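(* Let $n\geq1$ and $f(t)\in\mathbb{Z}[t]$, and let $$\mathcal{C}_{3,n}(f)=\{\mathcal{A}=(H_1,\dots,H_n)\in(\mathbb{P}^{2*})^n\mid H_i\neq H_j\ (i\neq j),\ \chi(\mathcal{A},t)=f(t)\}.$$ Then $\mathcal{C}_{3,n}(f)^{\mathrm{free}}=\{\mathcal{A}\in\mathcal{C}_{3,n}(f)\mid\mathcal{A}\text{ is free}\}$ is a Zariski open subset of $\mathcal{C}_{3,n}(f)$.
   Context: A point of $(\mathbb{P}^{2*})^n$ with distinct entries is identified with a central arrangement of $n$ distinct planes $H_i$ through the origin in $\mathbb{C}^3$ with defining linear forms $\alpha_i$. $L(\mathcal{A})$ is the set of nonempty intersections of the $H_i$ (including $\mathbb{C}^3$), ordered by reverse inclusion, with Möbius function $\mu(\mathbb{C}^3)=1$, $\mu(X)=-\sum_{Y<X}\mu(Y)$; $\chi(\mathcal{A},t)=\sum_{X\in L(\mathcal{A})}\mu(X)t^{\dim X}$. $\mathcal{A}$ is free if $D(\mathcal{A})=\{\delta\in\bigoplus_iS\partial_{x_i}\mid\delta\alpha_j\in(\alpha_j)\ \forall j\}$, $S=\mathbb{C}[x_1,x_2,x_3]$, is a free $S$-module. $\mathcal{C}_{3,n}(f)$ carries the Zariski topology induced from $(\mathbb{P}^{2*})^n$. *)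

theory Defs
  imports "HOL-Analysis.Analysis" "HOL-Computational_Algebra.Polynomial" "HOL-Library.Poly_Mapping"
begin

text \<open>A tuple of linear forms alpha_0,...,alpha_(n-1) on C^3 (nonzero vectors of C^3,
 representing points of the dual projective plane), indices i < n.\<close>

definition hyp :: "complex^3 \<Rightarrow> (complex^3) set" where
  "hyp a = {x. (\<Sum>k\<in>UNIV. a $ k * x $ k) = 0}"

definition proportional :: "complex^3 \<Rightarrow> complex^3 \<Rightarrow> bool" where
  "proportional a b \<longleftrightarrow> (\<exists>c. c \<noteq> 0 \<and> b = c *s a)"

text \<open>Intersection lattice L(A): all intersections of subfamilies (empty one gives C^3).\<close>
definition intlat :: "nat \<Rightarrow> (nat \<Rightarrow> complex^3) \<Rightarrow> (complex^3) set set" where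
  "intlat n \<alpha> = {\<Inter> (hyp ` \<alpha> ` I) | I. I \<subseteq> {..<n}}"

text \<open>Moebius function mu(C^3)=1, mu(X) = - sum over Y < X (Y strictly containing X),
 computed by recursion with fuel (fuel card L suffices since chains in L have length < card L).\<close>
primrec mob_fuel :: "nat \<Rightarrow> (complex^3) set set \<Rightarrow> (complex^3) set \<Rightarrow> int" where
  "mob_fuel 0 L X = (if X = UNIV then 1 else 0)"
| "mob_fuel (Suc k) L X = (if X = UNIV then 1
      else - (\<Sum>Y\<in>{Y\<in>L. X \<subset> Y}. mob_fuel k L Y))"

definition mobius :: "(complex^3) set set \<Rightarrow> (complex^3) set \<Rightarrow> int" where
  "mobius L X = mob_fuel (card L) L X"

definition charpoly :: "nat \<Rightarrow> (nat \<Rightarrow> complex^3) \<Rightarrow> int poly" where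
  "charpoly n \<alpha> = (\<Sum>X\<in>intlat n \<alpha>. monom (mobius (intlat n \<alpha>) X) (vec.dim X))"

text \<open>The polynomial ring S = C[x1,x2,x3], realised as iterated univariate polynomials.\<close>
type_synonym S = "complex poly poly poly"

definition constS :: "complex \<Rightarrow> S" where
  "constS c = [:[:[:c:]:]:]"

definition varS :: "3 \<Rightarrow> S" where
  "varS k = (if k = 1 then [:[:[:0, 1:]:]:] else if k = 2 then [:[:0, 1:]:] else [:0, 1:])"

definition linform :: "complex^3 \<Rightarrow> S" where
  "linform a = (\<Sum>k\<in>UNIV. constS (a $ k) * varS k)"

text \<open>A derivation delta = sum_k p_k d/dx_k is encoded by its coefficient vector p in S^3;
 delta(alpha) = sum_k p_k * a_k for the linear form alpha = sum_k a_k x_k.\<close>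
definition apply_der :: "S^3 \<Rightarrow> complex^3 \<Rightarrow> S" where
  "apply_der p a = (\<Sum>k\<in>UNIV. p $ k * constS (a $ k))"

definition derivation_module :: "nat \<Rightarrow> (nat \<Rightarrow> complex^3) \<Rightarrow> (S^3) set" where
  "derivation_module n \<alpha> = {p. \<forall>j<n. linform (\<alpha> j) dvd apply_der p (\<alpha> j)}"

definition is_free :: "nat \<Rightarrow> (nat \<Rightarrow> complex^3) \<Rightarrow> bool" where
  "is_free n \<alpha> \<longleftrightarrow> (\<exists>B. module.independent ((*s) :: S \<Rightarrow> S^3 \<Rightarrow> S^3) B \<and>
      module.span ((*s) :: S \<Rightarrow> S^3 \<Rightarrow> S^3) B = derivation_module n \<alpha>)"

text \<open>Points of C_{3,n}(f) via representatives.\<close>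
definition in_C :: "nat \<Rightarrow> int poly \<Rightarrow> (nat \<Rightarrow> complex^3) \<Rightarrow> bool" where
  "in_C n f \<alpha> \<longleftrightarrow> (\<forall>i<n. \<alpha> i \<noteq> 0) \<and>
     (\<forall>i<n. \<forall>j<n. i \<noteq> j \<longrightarrow> \<not> proportional (\<alpha> i) (\<alpha> j)) \<and> charpoly n \<alpha> = f"

text \<open>Polynomials in the 3n homogeneous coordinates (i,k), i<n, of (P^2*)^n.\<close>
type_synonym mpoly = "((nat \<times> 3) \<Rightarrow>\<^sub>0 nat) \<Rightarrow>\<^sub>0 complex"

definition mpeval :: "mpoly \<Rightarrow> (nat \<Rightarrow> complex^3) \<Rightarrow> complex" where
  "mpeval p \<alpha> = (\<Sum>m\<in>Poly_Mapping.keys p. Poly_Mapping.lookup p m * (\<Prod>v\<in>Poly_Mapping.keys m. (\<alpha> (fst v) $ snd v) ^ Poly_Mapping.lookup m v))"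

definition multihomogeneous :: "nat \<Rightarrow> mpoly \<Rightarrow> bool" where
  "multihomogeneous n p \<longleftrightarrow> (\<forall>m\<in>Poly_Mapping.keys p. \<forall>v\<in>Poly_Mapping.keys m. fst v < n) \<and>
     (\<exists>d :: nat \<Rightarrow> nat. \<forall>m\<in>Poly_Mapping.keys p. \<forall>i<n. (\<Sum>k\<in>UNIV. Poly_Mapping.lookup m (i, k)) = d i)"

text \<open>Zariski closed subsets of (P^2*)^n: common zero loci of sets of multihomogeneous
 polynomials; a subset of C_{3,n}(f) is open in the induced topology iff it is the
 intersection of C_{3,n}(f) with the complement of such a zero locus.\<close>

end

theory Submission
  imports Defs "HOL-Library.Function_Algebras"
begin

text \<open>Let D(d) denote the space of homogeneous derivations of degree d in the module D(A). By
 Saito's criterion, A is free iff there are three homogeneous elements of D(A) of total degree n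
 whose determinant does not vanish identically. To see that this persists near a free arrangement,
 one shows that dim D(d) is locally constant there for all d up to n.

 For d \<ge> n, deleting one plane after another computes dim D(d): passing from the first i planes to
 the first i+1 lowers it by d + 1 - i + p, where p is the number of lines in which the new plane
 meets the old ones. The numbers p add up to the linear coefficient of the characteristic
 polynomial, so dim D(n) is constant on the whole stratum. Let l be a generic linear form.
 Restriction to the plane l = 0 has kernel l D(d-1), and its image lies in the space of those plane
 fields that are tangent to all H_i along l = 0. The dimension of that space is upper semicontinuous
 in A, being the dimension of the kernel of a matrix with polynomial entries, and for a free
 arrangement the restriction map is onto it by Cramer's rule. Descending from d = n, the dimension
 of D(d) near a free arrangement is at least its value there, which is what is needed to extend the
 elements of a homogeneous basis to polynomial families of derivations.\<close>

section \<open>Ternary forms as functions\<close>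

text \<open>The obstacle is the direction of semicontinuity. D(d) is itself the kernel of a matrix
  with entries polynomial in the forms, so near a given arrangement dim D(d) can only drop, while an
  element of D(d) is sure to extend to a polynomial family only if it does not drop. Multiplication
  by l and restriction reverse the direction: dim D(d-1) is dim D(d) minus the dimension of the
  image, so an upper bound on the image is a lower bound on dim D(d-1). Hence the comparison with
  plane fields, whose dimension can also only drop, and hence the need for a degree in which dim
  D(d) is known exactly. Degree n serves as this start because the degrees of a homogeneous basis
  add up to n, so none of them exceeds n. The condition so obtained is the nonvanishing of a
  polynomial that need not be multihomogeneous. As freeness and the characteristic polynomial depend
  on the planes alone, the non-free part of the stratum is stable under rescaling each form, and
  every multihomogeneous component of that polynomial vanishes on it.\<close>

definition pairing :: "complex^3 \<Rightarrow> complex^3 \<Rightarrow> complex" where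
  "pairing a x = (\<Sum>k\<in>UNIV. a $ k * x $ k)"

lemma pairing_eq: "pairing a x = a$1 * x$1 + a$2 * x$2 + a$3 * x$3"
  by (simp add: pairing_def sum_3)

lemma mem_hyp: "x \<in> hyp a \<longleftrightarrow> pairing a x = 0"
  by (simp add: hyp_def pairing_def)

lemma pairing_simps:
  "pairing a (x + y) = pairing a x + pairing a y"
  "pairing a (x - y) = pairing a x - pairing a y"
  "pairing a (c *s x) = c * pairing a x"
  "pairing (a + b) x = pairing a x + pairing b x"
  "pairing (a - b) x = pairing a x - pairing b x"
  "pairing (c *s a) x = c * pairing a x"
  "pairing a 0 = 0"
  "pairing 0 x = 0"
  by (simp_all add: pairing_eq algebra_simps)

lemma pairing_commute: "pairing a b = pairing b a"
  by (simp add: pairing_eq mult.commute)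

definition crossC :: "complex^3 \<Rightarrow> complex^3 \<Rightarrow> complex^3" where
  "crossC a b = vector [a$2 * b$3 - a$3 * b$2, a$3 * b$1 - a$1 * b$3, a$1 * b$2 - a$2 * b$1]"

lemma crossC_nth [simp]:
  "crossC a b $ 1 = a$2 * b$3 - a$3 * b$2"
  "crossC a b $ 2 = a$3 * b$1 - a$1 * b$3"
  "crossC a b $ 3 = a$1 * b$2 - a$2 * b$1"
  by (simp_all add: crossC_def)

lemma pairing_crossC [simp]: "pairing a (crossC a y) = 0" "pairing y (crossC a y) = 0"
  by (simp_all add: pairing_eq algebra_simps)

lemma exists_pairing_one:
  assumes "a \<noteq> 0" shows "\<exists>w. pairing a w = 1"
proof -
  obtain k where "a $ k \<noteq> 0" using assms by (auto simp: vec_eq_iff)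
  moreover have "pairing a (axis k c) = a $ k * c" for c
    by (simp add: pairing_def axis_def if_distrib sum.delta cong: if_cong)
  ultimately have "pairing a (axis k (1 / a $ k)) = 1" by simp
  then show ?thesis by blast
qed

lemma crossC_eq_0_imp_proportional:
  assumes "a \<noteq> 0" "b \<noteq> 0" "crossC a b = 0"
  shows "proportional a b"
proof -
  have e: "a$2 * b$3 = a$3 * b$2" "a$3 * b$1 = a$1 * b$3" "a$1 * b$2 = a$2 * b$1"
    using assms(3) by (auto simp: vec_eq_iff forall_3)
  obtain k where k: "a $ k \<noteq> 0" using assms by (auto simp: vec_eq_iff)
  have "a $ k * b $ l = b $ k * a $ l" for l
    using exhaust_3[of k] exhaust_3[of l] e by (auto simp: mult.commute)
  then have "b = (b $ k / a $ k) *s a"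
    using k by (simp add: vec_eq_iff field_simps)
  moreover from this have "b $ k / a $ k \<noteq> 0" using assms(2) by auto
  ultimately show ?thesis unfolding proportional_def by blast
qed

lemma proportional_sym: "proportional a b \<Longrightarrow> proportional b a"
proof -
  assume "proportional a b"
  then obtain c where "c \<noteq> 0" "b = c *s a" by (auto simp: proportional_def)
  then have "inverse c \<noteq> 0 \<and> a = inverse c *s b" by (simp add: vec_eq_iff)
  then show ?thesis unfolding proportional_def by blast
qed

lemma exists_separating:
  assumes "a \<noteq> 0" "b \<noteq> 0" "\<not> proportional a b"
  shows "\<exists>w. pairing a w = 0 \<and> pairing b w = 1"
proof -
  have "crossC b a \<noteq> 0" using assms crossC_eq_0_imp_proportional proportional_sym by blast
  then obtain y where y: "pairing (crossC b a) y = 1" using exists_pairing_one by blast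
  have "pairing b (crossC a y) = pairing (crossC b a) y" by (simp add: pairing_eq algebra_simps)
  with y show ?thesis by (intro exI[of _ "crossC a y"]) simp
qed

lemma hyp_crossC:
  assumes "a \<noteq> 0" "x \<in> hyp a" shows "\<exists>y. x = crossC a y"
proof -
  obtain w where w: "pairing a w = 1" using exists_pairing_one assms by blast
  have ax: "pairing a x = 0" using assms by (simp add: mem_hyp)
  \<comment> \<open>the triple product identity a \<times> (x \<times> w) = (a w) x - (a x) w\<close>
  have "crossC a (crossC x w) = pairing a w *s x - pairing a x *s w"
    by (simp add: vec_eq_iff forall_3 pairing_eq algebra_simps)
  then show ?thesis using w ax by (intro exI[of _ "crossC x w"]) simp
qed

text \<open>Homogeneous polynomials are represented by their functions on C^3, so that equality is
  pointwise and restriction to planes and lines is immediate. The degree is an index, not an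
  attribute of the function: zero is a form of every degree.\<close>

inductive form :: "nat \<Rightarrow> (complex^3 \<Rightarrow> complex) \<Rightarrow> bool" where
  form_const: "form 0 (\<lambda>x. c)"
| form_add: "form j F \<Longrightarrow> form j G \<Longrightarrow> form j (\<lambda>x. F x + G x)"
| form_coord: "form j F \<Longrightarrow> form (Suc j) (\<lambda>x. x $ k * F x)"

lemma form_zero: "form j (\<lambda>x. 0)"
proof (induction j)
  case (Suc j)
  from form_coord[OF this, of 1] show ?case by simp
qed (rule form_const)

lemma form_cmult: "form j F \<Longrightarrow> form j (\<lambda>x. c * F x)"
proof (induction rule: form.induct)
  case (form_coord j F k)
  from form.form_coord[OF form_coord.IH, of k] show ?case by (simp add: mult.left_commute)
qed (auto simp: distrib_left intro: form.intros)

lemma form_sum: "(\<And>i. i \<in> I \<Longrightarrow> form j (F i)) \<Longrightarrow> form j (\<lambda>x. \<Sum>i\<in>I. F i x)"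
  by (induction I rule: infinite_finite_induct) (auto intro: form_zero form_add)

lemma form_mult: "form i F \<Longrightarrow> form j G \<Longrightarrow> form (i + j) (\<lambda>x. F x * G x)"
proof (induction rule: form.induct)
  case (form_coord i F k)
  from form.form_coord[OF form_coord.IH, of k] form_coord show ?case by (simp add: mult.assoc)
qed (auto simp: distrib_right intro: form.intros form_cmult)

lemma form_diff: "form j F \<Longrightarrow> form j G \<Longrightarrow> form j (\<lambda>x. F x - G x)"
  using form_add[of j F "\<lambda>x. -1 * G x"] form_cmult[of j G "-1"] by simp

lemma form_pairing: "form (Suc 0) (pairing a)"
proof -
  have "form (Suc 0) (\<lambda>x. \<Sum>k\<in>UNIV. a $ k * (x $ k * 1))"
    by (intro form_sum form_cmult form_coord form_const)
  then show ?thesis by (simp add: pairing_def[abs_def])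
qed

lemma form_pairing_mult: "form j F \<Longrightarrow> form (Suc j) (\<lambda>x. pairing a x * F x)"
  using form_mult[OF form_pairing] by simp

lemma form_pairing_power: "form m (\<lambda>x. pairing a x ^ m)"
  by (induction m) (auto intro: form_const form_pairing_mult)

lemma form_prod_pairing: "finite I \<Longrightarrow> form (card I) (\<lambda>x. \<Prod>i\<in>I. pairing (a i) x)"
  by (induction I rule: finite_induct) (auto intro: form_const form_pairing_mult)

lemma form_homogeneous: "form j F \<Longrightarrow> F (c *s x) = c ^ j * F x"
  by (induction rule: form.induct) (auto simp: algebra_simps)

lemma form_on_line: "form j F \<Longrightarrow> \<exists>p. degree p \<le> j \<and> (\<forall>t. poly p t = F (u + t *s v))"
proof (induction rule: form.induct)
  case (form_const c)
  then show ?case by (intro exI[of _ "[:c:]"]) simp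
next
  case (form_add j F G)
  then obtain p q where "degree p \<le> j \<and> (\<forall>t. poly p t = F (u + t *s v))"
    "degree q \<le> j \<and> (\<forall>t. poly q t = G (u + t *s v))" by blast
  then show ?case by (intro exI[of _ "p + q"]) (auto intro: degree_add_le)
next
  case (form_coord j F k)
  then obtain p where p: "degree p \<le> j" "\<forall>t. poly p t = F (u + t *s v)" by blast
  have "degree ([:u $ k, v $ k:] * p) \<le> Suc j"
    using degree_mult_le[of "[:u $ k, v $ k:]" p] p(1) by (auto split: if_splits)
  with p show ?case by (intro exI[of _ "[:u $ k, v $ k:] * p"]) (auto simp: algebra_simps)
qed

lemma form_projection: "form j F \<Longrightarrow> form j (\<lambda>x. F (x - pairing a x *s w))"
proof (induction rule: form.induct)
  case (form_coord j F k)
  let ?F = "\<lambda>x. F (x - pairing a x *s w)"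
  have "form (Suc j) (\<lambda>x. x $ k * ?F x - w $ k * (pairing a x * ?F x))"
    by (intro form_diff form.form_coord form_cmult form_pairing_mult form_coord.IH)
  then show ?case by (simp add: algebra_simps)
qed (auto intro: form.intros)

text \<open>With x' = x - a(x) w, the quotient is built by the product rule x_k F(x) - x'_k F(x') =
  x_k (F(x) - F(x')) + a(x) w_k F(x'). Degree 0 is a separate case: the difference is then 0 and
  there is no lower degree for its quotient.\<close>

lemma form_diff_projection:
  assumes "form j F"
  shows "\<exists>G. (\<forall>x. F x - F (x - pairing a x *s w) = pairing a x * G x) \<and>
    (case j of 0 \<Rightarrow> G = (\<lambda>x. 0) | Suc i \<Rightarrow> form i G)"
  using assms
proof (induction rule: form.induct)
  case (form_add j F F')
  then obtain G G' where G: "\<And>x. F x - F (x - pairing a x *s w) = pairing a x * G x"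
      "case j of 0 \<Rightarrow> G = (\<lambda>x. 0) | Suc i \<Rightarrow> form i G"
    and G': "\<And>x. F' x - F' (x - pairing a x *s w) = pairing a x * G' x"
      "case j of 0 \<Rightarrow> G' = (\<lambda>x. 0) | Suc i \<Rightarrow> form i G'"
    by blast
  have "\<forall>x. F x + F' x - (F (x - pairing a x *s w) + F' (x - pairing a x *s w))
      = pairing a x * (G x + G' x)"
    using G(1) G'(1) by (simp add: distrib_left add_diff_add)
  then show ?case using G(2) G'(2)
    by (intro exI[of _ "\<lambda>x. G x + G' x"]) (auto split: nat.splits intro: form.form_add)
next
  case (form_coord j F k)
  then obtain G where G: "\<And>x. F x - F (x - pairing a x *s w) = pairing a x * G x"
    "case j of 0 \<Rightarrow> G = (\<lambda>x. 0) | Suc i \<Rightarrow> form i G"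
    by blast
  let ?F = "\<lambda>x. F (x - pairing a x *s w)"
  have 1: "form j (\<lambda>x. x $ k * G x)"
    using G(2) form_zero[of 0] by (auto split: nat.splits intro: form.form_coord)
  have "x $ k * F x - (x - pairing a x *s w) $ k * ?F x = pairing a x * (x $ k * G x + w $ k * ?F x)"
    for x
  proof -
    have "x $ k * F x - (x - pairing a x *s w) $ k * ?F x
        = x $ k * (F x - ?F x) + pairing a x * (w $ k * ?F x)"
      by (simp add: algebra_simps)
    then show ?thesis by (simp only: G(1)) (simp add: algebra_simps)
  qed
  moreover have "form j (\<lambda>x. x $ k * G x + w $ k * ?F x)"
    using 1 form_projection[OF form_coord.hyps] by (intro form.form_add form_cmult)
  ultimately show ?case by (intro exI[of _ "\<lambda>x. x $ k * G x + w $ k * ?F x"]) simp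
qed auto

text \<open>For a(w) = 1 the point x - a(x) w lies on the plane of \<open>a\<close>, where F
  vanishes, so F(x) equals the difference just divided by a(x). In degree 0 the quotient is the zero
  form, which suits the truncated \<open>j - 1\<close>.\<close>

lemma form_vanishing:
  assumes "form j F" "a \<noteq> 0" "\<And>x. x \<in> hyp a \<Longrightarrow> F x = 0"
  shows "\<exists>G. form (j - 1) G \<and> (\<forall>x. F x = pairing a x * G x)"
proof -
  obtain w where w: "pairing a w = 1" using exists_pairing_one assms by blast
  obtain G where G: "\<And>x. F x - F (x - pairing a x *s w) = pairing a x * G x"
    "case j of 0 \<Rightarrow> G = (\<lambda>x. 0) | Suc i \<Rightarrow> form i G"
    using form_diff_projection[OF assms(1)] by blast
  have "F (x - pairing a x *s w) = 0" for x
    by (rule assms(3)) (simp add: mem_hyp pairing_simps w)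
  with G form_zero[of 0] show ?thesis by (intro exI[of _ G]) (auto split: nat.splits)
qed

section \<open>Division by several linear forms\<close>

lemma poly_eq_0_cofinite:
  fixes p :: "complex poly"
  assumes "finite T" "\<And>t. t \<notin> T \<Longrightarrow> poly p t = 0"
  shows "p = 0"
proof (rule ccontr)
  assume "p \<noteq> 0"
  then have "finite (T \<union> {t. poly p t = 0})" using assms(1) poly_roots_finite by blast
  moreover have "T \<union> {t. poly p t = 0} = UNIV" using assms(2) by blast
  ultimately show False using infinite_UNIV_char_0 by metis
qed

text \<open>The line from x in a direction y with b(y) = 0 and a(y) = 1 stays in the plane of
  \<open>b\<close> and meets the plane of \<open>a\<close> in a single point, so the polynomial of G
  on this line is zero off one parameter. Stating the hypothesis as polynomiality on lines makes the
  lemma serve forms and elements of \<open>S\<close> alike.\<close>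

lemma vanishing_cancel:
  assumes line: "\<And>u v. \<exists>p. \<forall>t. poly p t = G (u + t *s v)"
    and "a \<noteq> 0" "b \<noteq> 0" "\<not> proportional a b"
    and zero: "\<And>x. x \<in> hyp b \<Longrightarrow> pairing a x * G x = 0" and x: "x \<in> hyp b"
  shows "G x = 0"
proof -
  obtain y where y: "pairing b y = 0" "pairing a y = 1"
    using exists_separating[of b a] assms proportional_sym by blast
  obtain p where p: "\<And>t. poly p t = G (x + t *s y)" using line by blast
  have "poly p t = 0" if "t \<notin> {- pairing a x}" for t
  proof -
    have "x + t *s y \<in> hyp b" using x y by (simp add: mem_hyp pairing_simps)
    moreover have "pairing a (x + t *s y) \<noteq> 0"
      using that y by (auto simp: pairing_simps add_eq_0_iff)
    ultimately show ?thesis using zero p by fastforce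
  qed
  then have "p = 0" by (intro poly_eq_0_cofinite[of "{- pairing a x}"]) auto
  with p[of 0] show ?thesis by simp
qed

text \<open>The linear factors are split off one at a time; \<open>vanishing_cancel\<close> ensures
  that the quotient still vanishes on the remaining planes. If j < \<open>card I\<close>, the degree
  of the quotient is truncated to 0, which by itself does not say that F is zero.\<close>

lemma form_vanishing_prod:
  assumes "finite I" "form j F" "\<And>i. i \<in> I \<Longrightarrow> a i \<noteq> 0"
    "\<And>i i'. i \<in> I \<Longrightarrow> i' \<in> I \<Longrightarrow> i \<noteq> i' \<Longrightarrow> \<not> proportional (a i) (a i')"
    "\<And>i x. i \<in> I \<Longrightarrow> x \<in> hyp (a i) \<Longrightarrow> F x = 0"
  shows "\<exists>G. form (j - card I) G \<and> (\<forall>x. F x = (\<Prod>i\<in>I. pairing (a i) x) * G x)"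
  using assms
proof (induction I arbitrary: j F rule: finite_induct)
  case empty
  then show ?case by auto
next
  case (insert m I)
  obtain G where G: "form (j - 1) G" "\<And>x. F x = pairing (a m) x * G x"
    using form_vanishing[of j F "a m"] insert.prems by blast
  have "G x = 0" if "i \<in> I" "x \<in> hyp (a i)" for i x
  proof (rule vanishing_cancel)
    show "a m \<noteq> 0" "a i \<noteq> 0" "\<not> proportional (a m) (a i)" "x \<in> hyp (a i)"
      using insert.prems(2,3) insert.hyps(2) that by blast+
    show "pairing (a m) x * G x = 0" if "x \<in> hyp (a i)" for x
      using insert.prems(4)[of i x] that \<open>i \<in> I\<close> G(2) by simp
    show "\<exists>p. \<forall>t. poly p t = G (u + t *s v)" for u v using form_on_line[OF G(1)] by blast
  qed
  then obtain H where "form (j - 1 - card I) H" "\<And>x. G x = (\<Prod>i\<in>I. pairing (a i) x) * H x"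
    using insert.IH[OF G(1)] insert.prems by blast
  with insert.hyps G(2) show ?case by (intro exI[of _ H]) (simp add: mult.assoc)
qed

lemma poly_as_sum:
  fixes p :: "complex poly"
  assumes "degree p \<le> j" shows "poly p t = (\<Sum>m\<le>j. coeff p m * t ^ m)"
  unfolding poly_altdef using assms
  by (intro sum.mono_neutral_left) (auto simp: coeff_eq_0 not_le)

text \<open>F is the homogenisation of p in degree j, with \<open>pairing a\<close> and
  \<open>pairing b\<close> as the coordinates dual to u and v; the points u + t v form the affine
  chart in which the first coordinate is 1.\<close>

lemma form_of_poly:
  assumes "pairing a u = 1" "pairing a v = 0" "pairing b u = 0" "pairing b v = 1" "degree p \<le> j"
  shows "\<exists>F. form j F \<and> (\<forall>t. F (u + t *s v) = poly p t)"
proof (intro exI conjI allI)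
  let ?F = "\<lambda>x. \<Sum>m\<le>j. coeff p m * (pairing b x ^ m * pairing a x ^ (j - m))"
  have "form j (\<lambda>x. pairing b x ^ m * pairing a x ^ (j - m))" if "m \<le> j" for m
    using form_mult[OF form_pairing_power[of m b] form_pairing_power[of "j - m" a]] that by simp
  then show "form j ?F" by (intro form_sum form_cmult) auto
  show "?F (u + t *s v) = poly p t" for t
    using assms poly_as_sum[OF assms(5), of t] by (simp add: pairing_simps)
qed

section \<open>Polynomials as functions\<close>

text \<open>The type nests x3 outermost and x1 innermost, as in \<open>varS\<close>, so x3 is
  substituted first, as a constant of the inner ring.\<close>

definition evalS :: "S \<Rightarrow> complex^3 \<Rightarrow> complex" where
  "evalS p x = poly (poly (poly p [:[:x $ 3:]:]) [:x $ 2:]) (x $ 1)"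

lemma evalS_simps [simp]:
  "evalS 0 x = 0" "evalS 1 x = 1" "evalS (p + q) x = evalS p x + evalS q x"
  "evalS (p - q) x = evalS p x - evalS q x"
  "evalS (- p) x = - evalS p x"
  "evalS (p * q) x = evalS p x * evalS q x" "evalS (constS c) x = c"
  by (simp_all add: evalS_def constS_def)

lemma evalS_sum: "evalS (\<Sum>i\<in>I. p i) x = (\<Sum>i\<in>I. evalS (p i) x)"
  by (induction I rule: infinite_finite_induct) auto

lemma evalS_prod: "evalS (\<Prod>i\<in>I. p i) x = (\<Prod>i\<in>I. evalS (p i) x)"
  by (induction I rule: infinite_finite_induct) auto

lemma evalS_varS [simp]: "evalS (varS k) x = x $ k"
  using exhaust_3[of k] by (auto simp: evalS_def varS_def)

lemma evalS_linform [simp]: "evalS (linform a) x = pairing a x"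
  by (simp add: linform_def pairing_def evalS_sum)

lemma poly_eq_0I_infinite:
  fixes p :: "'a::idom poly"
  assumes "infinite T" "\<And>t. t \<in> T \<Longrightarrow> poly p t = 0"
  shows "p = 0"
proof (rule ccontr)
  assume "p \<noteq> 0"
  then have "finite {t. poly p t = 0}" by (rule poly_roots_finite)
  then have "finite T" by (rule finite_subset[rotated]) (use assms in auto)
  with assms show False by simp
qed

lemma evalS_eq_0:
  assumes "\<And>x. evalS p x = 0" shows "p = 0"
proof -
  have inf: "infinite (range (\<lambda>c::complex. [:c:]))" "infinite (range (\<lambda>c::complex. [:[:c:]:]))"
    by (auto simp: finite_image_iff inj_on_def infinite_UNIV_char_0)
  have "poly (poly (poly p [:[:c:]:]) [:b:]) a = 0" for a b c
    using assms[of "vector [a, b, c]"] by (simp add: evalS_def)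
  then have "poly (poly p [:[:c:]:]) [:b:] = 0" for b c
    by (intro poly_eq_0I_infinite[of UNIV]) (auto simp: infinite_UNIV_char_0)
  then have "poly p [:[:c:]:] = 0" for c
    by (intro poly_eq_0I_infinite[OF inf(1)]) auto
  then show ?thesis
    by (intro poly_eq_0I_infinite[OF inf(2)]) auto
qed

lemma evalS_inject: "(\<And>x. evalS p x = evalS q x) \<Longrightarrow> p = q"
  using evalS_eq_0[of "p - q"] by simp

text \<open>A decomposition into homogeneous components. The family \<open>F\<close> is defined in
  every degree and zero beyond \<open>N\<close>, so that two decompositions can be brought to a
  common range and added.\<close>

definition formsum :: "(complex^3 \<Rightarrow> complex) \<Rightarrow> bool" where
  "formsum g \<longleftrightarrow> (\<exists>N F. (\<forall>j. form j (F j)) \<and> (\<forall>j>N. F j = (\<lambda>x. 0)) \<and> (\<forall>x. g x = (\<Sum>j\<le>N. F j x)))"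

lemma formsum_const: "formsum (\<lambda>x. c)"
  unfolding formsum_def
  by (rule exI[of _ 0], rule exI[of _ "\<lambda>j. if j = 0 then (\<lambda>x. c) else (\<lambda>x. 0)"])
     (auto intro: form_const form_zero)

lemma sum_atMost_extend:
  fixes f :: "nat \<Rightarrow> complex"
  assumes "M \<le> N" "\<And>j. j > M \<Longrightarrow> f j = 0" shows "(\<Sum>j\<le>M. f j) = (\<Sum>j\<le>N. f j)"
  by (rule sum.mono_neutral_left) (use assms in auto)

lemma formsum_add:
  assumes "formsum g" "formsum h" shows "formsum (\<lambda>x. g x + h x)"
proof -
  obtain N F where F: "\<And>j. form j (F j)" "\<And>j. j > N \<Longrightarrow> F j = (\<lambda>x. 0)" "\<And>x. g x = (\<Sum>j\<le>N. F j x)"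
    using assms(1) unfolding formsum_def by blast
  obtain M H where H: "\<And>j. form j (H j)" "\<And>j. j > M \<Longrightarrow> H j = (\<lambda>x. 0)" "\<And>x. h x = (\<Sum>j\<le>M. H j x)"
    using assms(2) unfolding formsum_def by blast
  have "g x = (\<Sum>j\<le>N+M. F j x)" "h x = (\<Sum>j\<le>N+M. H j x)" for x
    unfolding F(3) H(3) by (rule sum_atMost_extend; simp add: F(2) H(2))+
  then show ?thesis unfolding formsum_def
    by (intro exI[of _ "N+M"] exI[of _ "\<lambda>j x. F j x + H j x"])
       (auto simp: sum.distrib F(1) H(1) F(2) H(2) intro: form_add)
qed

lemma formsum_coord:
  assumes "formsum g" shows "formsum (\<lambda>x. x $ k * g x)"
proof -
  obtain N F where F: "\<And>j. form j (F j)" "\<And>j. j > N \<Longrightarrow> F j = (\<lambda>x. 0)" "\<And>x. g x = (\<Sum>j\<le>N. F j x)"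
    using assms(1) unfolding formsum_def by blast
  define H where "H j = (case j of 0 \<Rightarrow> (\<lambda>x. 0) | Suc i \<Rightarrow> (\<lambda>x. x $ k * F i x))" for j
  have "form j (H j)" for j
    by (cases j) (auto simp: H_def intro: form_zero form_coord F)
  moreover have "H j = (\<lambda>x. 0)" if "j > Suc N" for j
    using that by (cases j) (auto simp: H_def F)
  moreover have "x $ k * g x = (\<Sum>j\<le>Suc N. H j x)" for x
    unfolding sum.atMost_Suc_shift by (simp add: H_def F(3) sum_distrib_left)
  ultimately show ?thesis unfolding formsum_def by blast
qed

lemma formsum_evalS: "formsum (evalS p)"
proof -
  have 1: "formsum (\<lambda>x. poly p (x $ 1))" for p :: "complex poly"
    by (induction p) (auto intro: formsum_const formsum_add formsum_coord)
  have 2: "formsum (\<lambda>x. poly (poly p [:x $ 2:]) (x $ 1))" for p :: "complex poly poly"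
    by (induction p) (auto intro: formsum_const formsum_add formsum_coord 1)
  have 3: "formsum (\<lambda>x. poly (poly (poly p [:[:x $ 3:]:]) [:x $ 2:]) (x $ 1))" for p :: S
    by (induction p) (auto intro: formsum_const formsum_add formsum_coord 2)
  then show ?thesis by (simp add: evalS_def[abs_def])
qed

lemma power_sum_eq_0:
  fixes c :: "nat \<Rightarrow> complex"
  assumes "\<And>t. (\<Sum>j\<le>N. t ^ j * c j) = 0" "j \<le> N"
  shows "c j = 0"
  using assms polyfun_eq_0[of c N] by (simp add: mult.commute)

lemma evalS_components:
  obtains N F where "\<And>j. form j (F j)" "\<And>j. j > N \<Longrightarrow> F j = (\<lambda>x. 0)" "\<And>x. evalS p x = (\<Sum>j\<le>N. F j x)"
    "\<And>x t. evalS p (t *s x) = (\<Sum>j\<le>N. t ^ j * F j x)"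
proof -
  obtain N F where F: "\<And>j. form j (F j)" "\<And>j. j > N \<Longrightarrow> F j = (\<lambda>x. 0)"
    "\<And>x. evalS p x = (\<Sum>j\<le>N. F j x)"
    using formsum_evalS[of p] unfolding formsum_def by blast
  moreover have "evalS p (t *s x) = (\<Sum>j\<le>N. t ^ j * F j x)" for x t
    unfolding F(3) by (intro sum.cong refl form_homogeneous F(1))
  ultimately show ?thesis using that by blast
qed

lemma evalS_on_line: "\<exists>q. \<forall>t. poly q t = evalS p (u + t *s v)"
proof -
  obtain N F where F: "\<And>j. form j (F j)" "\<And>x. evalS p x = (\<Sum>j\<le>N. F j x)"
    using evalS_components[of p] by metis
  have "\<forall>j. \<exists>q. \<forall>t. poly q t = F j (u + t *s v)" using form_on_line[OF F(1)] by blast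
  then obtain q where "\<And>j t. poly (q j) t = F j (u + t *s v)" by metis
  then have "\<forall>t. poly (\<Sum>j\<le>N. q j) t = evalS p (u + t *s v)" by (simp add: poly_sum F(2))
  then show ?thesis by blast
qed

lemma form_imp_evalS: "form j F \<Longrightarrow> \<exists>p. \<forall>x. evalS p x = F x"
proof (induction rule: form.induct)
  case (form_const c)
  show ?case by (intro exI[of _ "constS c"]) simp
next
  case (form_add j F G)
  then obtain p q where "\<forall>x. evalS p x = F x" "\<forall>x. evalS q x = G x" by blast
  then show ?case by (intro exI[of _ "p + q"]) simp
next
  case (form_coord j F k)
  then obtain p where "\<forall>x. evalS p x = F x" by blast
  then show ?case by (intro exI[of _ "varS k * p"]) simp
qed

text \<open>The plane contains t x along with x, so comparing powers of t shows that each
  homogeneous component vanishes on it; the components are divided separately by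
  \<open>form_vanishing\<close> and their quotients lifted back to \<open>S\<close>.\<close>

lemma linform_dvd_iff:
  assumes "a \<noteq> 0"
  shows "linform a dvd p \<longleftrightarrow> (\<forall>x\<in>hyp a. evalS p x = 0)"
proof
  assume "linform a dvd p"
  then show "\<forall>x\<in>hyp a. evalS p x = 0" by (auto simp: mem_hyp)
next
  assume zero: "\<forall>x\<in>hyp a. evalS p x = 0"
  obtain N F where F: "\<And>j. form j (F j)" "\<And>x. evalS p x = (\<Sum>j\<le>N. F j x)"
    "\<And>x t. evalS p (t *s x) = (\<Sum>j\<le>N. t ^ j * F j x)" using evalS_components[of p] by metis
  have "F j x = 0" if "j \<le> N" "x \<in> hyp a" for j x
  proof (rule power_sum_eq_0[where N = N and c = "\<lambda>j. F j x"])
    fix t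
    have "t *s x \<in> hyp a" using that by (simp add: mem_hyp pairing_simps)
    then show "(\<Sum>j\<le>N. t ^ j * F j x) = 0" using zero F(3) by metis
  qed fact
  then have "\<exists>G. form (j - 1) G \<and> (\<forall>x. F j x = pairing a x * G x)" if "j \<le> N" for j
    using form_vanishing[OF F(1) assms] that by blast
  then have "\<forall>j. \<exists>q. j \<le> N \<longrightarrow> (\<forall>x. F j x = pairing a x * evalS q x)"
    using form_imp_evalS by metis
  then obtain q where q: "\<And>j x. j \<le> N \<Longrightarrow> F j x = pairing a x * evalS (q j) x" by metis
  have "p = linform a * (\<Sum>j\<le>N. q j)"
    by (rule evalS_inject) (simp add: F(2) q evalS_sum sum_distrib_left)
  then show "linform a dvd p" by simp
qed

text \<open>Primality of a linear form. If p and q are nonzero at points x and y of the plane, then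
  on the line joining them, which lies in the plane, both are nonzero polynomials in one variable,
  and so is their product.\<close>

lemma linform_dvd_mult:
  assumes "a \<noteq> 0" "linform a dvd p * q"
  shows "linform a dvd p \<or> linform a dvd q"
proof (rule ccontr)
  assume "\<not> ?thesis"
  then obtain x y where xy: "x \<in> hyp a" "evalS p x \<noteq> 0" "y \<in> hyp a" "evalS q y \<noteq> 0"
    using linform_dvd_iff[OF assms(1)] by blast
  obtain r s where r: "\<And>t. poly r t = evalS p (x + t *s (y - x))"
    and s: "\<And>t. poly s t = evalS q (x + t *s (y - x))"
    using evalS_on_line by metis
  have "poly (r * s) t = 0" for t
  proof -
    have "x + t *s (y - x) \<in> hyp a" using xy by (simp add: mem_hyp pairing_simps)
    then show ?thesis using assms linform_dvd_iff[OF assms(1), of "p * q"] by (simp add: r s)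
  qed
  then have "r * s = 0" by (metis poly_all_0_iff_0)
  moreover have "r \<noteq> 0" using r[of 0] xy by auto
  moreover have "s \<noteq> 0" using s[of 1] xy by auto
  ultimately show False by simp
qed

lemma linform_nonzero: "a \<noteq> 0 \<Longrightarrow> linform a \<noteq> 0"
  using exists_pairing_one[of a] evalS_linform[of a] by fastforce

lemma prod_linform_dvd:
  assumes "finite I" "\<And>i. i \<in> I \<Longrightarrow> a i \<noteq> 0"
    "\<And>i i'. i \<in> I \<Longrightarrow> i' \<in> I \<Longrightarrow> i \<noteq> i' \<Longrightarrow> \<not> proportional (a i) (a i')"
    "\<And>i x. i \<in> I \<Longrightarrow> x \<in> hyp (a i) \<Longrightarrow> evalS p x = 0"
  shows "(\<Prod>i\<in>I. linform (a i)) dvd p"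
  using assms
proof (induction I arbitrary: p rule: finite_induct)
  case empty
  then show ?case by simp
next
  case (insert m I)
  have "linform (a m) dvd p"
    using insert.prems(1)[of m] insert.prems(3)[of m] by (subst linform_dvd_iff) auto
  then obtain q where q: "p = linform (a m) * q" by (rule dvdE)
  have "evalS q x = 0" if "i \<in> I" "x \<in> hyp (a i)" for i x
  proof (rule vanishing_cancel[OF evalS_on_line])
    show "a m \<noteq> 0" "a i \<noteq> 0" "\<not> proportional (a m) (a i)" "x \<in> hyp (a i)"
      using insert.prems(1,2) insert.hyps(2) that by blast+
    show "pairing (a m) x * evalS q x = 0" if "x \<in> hyp (a i)" for x
      using insert.prems(3)[of i x] that \<open>i \<in> I\<close> by (simp add: q)
  qed
  then have "(\<Prod>i\<in>I. linform (a i)) dvd q" using insert by blast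
  with q insert.hyps show ?case by (simp add: mult_dvd_mono)
qed

lemma unit_S_constS:
  assumes "g dvd (1::S)" shows "\<exists>c. c \<noteq> 0 \<and> g = constS c"
  using assms unfolding is_unit_poly_iff constS_def by auto

section \<open>Saito's criterion\<close>

text \<open>The 3 by 3 determinant with rows a, b, c, over any commutative ring so as to apply both
  to polynomial vectors and to their values.\<close>

definition tdet :: "'a::comm_ring_1^3 \<Rightarrow> 'a^3 \<Rightarrow> 'a^3 \<Rightarrow> 'a" where
  "tdet a b c = a$1 * (b$2 * c$3 - b$3 * c$2) + a$2 * (b$3 * c$1 - b$1 * c$3)
     + a$3 * (b$1 * c$2 - b$2 * c$1)"

lemma tdet_cramer: "tdet a b c *s p = tdet p b c *s a + tdet a p c *s b + tdet a b p *s c"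
  by (simp add: vec_eq_iff forall_3 tdet_def algebra_simps)

lemma tdet_linear:
  "tdet (a + a') b c = tdet a b c + tdet a' b c" "tdet (s *s a) b c = s * tdet a b c"
  "tdet a (b + b') c = tdet a b c + tdet a b' c" "tdet a (s *s b) c = s * tdet a b c"
  "tdet a b (c + c') = tdet a b c + tdet a b c'" "tdet a b (s *s c) = s * tdet a b c"
  "tdet 0 b c = 0" "tdet a 0 c = 0" "tdet a b 0 = 0"
  by (simp_all add: tdet_def algebra_simps)

lemma tdet_degenerate: "tdet a a c = 0" "tdet a b a = 0" "tdet a b b = 0"
  by (simp_all add: tdet_def algebra_simps)

lemma tdet_swap: "tdet b a c = - tdet a b c" "tdet a c b = - tdet a b c" "tdet c b a = - tdet a b c"
  "tdet b c a = tdet a b c" "tdet c a b = tdet a b c"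
  by (simp_all add: tdet_def algebra_simps)

lemma tdet_sum: "tdet (\<Sum>i\<in>I. f i) b c = (\<Sum>i\<in>I. tdet (f i) b c)"
  "tdet a (\<Sum>i\<in>I. f i) c = (\<Sum>i\<in>I. tdet a (f i) c)"
  "tdet a b (\<Sum>i\<in>I. f i) = (\<Sum>i\<in>I. tdet a b (f i))"
  by (induction I rule: infinite_finite_induct) (auto simp: tdet_linear)

lemma tdet_sum3: "tdet (\<Sum>i\<in>I. f i) (\<Sum>j\<in>J. g j) (\<Sum>k\<in>K. h k)
    = (\<Sum>i\<in>I. \<Sum>j\<in>J. \<Sum>k\<in>K. tdet (f i) (g j) (h k))"
  by (simp only: tdet_sum(1), simp only: tdet_sum(2), simp only: tdet_sum(3))

lemma tdet_plane:
  fixes e :: "complex^3"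
  assumes "e \<noteq> 0" "pairing e a = 0" "pairing e b = 0" "pairing e c = 0"
  shows "tdet a b c = 0"
proof -
  have "e $ 1 * tdet a b c = pairing e a * (b$2 * c$3 - b$3 * c$2) - pairing e b * (a$2 * c$3 - a$3 * c$2)
      + pairing e c * (a$2 * b$3 - a$3 * b$2)"
    "e $ 2 * tdet a b c = pairing e a * (b$3 * c$1 - b$1 * c$3) - pairing e b * (a$3 * c$1 - a$1 * c$3)
      + pairing e c * (a$3 * b$1 - a$1 * b$3)"
    "e $ 3 * tdet a b c = pairing e a * (b$1 * c$2 - b$2 * c$1) - pairing e b * (a$1 * c$2 - a$2 * c$1)
      + pairing e c * (a$1 * b$2 - a$2 * b$1)"
    by (simp_all add: tdet_def pairing_eq algebra_simps)
  with assms show ?thesis by (auto simp: vec_eq_iff forall_3)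
qed

lemma exists_nonproportional:
  assumes "a \<noteq> 0" shows "\<exists>b. b \<noteq> 0 \<and> \<not> proportional a b"
proof -
  obtain k where k: "a $ k \<noteq> 0" using assms by (auto simp: vec_eq_iff)
  obtain l :: 3 where l: "l \<noteq> k" by (metis num1_eq_iff one_neq_zero zero_neq_one)
  have "\<not> proportional a (axis l 1)"
  proof
    assume "proportional a (axis l 1)"
    then obtain c where c: "c \<noteq> 0" "axis l 1 = c *s a" by (auto simp: proportional_def)
    from arg_cong[OF c(2), of "\<lambda>v. v $ k"] l k c(1) show False by (simp add: axis_def)
  qed
  moreover have "axis l (1::complex) \<noteq> 0" by (simp add: axis_eq_0_iff)
  ultimately show ?thesis by blast
qed

lemma exists_adapted_basis:
  assumes "a \<noteq> 0"
  shows "\<exists>v1 v2 w. pairing a v1 = 0 \<and> pairing a v2 = 0 \<and> pairing a w = 1 \<and> tdet v1 v2 w = 1"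
proof -
  obtain w where w: "pairing a w = 1" using exists_pairing_one assms by blast
  obtain b where b: "b \<noteq> 0" "\<not> proportional a b" using exists_nonproportional assms by blast
  obtain v where v: "pairing a v = 0" "pairing b v = 1" using exists_separating assms b by blast
  have "tdet v (crossC a b) w = pairing b v * pairing a w - pairing a v * pairing b w"
    by (simp add: tdet_def pairing_eq algebra_simps)
  with w v show ?thesis by (intro exI[of _ v] exI[of _ "crossC a b"] exI[of _ w]) simp
qed

section \<open>Derivations of an arrangement, as polynomial vectors and degree by degree\<close>

definition arrangement :: "nat \<Rightarrow> (nat \<Rightarrow> complex^3) \<Rightarrow> bool" where
  "arrangement n \<alpha> \<longleftrightarrow> (\<forall>i<n. \<alpha> i \<noteq> 0) \<and> (\<forall>i<n. \<forall>j<n. i \<noteq> j \<longrightarrow> \<not> proportional (\<alpha> i) (\<alpha> j))"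

lemma arrangementD:
  assumes "arrangement n \<alpha>"
  shows "i < n \<Longrightarrow> \<alpha> i \<noteq> 0" "i < n \<Longrightarrow> j < n \<Longrightarrow> i \<noteq> j \<Longrightarrow> \<not> proportional (\<alpha> i) (\<alpha> j)"
  using assms by (auto simp: arrangement_def)

definition evalV :: "S^3 \<Rightarrow> complex^3 \<Rightarrow> complex^3" where
  "evalV p x = (\<chi> k. evalS (p $ k) x)"

lemma evalV_nth [simp]: "evalV p x $ k = evalS (p $ k) x"
  by (simp add: evalV_def)

lemma evalS_tdet: "evalS (tdet a b c) x = tdet (evalV a x) (evalV b x) (evalV c x)"
  by (simp add: tdet_def)

lemma derivation_module_iff:
  assumes "arrangement n \<alpha>"
  shows "p \<in> derivation_module n \<alpha> \<longleftrightarrow> (\<forall>i<n. \<forall>x\<in>hyp (\<alpha> i). pairing (\<alpha> i) (evalV p x) = 0)"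
proof -
  have "evalS (apply_der p a) x = pairing a (evalV p x)" for a x
    by (simp add: apply_der_def evalS_sum pairing_def mult.commute)
  then show ?thesis
    using linform_dvd_iff arrangementD(1)[OF assms] by (simp add: derivation_module_def)
qed

text \<open>A vector field is encoded by its coefficients as a scalar function of the component and the
 point, so that all spaces of vector fields are spaces of functions with values in C.\<close>

definition vfield :: "nat \<Rightarrow> (3 \<times> (complex^3) \<Rightarrow> complex) \<Rightarrow> bool" where
  "vfield d \<xi> \<longleftrightarrow> (\<forall>k. form d (\<lambda>x. \<xi> (k, x)))"

definition vval :: "(3 \<times> (complex^3) \<Rightarrow> complex) \<Rightarrow> complex^3 \<Rightarrow> complex^3" where
  "vval \<xi> x = (\<chi> k. \<xi> (k, x))"

lemma vval_nth [simp]: "vval \<xi> x $ k = \<xi> (k, x)"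
  by (simp add: vval_def)

definition logder :: "nat \<Rightarrow> (nat \<Rightarrow> complex^3) \<Rightarrow> nat \<Rightarrow> (3 \<times> (complex^3) \<Rightarrow> complex) set" where
  "logder n \<alpha> d = {\<xi>. vfield d \<xi> \<and> (\<forall>i<n. \<forall>x\<in>hyp (\<alpha> i). pairing (\<alpha> i) (vval \<xi> x) = 0)}"

lemma form_tdet:
  assumes "vfield d1 \<xi>1" "vfield d2 \<xi>2" "vfield d3 \<xi>3"
  shows "form (d1 + d2 + d3) (\<lambda>x. tdet (vval \<xi>1 x) (vval \<xi>2 x) (vval \<xi>3 x))"
proof -
  have "form (d1 + (d2 + d3)) (\<lambda>x. tdet (vval \<xi>1 x) (vval \<xi>2 x) (vval \<xi>3 x))"
    using assms unfolding tdet_def vval_nth vfield_def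
    by (intro form_add form_mult form_diff) auto
  then show ?thesis by (simp add: add.assoc)
qed

lemma form_0_const: "form 0 F \<Longrightarrow> \<exists>c. \<forall>x. F x = c"
  using form_homogeneous[of 0 F 0] by (metis mult_1 power_0 vector_smult_lzero)

text \<open>At a point of H_i all three fields take values in the plane H_i, so the determinant
  vanishes there and is divisible by the product of the forms. The degrees leave a quotient of
  degree 0.\<close>

lemma saito_det:
  assumes A: "arrangement n \<alpha>"
    and "\<xi>1 \<in> logder n \<alpha> d1" "\<xi>2 \<in> logder n \<alpha> d2" "\<xi>3 \<in> logder n \<alpha> d3" and d: "d1 + d2 + d3 = n"
  shows "\<exists>c. \<forall>x. tdet (vval \<xi>1 x) (vval \<xi>2 x) (vval \<xi>3 x) = c * (\<Prod>i<n. pairing (\<alpha> i) x)"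
proof -
  have "form n (\<lambda>x. tdet (vval \<xi>1 x) (vval \<xi>2 x) (vval \<xi>3 x))"
    using form_tdet[of d1 \<xi>1 d2 \<xi>2 d3 \<xi>3] assms by (simp add: logder_def)
  moreover have "tdet (vval \<xi>1 x) (vval \<xi>2 x) (vval \<xi>3 x) = 0" if "i < n" "x \<in> hyp (\<alpha> i)" for i x
    by (rule tdet_plane[of "\<alpha> i"]) (use assms that arrangementD(1)[OF A] in \<open>auto simp: logder_def\<close>)
  ultimately obtain G where "form (n - card {..<n}) G"
    "\<forall>x. tdet (vval \<xi>1 x) (vval \<xi>2 x) (vval \<xi>3 x) = (\<Prod>i<n. pairing (\<alpha> i) x) * G x"
    using form_vanishing_prod[of "{..<n}" n "\<lambda>x. tdet (vval \<xi>1 x) (vval \<xi>2 x) (vval \<xi>3 x)" \<alpha>]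
      arrangementD[OF A] by auto
  then show ?thesis using form_0_const[of G] by (auto simp: mult.commute)
qed

lemma module_S3: "module ((*s) :: S \<Rightarrow> S^3 \<Rightarrow> S^3)"
  by unfold_locales (auto simp: algebra_simps vec_eq_iff)

lemma subspace_derivation_module:
  assumes "arrangement n \<alpha>"
  shows "module.subspace ((*s) :: S \<Rightarrow> S^3 \<Rightarrow> S^3) (derivation_module n \<alpha>)"
proof -
  interpret M: module "(*s) :: S \<Rightarrow> S^3 \<Rightarrow> S^3" by (rule module_S3)
  have "evalV (p + q) x = evalV p x + evalV q x" "evalV (s *s p) x = evalS s x *s evalV p x"
    "evalV 0 x = 0" for p q s x by (simp_all add: vec_eq_iff)
  then show ?thesis
    unfolding M.subspace_def by (simp add: derivation_module_iff[OF assms] pairing_simps)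
qed

lemma vfield_lift:
  assumes "vfield d \<xi>" shows "\<exists>p. \<forall>x. evalV p x = vval \<xi> x"
proof -
  have "\<forall>k. \<exists>q. \<forall>x. evalS q x = \<xi> (k, x)"
    using assms form_imp_evalS unfolding vfield_def by fast
  then obtain q where "\<And>k x. evalS (q k) x = \<xi> (k, x)" by metis
  then show ?thesis by (intro exI[of _ "\<chi> k. q k"]) (simp add: vec_eq_iff)
qed

text \<open>By \<open>saito_det\<close> the determinant is c Q with c \<noteq> 0, where Q is the
  product of the forms. For p in the module, the Cramer numerators, got by putting p for one of the
  three fields, are divisible by Q too. Cancelling Q writes p as a combination of the three
  fields.\<close>

theorem saito_free:
  assumes A: "arrangement n \<alpha>"
    and \<xi>: "\<xi>1 \<in> logder n \<alpha> d1" "\<xi>2 \<in> logder n \<alpha> d2" "\<xi>3 \<in> logder n \<alpha> d3" and d: "d1 + d2 + d3 = n"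
    and nz: "tdet (vval \<xi>1 x) (vval \<xi>2 x) (vval \<xi>3 x) \<noteq> 0"
  shows "is_free n \<alpha>"
proof -
  interpret M: module "(*s) :: S \<Rightarrow> S^3 \<Rightarrow> S^3" by (rule module_S3)
  have "\<exists>p. \<forall>x. evalV p x = vval \<xi> x" if "\<xi> \<in> logder n \<alpha> d" for \<xi> d
    using that vfield_lift by (auto simp: logder_def)
  then obtain T1 T2 T3 where T: "\<And>x. evalV T1 x = vval \<xi>1 x" "\<And>x. evalV T2 x = vval \<xi>2 x"
      "\<And>x. evalV T3 x = vval \<xi>3 x"
    using \<xi> by metis
  have TD: "T1 \<in> derivation_module n \<alpha>" "T2 \<in> derivation_module n \<alpha>" "T3 \<in> derivation_module n \<alpha>"
    using \<xi> by (auto simp: derivation_module_iff[OF A] logder_def T)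
  obtain c where c: "\<And>x. tdet (vval \<xi>1 x) (vval \<xi>2 x) (vval \<xi>3 x) = c * (\<Prod>i<n. pairing (\<alpha> i) x)"
    using saito_det[OF A \<xi> d] by blast
  define Q where "Q = (\<Prod>i<n. linform (\<alpha> i))"
  have Q: "Q \<noteq> 0" unfolding Q_def using linform_nonzero arrangementD(1)[OF A] by simp
  have c0: "c \<noteq> 0" using nz c by auto
  have det: "tdet T1 T2 T3 = constS c * Q"
    by (rule evalS_inject) (simp add: evalS_tdet T c Q_def evalS_prod)
  then have det0: "tdet T1 T2 T3 \<noteq> 0" using Q c0 by (simp add: constS_def)
  have Qdvd: "Q dvd tdet p q r" if "p \<in> derivation_module n \<alpha>" "q \<in> derivation_module n \<alpha>"
    "r \<in> derivation_module n \<alpha>" for p q r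
    unfolding Q_def
  proof (rule prod_linform_dvd)
    fix i x assume "i \<in> {..<n}" "x \<in> hyp (\<alpha> i)"
    then show "evalS (tdet p q r) x = 0"
      unfolding evalS_tdet using that arrangementD(1)[OF A, of i]
      by (intro tdet_plane[of "\<alpha> i"]) (auto simp: derivation_module_iff[OF A])
  qed (use arrangementD[OF A] in auto)
  have "p \<in> M.span {T1, T2, T3}" if p: "p \<in> derivation_module n \<alpha>" for p
  proof -
    obtain g1 where g1: "tdet p T2 T3 = Q * g1" using Qdvd[OF p TD(2,3)] by (rule dvdE)
    obtain g2 where g2: "tdet T1 p T3 = Q * g2" using Qdvd[OF TD(1) p TD(3)] by (rule dvdE)
    obtain g3 where g3: "tdet T1 T2 p = Q * g3" using Qdvd[OF TD(1,2) p] by (rule dvdE)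
    let ?k = "constS (1 / c)"
    have k: "?k * constS c = 1" by (rule evalS_inject) (simp add: c0)
    have "Q * (constS c *s p) $ i = Q * (g1 *s T1 + g2 *s T2 + g3 *s T3) $ i" for i
      using arg_cong[OF tdet_cramer[of T1 T2 T3 p], of "\<lambda>v. v $ i"]
      by (simp add: det g1 g2 g3 algebra_simps)
    then have "constS c *s p = g1 *s T1 + g2 *s T2 + g3 *s T3"
      unfolding vec_eq_iff using Q mult_left_cancel by blast
    then have "?k *s (constS c *s p) = ?k *s (g1 *s T1 + g2 *s T2 + g3 *s T3)" by simp
    then have "p = ?k *s (g1 *s T1 + g2 *s T2 + g3 *s T3)"
      by (simp add: k)
    also have "\<dots> \<in> M.span {T1, T2, T3}"
      by (intro M.span_scale M.span_add M.span_base) auto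
    finally show ?thesis .
  qed
  moreover have "M.span {T1, T2, T3} \<subseteq> derivation_module n \<alpha>"
    by (rule M.span_minimal) (use TD subspace_derivation_module[OF A] in auto)
  ultimately have span: "M.span {T1, T2, T3} = derivation_module n \<alpha>" by blast
  have ne: "T1 \<noteq> T2" "T1 \<noteq> T3" "T2 \<noteq> T3" using det0 tdet_degenerate by metis+
  have "M.independent {T1, T2, T3}"
  proof
    assume "M.dependent {T1, T2, T3}"
    then obtain u where u: "u T1 \<noteq> 0 \<or> u T2 \<noteq> 0 \<or> u T3 \<noteq> 0"
        and s: "(\<Sum>v\<in>{T1, T2, T3}. u v *s v) = 0"
      by (subst (asm) M.dependent_finite) auto
    from s ne have s: "u T1 *s T1 + (u T2 *s T2 + u T3 *s T3) = 0" by simp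
    have e: "u T1 * tdet T1 T2 T3 = tdet (u T1 *s T1 + (u T2 *s T2 + u T3 *s T3)) T2 T3"
      "u T2 * tdet T1 T2 T3 = tdet T1 (u T1 *s T1 + (u T2 *s T2 + u T3 *s T3)) T3"
      "u T3 * tdet T1 T2 T3 = tdet T1 T2 (u T1 *s T1 + (u T2 *s T2 + u T3 *s T3))"
      by (simp_all add: tdet_linear tdet_degenerate)
    from e[unfolded s tdet_linear(7-9)] u det0 show False by auto
  qed
  with span show ?thesis unfolding is_free_def by blast
qed

lemma evalV_components:
  obtains N \<xi> where "\<And>j. vfield j (\<xi> j)" "\<And>x t. evalV p (t *s x) = (\<Sum>j\<le>N. t ^ j *s vval (\<xi> j) x)"
proof -
  have "\<forall>k. \<exists>N F. (\<forall>j. form j (F j)) \<and> (\<forall>j>N. F j = (\<lambda>x. 0)) \<and>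
      (\<forall>x t. evalS (p $ k) (t *s x) = (\<Sum>j\<le>N. t ^ j * F j x))"
  proof
    fix k
    obtain N F where "\<And>j. form j (F j)" "\<And>j. j > N \<Longrightarrow> F j = (\<lambda>x. 0)"
      "\<And>x t. evalS (p $ k) (t *s x) = (\<Sum>j\<le>N. t ^ j * F j x)"
      using evalS_components[of "p $ k"] by metis
    then show "\<exists>N F. (\<forall>j. form j (F j)) \<and> (\<forall>j>N. F j = (\<lambda>x. 0)) \<and>
      (\<forall>x t. evalS (p $ k) (t *s x) = (\<Sum>j\<le>N. t ^ j * F j x))" by blast
  qed
  then obtain N F where F: "\<And>k j. form j (F k j)" "\<And>k j. j > N k \<Longrightarrow> F k j = (\<lambda>x. 0)"
    "\<And>k x t. evalS (p $ k) (t *s x) = (\<Sum>j\<le>N k. t ^ j * F k j x)" by metis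
  define M where "M = (\<Sum>k\<in>UNIV. N k)"
  have "evalS (p $ k) (t *s x) = (\<Sum>j\<le>M. t ^ j * F k j x)" for k t x
    unfolding F(3)
  proof (rule sum_atMost_extend)
    show "N k \<le> M" unfolding M_def using member_le_sum[of k UNIV N] by simp
  qed (simp add: F(2))
  then have "evalV p (t *s x) = (\<Sum>j\<le>M. t ^ j *s vval (\<lambda>(k, x). F k j x) x)" for t x
    by (simp add: vec_eq_iff)
  moreover have "vfield j (\<lambda>(k, x). F k j x)" for j by (simp add: vfield_def F(1))
  ultimately show ?thesis using that[of "\<lambda>j (k, x). F k j x" M] by blast
qed

text \<open>The module is graded: H_i contains t x along with x, so tangency of the whole field at t
  x is a polynomial identity in t and passes to each coefficient.\<close>

lemma derivation_components:
  assumes A: "arrangement n \<alpha>" and p: "p \<in> derivation_module n \<alpha>"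
  obtains N \<xi> where "\<And>j. j \<le> N \<Longrightarrow> \<xi> j \<in> logder n \<alpha> j"
    "\<And>x t. evalV p (t *s x) = (\<Sum>j\<le>N. t ^ j *s vval (\<xi> j) x)"
proof -
  obtain N \<xi> where \<xi>: "\<And>j. vfield j (\<xi> j)" "\<And>x t. evalV p (t *s x) = (\<Sum>j\<le>N. t ^ j *s vval (\<xi> j) x)"
    using evalV_components[of p] by metis
  have "pairing (\<alpha> i) (vval (\<xi> j) x) = 0" if "i < n" "x \<in> hyp (\<alpha> i)" "j \<le> N" for i j x
  proof (rule power_sum_eq_0[where N = N and c = "\<lambda>j. pairing (\<alpha> i) (vval (\<xi> j) x)"])
    fix t
    have "t *s x \<in> hyp (\<alpha> i)" using that by (simp add: mem_hyp pairing_simps)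
    then have "pairing (\<alpha> i) (evalV p (t *s x)) = 0"
      using p that by (simp add: derivation_module_iff[OF A])
    moreover have "pairing a (sum f I) = (\<Sum>i\<in>I. pairing a (f i))" for a and f :: "nat \<Rightarrow> _" and I
      by (induction I rule: infinite_finite_induct) (auto simp: pairing_simps)
    ultimately show "(\<Sum>j\<le>N. t ^ j * pairing (\<alpha> i) (vval (\<xi> j) x)) = 0"
      by (simp add: \<xi>(2) pairing_simps)
  qed fact
  then have "\<xi> j \<in> logder n \<alpha> j" if "j \<le> N" for j using that \<xi>(1) by (simp add: logder_def)
  with \<xi>(2) that show ?thesis by blast
qed

lemma prime_prod_dvd_cancel:
  fixes f :: "'i \<Rightarrow> 'a::idom"
  assumes "finite I" "\<And>i p q. i \<in> I \<Longrightarrow> f i dvd p * q \<Longrightarrow> f i dvd p \<or> f i dvd q"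
    "\<And>i. i \<in> I \<Longrightarrow> f i \<noteq> 0" "\<And>i. i \<in> I \<Longrightarrow> \<not> f i dvd g" "g dvd (\<Prod>i\<in>I. f i) * r"
  shows "g dvd r"
  using assms
proof (induction I rule: finite_induct)
  case (insert m I)
  obtain h where h: "(\<Prod>i\<in>insert m I. f i) * r = g * h" using insert.prems(4) by (rule dvdE)
  then have eq: "f m * ((\<Prod>i\<in>I. f i) * r) = g * h" using insert.hyps by (simp add: mult.assoc)
  then have "f m dvd g * h" by (metis dvd_triv_left)
  then have "f m dvd h" using insert.prems(1,3) by blast
  then obtain h' where "h = f m * h'" by (rule dvdE)
  with eq have "f m * ((\<Prod>i\<in>I. f i) * r) = f m * (g * h')" by (simp add: mult.left_commute)
  then have "(\<Prod>i\<in>I. f i) * r = g * h'" using insert.prems(2)[of m] by simp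
  then have "g dvd (\<Prod>i\<in>I. f i) * r" by simp
  then show ?case using insert by blast
qed auto

lemma linform_dvd_prod:
  assumes "finite I" "a \<noteq> 0" "linform a dvd (\<Prod>i\<in>I. p i)" "\<not> linform a dvd 1"
  shows "\<exists>i\<in>I. linform a dvd p i"
  using assms
proof (induction I rule: finite_induct)
  case (insert m I)
  then have "linform a dvd p m * (\<Prod>i\<in>I. p i)" by simp
  then have "linform a dvd p m \<or> linform a dvd (\<Prod>i\<in>I. p i)" using insert.prems linform_dvd_mult by blast
  with insert show ?case by blast
qed auto

lemma linform_not_unit: "\<not> linform a dvd 1"
proof
  assume "linform a dvd 1"
  then obtain q where "1 = linform a * q" by (rule dvdE)
  from arg_cong[OF this, of "\<lambda>p. evalS p 0"] show False by (simp add: pairing_simps)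
qed

lemma linform_dvd_linform_imp_proportional:
  assumes "a \<noteq> 0" "b \<noteq> 0" "linform a dvd linform b" shows "proportional a b"
proof (rule ccontr)
  assume "\<not> proportional a b"
  then obtain w where "pairing a w = 0" "pairing b w = 1" using exists_separating assms by blast
  with assms linform_dvd_iff[of a "linform b"] show False by (auto simp: mem_hyp)
qed

definition constV :: "complex^3 \<Rightarrow> S^3" where
  "constV v = (\<chi> k. constS (v $ k))"

lemma evalV_constV: "evalV (p *s constV v) x = evalS p x *s v" "evalV (constV v) x = v"
  by (simp_all add: constV_def vec_eq_iff)

text \<open>For each i the fields (Q/a) v, (Q/a) v', Q w, where a is the i-th form and v, v' span its plane,
 have determinant Q (Q/a)^2. The determinant Q g of a basis divides all of these, hence no form of
 the arrangement divides g and g is a unit.\<close>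

lemma free_det:
  assumes A: "arrangement n \<alpha>" and n: "n \<ge> 1" and free: "is_free n \<alpha>"
  obtains b1 b2 b3 c where "b1 \<in> derivation_module n \<alpha>" "b2 \<in> derivation_module n \<alpha>"
    "b3 \<in> derivation_module n \<alpha>" "c \<noteq> 0" "tdet b1 b2 b3 = constS c * (\<Prod>i<n. linform (\<alpha> i))"
proof -
  interpret M: module "(*s) :: S \<Rightarrow> S^3 \<Rightarrow> S^3" by (rule module_S3)
  let ?D = "derivation_module n \<alpha>"
  obtain B where B: "M.independent B" "M.span B = ?D" using free unfolding is_free_def by blast
  define Q where "Q = (\<Prod>i<n. linform (\<alpha> i))"
  define R where "R i = (\<Prod>j\<in>{..<n}-{i}. linform (\<alpha> j))" for i
  have Q0: "Q \<noteq> 0" unfolding Q_def using linform_nonzero arrangementD(1)[OF A] by simp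
  have R0: "R i \<noteq> 0" for i unfolding R_def using linform_nonzero arrangementD(1)[OF A] by simp
  have eta: "\<exists>e1 e2 e3. e1 \<in> ?D \<and> e2 \<in> ?D \<and> e3 \<in> ?D \<and> tdet e1 e2 e3 = Q * (R i * R i)" if i: "i < n" for i
  proof -
    obtain v1 v2 w where v: "pairing (\<alpha> i) v1 = 0" "pairing (\<alpha> i) v2 = 0" "pairing (\<alpha> i) w = 1"
      "tdet v1 v2 w = 1" using exists_adapted_basis arrangementD(1)[OF A i] by blast
    have "R i *s constV v \<in> ?D" if "pairing (\<alpha> i) v = 0" for v
      unfolding derivation_module_iff[OF A] evalV_constV
      using that by (auto simp: pairing_simps R_def evalS_prod mem_hyp)
    moreover have "Q *s constV w \<in> ?D"
      unfolding derivation_module_iff[OF A] evalV_constV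
      by (auto simp: pairing_simps Q_def evalS_prod mem_hyp)
    moreover have "tdet (R i *s constV v1) (R i *s constV v2) (Q *s constV w) = Q * (R i * R i)"
      by (rule evalS_inject)
         (simp add: evalS_tdet evalV_constV tdet_linear v(4) mult.left_commute mult.commute)
    ultimately show ?thesis using v by blast
  qed
  have sub: "M.subspace {p. tdet p q r = 0}" "M.subspace {p. tdet q p r = 0}" "M.subspace {p. tdet q r p = 0}"
    "M.subspace {p. s dvd tdet p q r}" "M.subspace {p. s dvd tdet q p r}" "M.subspace {p. s dvd tdet q r p}"
    for q r s by (auto simp: M.subspace_def tdet_linear)
  \<comment> \<open>If all triples from \<open>B\<close> had determinant zero, multilinearity would
    carry this to the whole module, against \<open>eta\<close>. At this point \<open>B\<close> is
    not yet known to be finite.\<close>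
  have "\<exists>b1\<in>B. \<exists>b2\<in>B. \<exists>b3\<in>B. tdet b1 b2 b3 \<noteq> 0"
  proof (rule ccontr)
    assume "\<not> ?thesis"
    then have 0: "tdet p q r = 0" if "p \<in> B" "q \<in> B" "r \<in> B" for p q r using that by blast
    have 1: "tdet p q r = 0" if "p \<in> ?D" "q \<in> B" "r \<in> B" for p q r
      using M.span_induct[of p B "\<lambda>p. tdet p q r = 0"] 0 that B(2) sub by blast
    have 2: "tdet p q r = 0" if "p \<in> ?D" "q \<in> ?D" "r \<in> B" for p q r
      using M.span_induct[of q B "\<lambda>q. tdet p q r = 0"] 1 that B(2) sub by blast
    have 3: "tdet p q r = 0" if "p \<in> ?D" "q \<in> ?D" "r \<in> ?D" for p q r
      using M.span_induct[of r B "\<lambda>r. tdet p q r = 0"] 2 that B(2) sub by blast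
    from eta[of 0] n obtain e1 e2 e3 where "e1 \<in> ?D" "e2 \<in> ?D" "e3 \<in> ?D" "tdet e1 e2 e3 = Q * (R 0 * R 0)"
      by auto
    with 3 Q0 R0 show False by force
  qed
  then obtain b1 b2 b3 where b: "b1 \<in> B" "b2 \<in> B" "b3 \<in> B" "tdet b1 b2 b3 \<noteq> 0" by blast
  define T where "T = {b1, b2, b3}"
  define \<Delta> where "\<Delta> = tdet b1 b2 b3"
  have ne: "b1 \<noteq> b2" "b1 \<noteq> b3" "b2 \<noteq> b3" using b(4) tdet_degenerate by metis+
  \<comment> \<open>Cramer's rule is a linear relation between a further element p of
    \<open>B\<close> and b1, b2, b3 in which p has the nonzero coefficient \<Delta>.\<close>
  have "B = T"
  proof (rule ccontr)
    assume "B \<noteq> T"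
    then obtain p where p: "p \<in> B" "p \<notin> T" using b by (auto simp: T_def)
    define u where "u = (\<lambda>v. if v = b1 then - tdet p b2 b3 else if v = b2 then - tdet b1 p b3
      else if v = b3 then - tdet b1 b2 p else \<Delta>)"
    have "(\<Sum>v\<in>insert p T. u v *s v) = 0"
      using p ne tdet_cramer[of b1 b2 b3 p] by (auto simp: T_def u_def \<Delta>_def vec_eq_iff)
    moreover have "finite (insert p T)" "insert p T \<subseteq> B" using p b by (auto simp: T_def)
    ultimately have "u p = 0" using M.independentD[OF B(1)] by blast
    with p b show False by (auto simp: u_def T_def \<Delta>_def)
  qed
  then have D: "M.span T = ?D" using B by simp
  have TD: "b1 \<in> ?D" "b2 \<in> ?D" "b3 \<in> ?D" using b B(2) M.span_base by blast+
  have 0: "\<Delta> dvd tdet p q r" if "p \<in> T" "q \<in> T" "r \<in> T" for p q r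
    using that tdet_swap[of b1 b2 b3] by (auto simp: T_def \<Delta>_def tdet_degenerate)
  have 1: "\<Delta> dvd tdet p q r" if "p \<in> ?D" "q \<in> T" "r \<in> T" for p q r
    using M.span_induct[of p T "\<lambda>p. \<Delta> dvd tdet p q r"] 0 that D sub by blast
  have 2: "\<Delta> dvd tdet p q r" if "p \<in> ?D" "q \<in> ?D" "r \<in> T" for p q r
    using M.span_induct[of q T "\<lambda>q. \<Delta> dvd tdet p q r"] 1 that D sub by blast
  have 3: "\<Delta> dvd tdet p q r" if "p \<in> ?D" "q \<in> ?D" "r \<in> ?D" for p q r
    using M.span_induct[of r T "\<lambda>r. \<Delta> dvd tdet p q r"] 2 that D sub by blast
  have "Q dvd \<Delta>"
    unfolding Q_def
  proof (rule prod_linform_dvd)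
    fix i x assume "i \<in> {..<n}" "x \<in> hyp (\<alpha> i)"
    then show "evalS \<Delta> x = 0"
      unfolding \<Delta>_def evalS_tdet using TD arrangementD(1)[OF A, of i]
      by (intro tdet_plane[of "\<alpha> i"]) (auto simp: derivation_module_iff[OF A])
  qed (use arrangementD[OF A] in auto)
  then obtain g where g: "\<Delta> = Q * g" by (rule dvdE)
  have gR: "g dvd R i * R i" if "i < n" for i
  proof -
    obtain e1 e2 e3 where "e1 \<in> ?D" "e2 \<in> ?D" "e3 \<in> ?D" "tdet e1 e2 e3 = Q * (R i * R i)"
      using eta[OF \<open>i < n\<close>] by blast
    with 3[of e1 e2 e3] g Q0 show ?thesis by simp
  qed
  have ng: "\<not> linform (\<alpha> i) dvd g" if i: "i < n" for i
  proof
    assume "linform (\<alpha> i) dvd g"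
    then have "linform (\<alpha> i) dvd R i * R i" using gR[OF i] dvd_trans by blast
    then have "linform (\<alpha> i) dvd R i" using linform_dvd_mult arrangementD(1)[OF A i] by blast
    then obtain j where "j \<in> {..<n} - {i}" "linform (\<alpha> i) dvd linform (\<alpha> j)"
      using linform_dvd_prod[of "{..<n}-{i}" "\<alpha> i" "\<lambda>j. linform (\<alpha> j)"] arrangementD(1)[OF A i] linform_not_unit
      by (auto simp: R_def)
    then show False
      using linform_dvd_linform_imp_proportional[of "\<alpha> i" "\<alpha> j"] arrangementD[OF A] i by auto
  qed
  \<comment> \<open>No form of the arrangement divides g, so both factors \<open>R 0\<close> can be
    removed in turn from \<open>R 0 * R 0\<close>, and g divides 1.\<close>
  have cancel: "g dvd r" if "g dvd R 0 * r" for r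
    by (rule prime_prod_dvd_cancel[of "{..<n}-{0}" "\<lambda>j. linform (\<alpha> j)"])
       (use that ng linform_nonzero linform_dvd_mult arrangementD(1)[OF A] in \<open>auto simp: R_def\<close>)
  have "0 < n" using n by simp
  then have "g dvd R 0" by (rule cancel[OF gR])
  then have "g dvd R 0 * 1" by (simp only: mult_1_right)
  then have "g dvd 1" by (rule cancel)
  then obtain c where "c \<noteq> 0" "g = constS c" using unit_S_constS by blast
  with TD g show ?thesis using that[of b1 b2 b3 c] by (simp add: \<Delta>_def Q_def mult.commute)
qed

text \<open>The elements of a basis need not be homogeneous. At a point x off all planes, their
  determinant at t x is c Q(x) t^n. Expanded over homogeneous components, the coefficient of t^n is
  a sum of determinants of components whose degrees add up to n, so one of these is nonzero.\<close>

theorem saito_converse: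
  assumes A: "arrangement n \<alpha>" and n: "n \<ge> 1" and free: "is_free n \<alpha>"
  obtains d1 d2 d3 \<xi>1 \<xi>2 \<xi>3 x where "\<xi>1 \<in> logder n \<alpha> d1" "\<xi>2 \<in> logder n \<alpha> d2" "\<xi>3 \<in> logder n \<alpha> d3"
    "d1 + d2 + d3 = n" "tdet (vval \<xi>1 x) (vval \<xi>2 x) (vval \<xi>3 x) \<noteq> 0"
proof -
  obtain b1 b2 b3 c where b: "b1 \<in> derivation_module n \<alpha>" "b2 \<in> derivation_module n \<alpha>"
    "b3 \<in> derivation_module n \<alpha>" "c \<noteq> 0" "tdet b1 b2 b3 = constS c * (\<Prod>i<n. linform (\<alpha> i))"
    using free_det[OF A n free] by metis
  obtain N1 \<xi>1 where t1: "\<And>j. j \<le> N1 \<Longrightarrow> \<xi>1 j \<in> logder n \<alpha> j"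
    "\<And>x t. evalV b1 (t *s x) = (\<Sum>j\<le>N1. t ^ j *s vval (\<xi>1 j) x)"
    by (rule derivation_components[OF A b(1)]) blast
  obtain N2 \<xi>2 where t2: "\<And>j. j \<le> N2 \<Longrightarrow> \<xi>2 j \<in> logder n \<alpha> j"
    "\<And>x t. evalV b2 (t *s x) = (\<Sum>j\<le>N2. t ^ j *s vval (\<xi>2 j) x)"
    by (rule derivation_components[OF A b(2)]) blast
  obtain N3 \<xi>3 where t3: "\<And>j. j \<le> N3 \<Longrightarrow> \<xi>3 j \<in> logder n \<alpha> j"
    "\<And>x t. evalV b3 (t *s x) = (\<Sum>j\<le>N3. t ^ j *s vval (\<xi>3 j) x)"
    by (rule derivation_components[OF A b(3)]) blast
  have "(\<Prod>i<n. linform (\<alpha> i)) \<noteq> 0" using linform_nonzero arrangementD(1)[OF A] by simp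
  then obtain x where "evalS (\<Prod>i<n. linform (\<alpha> i)) x \<noteq> 0" using evalS_eq_0 by blast
  then have x: "(\<Prod>i<n. pairing (\<alpha> i) x) \<noteq> 0" by (simp add: evalS_prod)
  let ?t = "\<lambda>j1 j2 j3. tdet (vval (\<xi>1 j1) x) (vval (\<xi>2 j2) x) (vval (\<xi>3 j3) x)"
  let ?q = "c * (\<Prod>i<n. pairing (\<alpha> i) x)"
  have "poly (\<Sum>j1\<le>N1. \<Sum>j2\<le>N2. \<Sum>j3\<le>N3. monom (?t j1 j2 j3) (j1 + j2 + j3)) t = poly (monom ?q n) t" for t
  proof -
    have "evalS (tdet b1 b2 b3) (t *s x) = (\<Sum>j1\<le>N1. \<Sum>j2\<le>N2. \<Sum>j3\<le>N3. t ^ (j1 + j2 + j3) * ?t j1 j2 j3)"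
      by (simp add: evalS_tdet t1(2) t2(2) t3(2) tdet_sum3 tdet_linear power_add mult_ac)
    moreover have "evalS (tdet b1 b2 b3) (t *s x) = ?q * t ^ n"
      by (simp add: b(5) evalS_prod pairing_simps prod.distrib mult_ac)
    ultimately show ?thesis by (simp add: poly_sum poly_monom mult.commute)
  qed
  then have "(\<Sum>j1\<le>N1. \<Sum>j2\<le>N2. \<Sum>j3\<le>N3. monom (?t j1 j2 j3) (j1 + j2 + j3)) = monom ?q n"
    by (intro iffD1[OF poly_eq_poly_eq_iff] ext)
  from arg_cong[OF this, of "\<lambda>p. coeff p n"]
  have "(\<Sum>j1\<le>N1. \<Sum>j2\<le>N2. \<Sum>j3\<le>N3. if j1 + j2 + j3 = n then ?t j1 j2 j3 else 0) = ?q"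
    by (simp add: coeff_sum)
  also have "?q \<noteq> 0" using b(4) x by simp
  finally have "(\<Sum>j1\<le>N1. \<Sum>j2\<le>N2. \<Sum>j3\<le>N3. if j1 + j2 + j3 = n then ?t j1 j2 j3 else 0) \<noteq> 0" .
  then obtain j1 where j1: "j1 \<le> N1"
      "(\<Sum>j2\<le>N2. \<Sum>j3\<le>N3. if j1 + j2 + j3 = n then ?t j1 j2 j3 else 0) \<noteq> 0"
    by (rule sum.not_neutral_contains_not_neutral) auto
  from j1(2) obtain j2 where j2: "j2 \<le> N2" "(\<Sum>j3\<le>N3. if j1 + j2 + j3 = n then ?t j1 j2 j3 else 0) \<noteq> 0"
    by (rule sum.not_neutral_contains_not_neutral) auto
  from j2(2) obtain j3 where j3: "j3 \<le> N3" "(if j1 + j2 + j3 = n then ?t j1 j2 j3 else 0) \<noteq> 0"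
    by (rule sum.not_neutral_contains_not_neutral) auto
  show ?thesis
    by (rule that[OF t1(1)[OF j1(1)] t2(1)[OF j2(1)] t3(1)[OF j3(1)], of x]) (use j3 in \<open>auto split: if_splits\<close>)
qed

section \<open>Linear algebra in spaces of functions\<close>

context vector_space
begin

text \<open>The spaces in view consist of functions and sit in an infinite dimensional space;
  finiteness is therefore supplied by a finite set \<open>T\<close> whose span contains
  \<open>W\<close>.\<close>

lemma dim_mono_finite:
  assumes "V \<subseteq> W" "W \<subseteq> span T" "finite T" shows "dim V \<le> dim W"
proof -
  obtain B where B: "B \<subseteq> W" "independent B" "W \<subseteq> span B" "card B = dim W" using basis_exists by blast
  have "finite B" using independent_span_bound[OF assms(3) B(2)] B(1) assms(2) by blast
  then show ?thesis using dim_le_card[of V B] B assms(1) by auto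
qed

lemma subspace_eq_of_dim_le:
  assumes "subspace V" "V \<subseteq> W" "W \<subseteq> span T" "finite T" "dim W \<le> dim V"
  shows "V = W"
proof -
  obtain B where B: "B \<subseteq> V" "independent B" "V \<subseteq> span B" "card B = dim V" using basis_exists by blast
  obtain C where C: "B \<subseteq> C" "C \<subseteq> W" "independent C" "W \<subseteq> span C"
    using maximal_independent_subset_extend[of B W] B(1,2) assms(2) by blast
  have fin: "finite C" using independent_span_bound[OF assms(4) C(3)] C(2) assms(3) by blast
  have "card C = dim W" using basis_card_eq_dim C by blast
  then have "B = C" using C(1) B(4) assms(5) fin card_seteq by metis
  then have "W \<subseteq> V" using C(4) span_minimal[OF B(1) assms(1)] by blast
  with assms(2) show ?thesis by blast
qed

lemma dim_singleton_zero: "dim {0} = 0"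
  using dim_le_card[of "{0}" "{}"] by (simp add: span_empty)

end

text \<open>A basis C of the kernel is extended to a basis B of V. A vector in the span of B - C
  killed by f also lies in the span of C, hence is 0 by independence; so f maps B - C to a basis of
  the image.\<close>

lemma (in vector_space_pair) rank_nullity:
  assumes V: "vs1.subspace V" and T: "V \<subseteq> vs1.span T" "finite T"
    and f: "Vector_Spaces.linear s1 s2 f"
  shows "vs1.dim V = vs2.dim (f ` V) + vs1.dim {x\<in>V. f x = 0}"
proof -
  interpret f: Vector_Spaces.linear s1 s2 f by (rule f)
  define K where "K = {x\<in>V. f x = 0}"
  have Ks: "vs1.subspace K"
    using V unfolding K_def vs1.subspace_def by (auto simp: f.add f.scale f.zero)
  obtain C where C: "C \<subseteq> K" "vs1.independent C" "K \<subseteq> vs1.span C" "card C = vs1.dim K"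
    using vs1.basis_exists by blast
  have "C \<subseteq> V" using C(1) by (auto simp: K_def)
  then obtain B where B: "C \<subseteq> B" "B \<subseteq> V" "vs1.independent B" "V \<subseteq> vs1.span B"
    using vs1.maximal_independent_subset_extend C(2) by blast
  have fin: "finite B" using vs1.independent_span_bound[OF T(2) B(3)] B(2) T(1) by blast
  have finC: "finite C" using fin B(1) finite_subset by blast
  have ker: "x = 0" if x: "x \<in> vs1.span (B - C)" "f x = 0" for x
  proof -
    have "x \<in> V" using x(1) vs1.span_minimal[of "B - C" V] B(2) V by blast
    with x have "x \<in> vs1.span C" using C(3) by (auto simp: K_def)
    then obtain a where a: "x = (\<Sum>v\<in>C. s1 (a v) v)" using vs1.span_finite[OF finC] by auto
    obtain b where b: "x = (\<Sum>v\<in>B-C. s1 (b v) v)" using x(1) vs1.span_finite[of "B - C"] fin by auto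
    define u where "u v = (if v \<in> C then a v else - b v)" for v
    have "(\<Sum>v\<in>B. s1 (u v) v) = (\<Sum>v\<in>B-C. s1 (u v) v) + (\<Sum>v\<in>C. s1 (u v) v)"
      using sum.subset_diff[OF B(1) fin] by blast
    also have "(\<Sum>v\<in>B-C. s1 (u v) v) = - x"
      unfolding b sum_negf[symmetric] by (intro sum.cong) (auto simp: u_def vs1.scale_minus_left)
    also have "(\<Sum>v\<in>C. s1 (u v) v) = x"
      unfolding a by (intro sum.cong) (auto simp: u_def)
    finally have "(\<Sum>v\<in>B. s1 (u v) v) = 0" by simp
    then have "u v = 0" if "v \<in> B" for v
      using vs1.independentD[OF B(3) fin order_refl] that by blast
    then have "\<And>v. v \<in> C \<Longrightarrow> a v = 0" using B(1) unfolding u_def by fastforce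
    then show ?thesis by (simp add: a)
  qed
  have inj: "inj_on f (vs1.span (B - C))"
  proof (rule inj_onI)
    fix x y assume xy: "x \<in> vs1.span (B - C)" "y \<in> vs1.span (B - C)" "f x = f y"
    have "x - y = 0" by (rule ker) (use xy vs1.span_diff f.diff in auto)
    then show "x = y" by simp
  qed
  have ind: "vs2.independent (f ` (B - C))"
    using f.independent_injective_image inj vs1.independent_mono[OF B(3)] by blast
  have "f ` V \<subseteq> vs2.span (f ` (B - C))"
  proof -
    have "f ` V \<subseteq> vs2.span (f ` B)" using B(4) f.span_image by blast
    also have "\<dots> \<subseteq> vs2.span (f ` (B - C))"
    proof (rule vs2.span_minimal[OF _ vs2.subspace_span])
      show "f ` B \<subseteq> vs2.span (f ` (B - C))"
      proof
        fix y assume "y \<in> f ` B"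
        then obtain b where b: "b \<in> B" "y = f b" by blast
        show "y \<in> vs2.span (f ` (B - C))"
        proof (cases "b \<in> C")
          case True
          with C(1) b show ?thesis by (auto simp: K_def vs2.span_zero)
        next
          case False
          with b show ?thesis by (auto intro: vs2.span_base)
        qed
      qed
    qed
    finally show ?thesis .
  qed
  then have "vs2.dim (f ` V) = card (f ` (B - C))"
    using B(2) ind by (intro vs2.basis_card_eq_dim[symmetric]) auto
  also have "\<dots> = card (B - C)"
    using inj by (intro card_image) (meson inj_on_subset vs1.span_superset)
  also have "\<dots> = card B - card C" using B(1) finC by (simp add: card_Diff_subset)
  finally have "vs2.dim (f ` V) = card B - card C" .
  moreover have "card B = vs1.dim V" using vs1.basis_card_eq_dim B by blast
  moreover have "card C \<le> card B" using B(1) fin card_mono by blast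
  ultimately show ?thesis using C(4) by (simp add: K_def)
qed

definition fscale :: "complex \<Rightarrow> ('x \<Rightarrow> complex) \<Rightarrow> 'x \<Rightarrow> complex" where
  "fscale c f = (\<lambda>x. c * f x)"

lemma fscale_apply [simp]: "fscale c f x = c * f x"
  by (simp add: fscale_def)

interpretation fs: vector_space "fscale :: complex \<Rightarrow> ('x \<Rightarrow> complex) \<Rightarrow> 'x \<Rightarrow> complex"
  by unfold_locales (auto simp: fun_eq_iff algebra_simps)

interpretation fsp: vector_space_pair "fscale :: complex \<Rightarrow> ('x \<Rightarrow> complex) \<Rightarrow> 'x \<Rightarrow> complex"
    "fscale :: complex \<Rightarrow> ('y \<Rightarrow> complex) \<Rightarrow> 'y \<Rightarrow> complex"
  by unfold_locales

lemma fsubspace_iff: "fs.subspace V \<longleftrightarrow> (\<lambda>x. 0) \<in> V \<and> (\<forall>f\<in>V. \<forall>g\<in>V. (\<lambda>x. f x + g x) \<in> V) \<and>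
    (\<forall>c. \<forall>f\<in>V. (\<lambda>x. c * f x) \<in> V)"
  by (simp add: fs.subspace_def fscale_def zero_fun_def plus_fun_def)

lemma flinearI:
  assumes "\<And>f g. \<Phi> (\<lambda>x. f x + g x) = (\<lambda>y. \<Phi> f y + \<Phi> g y)" "\<And>c f. \<Phi> (\<lambda>x. c * f x) = (\<lambda>y. c * \<Phi> f y)"
  shows "Vector_Spaces.linear fscale fscale \<Phi>"
  by unfold_locales (use assms in \<open>auto simp: plus_fun_def fscale_def\<close>)

lemma sum_fun_apply: "(\<Sum>i\<in>I. f i) x = (\<Sum>i\<in>I. f i x)" for f :: "'i \<Rightarrow> 'x \<Rightarrow> complex"
  by (induction I rule: infinite_finite_induct) (auto simp: zero_fun_def plus_fun_def)

section \<open>Solution spaces of polynomial families of linear systems\<close>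

text \<open>Polynomial functions of the 3n coordinates of the forms. Kept as functions, they make
  the elimination an argument about values; actual polynomials are recovered by
  \<open>polyfun_imp_mpeval\<close>.\<close>

inductive polyfun :: "nat \<Rightarrow> ((nat \<Rightarrow> complex^3) \<Rightarrow> complex) \<Rightarrow> bool" for n where
  polyfun_const: "polyfun n (\<lambda>\<alpha>. c)"
| polyfun_add: "polyfun n p \<Longrightarrow> polyfun n q \<Longrightarrow> polyfun n (\<lambda>\<alpha>. p \<alpha> + q \<alpha>)"
| polyfun_coord_mult: "i < n \<Longrightarrow> polyfun n p \<Longrightarrow> polyfun n (\<lambda>\<alpha>. \<alpha> i $ k * p \<alpha>)"

lemma polyfun_mult: "polyfun n p \<Longrightarrow> polyfun n q \<Longrightarrow> polyfun n (\<lambda>\<alpha>. p \<alpha> * q \<alpha>)"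
proof (induction rule: polyfun.induct)
  case (polyfun_const c)
  from \<open>polyfun n q\<close> show ?case
  proof (induction rule: polyfun.induct)
    case (polyfun_coord_mult i q k)
    from polyfun.polyfun_coord_mult[OF polyfun_coord_mult(1,3)] show ?case
      by (simp add: mult.left_commute)
  qed (auto simp: distrib_left intro: polyfun.intros)
next
  case (polyfun_coord_mult i p k)
  from polyfun.polyfun_coord_mult[OF polyfun_coord_mult.hyps(1) polyfun_coord_mult.IH[OF polyfun_coord_mult.prems]]
  show ?case by (simp add: mult.assoc)
qed (auto simp: distrib_right intro: polyfun.intros)

lemma polyfun_coord: "i < n \<Longrightarrow> polyfun n (\<lambda>\<alpha>. \<alpha> i $ k)"
  using polyfun_coord_mult[of i n "\<lambda>\<alpha>. 1" k] polyfun_const by simp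

lemma polyfun_sum: "(\<And>i. i \<in> I \<Longrightarrow> polyfun n (p i)) \<Longrightarrow> polyfun n (\<lambda>\<alpha>. \<Sum>i\<in>I. p i \<alpha>)"
  by (induction I rule: infinite_finite_induct) (auto intro: polyfun_const polyfun_add)

lemma polyfun_prod: "(\<And>i. i \<in> I \<Longrightarrow> polyfun n (p i)) \<Longrightarrow> polyfun n (\<lambda>\<alpha>. \<Prod>i\<in>I. p i \<alpha>)"
  by (induction I rule: infinite_finite_induct) (auto intro: polyfun_const polyfun_mult)

lemma polyfun_uminus: "polyfun n p \<Longrightarrow> polyfun n (\<lambda>\<alpha>. - p \<alpha>)"
  using polyfun_mult[OF polyfun_const, of n p "-1"] by simp

lemma polyfun_diff: "polyfun n p \<Longrightarrow> polyfun n q \<Longrightarrow> polyfun n (\<lambda>\<alpha>. p \<alpha> - q \<alpha>)"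
  using polyfun_add[OF _ polyfun_uminus] by simp

lemma polyfun_form_crossC:
  assumes "form d F" "i < n"
  shows "polyfun n (\<lambda>\<alpha>. F (crossC (\<alpha> i) y))"
  using assms
proof (induction rule: form.induct)
  case (form_coord j F k)
  have "polyfun n (\<lambda>\<alpha>. crossC (\<alpha> i) y $ k)"
    using exhaust_3[of k] \<open>i < n\<close>
    by (auto intro!: polyfun_diff polyfun_mult polyfun_coord polyfun_const)
  then show ?case using form_coord by (auto intro: polyfun_mult)
qed (auto intro: polyfun.intros)

text \<open>Gaussian elimination with pivots that do not vanish at the base point. The set F consists of
 the free unknowns, and w f is the solution with free coordinates (0,...,q,...,0).\<close>

lemma polynomial_elimination:
  fixes E :: "'r \<Rightarrow> 'k \<Rightarrow> (nat \<Rightarrow> complex^3) \<Rightarrow> complex"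
  assumes "finite K" "\<forall>r\<in>R. \<forall>k\<in>K. polyfun n (E r k)"
  shows "\<exists>F q w. F \<subseteq> K \<and> polyfun n q \<and> q \<alpha>0 \<noteq> 0 \<and> (\<forall>f\<in>F. \<forall>k\<in>K. polyfun n (w f k)) \<and>
    (\<forall>f\<in>F. \<forall>k\<in>F. w f k \<alpha>0 = (if k = f then q \<alpha>0 else 0)) \<and>
    (\<forall>f\<in>F. \<forall>r\<in>R. (\<Sum>k\<in>K. w f k \<alpha>0 * E r k \<alpha>0) = 0) \<and>
    (\<forall>\<alpha> c. q \<alpha> \<noteq> 0 \<longrightarrow> (\<forall>r\<in>R. (\<Sum>k\<in>K. c k * E r k \<alpha>) = 0) \<longrightarrow>
       (\<forall>k\<in>K. q \<alpha> * c k = (\<Sum>f\<in>F. c f * w f k \<alpha>)))"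
  using assms
proof (induction "card K" arbitrary: K E)
  case 0
  then have "K = {}" by simp
  then show ?case by (intro exI[of _ "{}"] exI[of _ "\<lambda>\<alpha>. 1"]) (auto intro: polyfun_const)
next
  case (Suc m)
  show ?case
  proof (cases "\<forall>r\<in>R. \<forall>k\<in>K. E r k \<alpha>0 = 0")
    \<comment> \<open>Without a pivot all unknowns are free. Away from \<open>\<alpha>0\<close> the
      equations may become nontrivial, which is why the last clause of the claim only bounds the
      solutions at \<alpha> from above.\<close>
    case True
    have "\<forall>k\<in>K. 1 * c k = (\<Sum>f\<in>K. c f * (if k = f then 1 else 0))" for c :: "'k \<Rightarrow> complex"
      using Suc.prems(1) by (simp add: if_distrib sum.delta' cong: if_cong)
    with True show ?thesis
      by (intro exI[of _ K] exI[of _ "\<lambda>\<alpha>. 1"] exI[of _ "\<lambda>f k \<alpha>. if k = f then 1 else 0"])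
         (auto intro: polyfun_const)
  next
    case False
    then obtain r h where rh: "r \<in> R" "h \<in> K" "E r h \<alpha>0 \<noteq> 0" by blast
    define K' where "K' = K - {h}"
    \<comment> \<open>Unknown h is eliminated by cross-multiplication with the pivot equation r, so
      that the new coefficients stay polynomial.\<close>
    define E' where "E' s k = (\<lambda>\<alpha>. E r h \<alpha> * E s k \<alpha> - E s h \<alpha> * E r k \<alpha>)" for s k
    have K': "finite K'" "K = insert h K'" "h \<notin> K'" "m = card K'"
      using Suc.prems(1) Suc.hyps(2) rh(2) by (auto simp: K'_def)
    have E': "\<forall>s\<in>R. \<forall>k\<in>K'. polyfun n (E' s k)"
      unfolding E'_def using Suc.prems(2) rh K'(2) by (auto intro!: polyfun_diff polyfun_mult)
    obtain F q w where F: "F \<subseteq> K'" and q: "polyfun n q" "q \<alpha>0 \<noteq> 0"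
      and w: "\<forall>f\<in>F. \<forall>k\<in>K'. polyfun n (w f k)"
        "\<forall>f\<in>F. \<forall>k\<in>F. w f k \<alpha>0 = (if k = f then q \<alpha>0 else 0)"
        "\<forall>f\<in>F. \<forall>r\<in>R. (\<Sum>k\<in>K'. w f k \<alpha>0 * E' r k \<alpha>0) = 0"
        "\<forall>\<alpha> c. q \<alpha> \<noteq> 0 \<longrightarrow> (\<forall>r\<in>R. (\<Sum>k\<in>K'. c k * E' r k \<alpha>) = 0) \<longrightarrow>
          (\<forall>k\<in>K'. q \<alpha> * c k = (\<Sum>f\<in>F. c f * w f k \<alpha>))"
      using Suc.hyps(1)[OF K'(4) K'(1) E'] by (elim exE conjE) (rule that)
    have hF: "h \<notin> F" using F K'(3) by blast
    \<comment> \<open>The value at h is forced by equation r; scaling the other values by the pivot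
      avoids division.\<close>
    define w' where "w' f k = (if k = h then (\<lambda>\<alpha>. - (\<Sum>l\<in>K'. E r l \<alpha> * w f l \<alpha>))
      else (\<lambda>\<alpha>. E r h \<alpha> * w f k \<alpha>))" for f k
    define q' where "q' = (\<lambda>\<alpha>. E r h \<alpha> * q \<alpha>)"
    have split: "(\<Sum>k\<in>K. g k) = g h + (\<Sum>k\<in>K'. g k)" for g :: "'k \<Rightarrow> complex"
      using K' by simp
    have E'sum: "(\<Sum>k\<in>K'. c k * E' s k \<alpha>)
        = E r h \<alpha> * (\<Sum>k\<in>K'. c k * E s k \<alpha>) - E s h \<alpha> * (\<Sum>k\<in>K'. c k * E r k \<alpha>)" for c s \<alpha>
      by (simp add: E'_def sum_distrib_left sum_subtractf[symmetric] algebra_simps)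
    have "polyfun n q'" unfolding q'_def using q rh Suc.prems(2) by (intro polyfun_mult) auto
    moreover have "q' \<alpha>0 \<noteq> 0" using q rh by (simp add: q'_def)
    moreover have "\<forall>f\<in>F. \<forall>k\<in>K. polyfun n (w' f k)"
      unfolding w'_def using w(1) rh Suc.prems(2) K'(2)
      by (auto intro!: polyfun_uminus polyfun_sum polyfun_mult)
    moreover have "\<forall>f\<in>F. \<forall>k\<in>F. w' f k \<alpha>0 = (if k = f then q' \<alpha>0 else 0)"
      using w(2) hF by (auto simp: w'_def q'_def)
    moreover have "\<forall>f\<in>F. \<forall>s\<in>R. (\<Sum>k\<in>K. w' f k \<alpha>0 * E s k \<alpha>0) = 0"
    proof (intro ballI)
      fix f s assume fs: "f \<in> F" "s \<in> R"
      have "(\<Sum>k\<in>K'. w' f k \<alpha>0 * E s k \<alpha>0) = E r h \<alpha>0 * (\<Sum>k\<in>K'. w f k \<alpha>0 * E s k \<alpha>0)"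
        unfolding sum_distrib_left using K'(3) by (intro sum.cong) (auto simp: w'_def)
      then have "(\<Sum>k\<in>K. w' f k \<alpha>0 * E s k \<alpha>0) = (\<Sum>k\<in>K'. w f k \<alpha>0 * E' s k \<alpha>0)"
        unfolding split E'sum by (simp add: w'_def mult.commute)
      with w(3) fs show "(\<Sum>k\<in>K. w' f k \<alpha>0 * E s k \<alpha>0) = 0" by simp
    qed
    moreover have "\<forall>k\<in>K. q' \<alpha> * c k = (\<Sum>f\<in>F. c f * w' f k \<alpha>)"
      if q\<alpha>: "q' \<alpha> \<noteq> 0" and c: "\<forall>r\<in>R. (\<Sum>k\<in>K. c k * E r k \<alpha>) = 0" for \<alpha> c
    proof -
      have c': "(\<Sum>k\<in>K'. c k * E s k \<alpha>) = - c h * E s h \<alpha>" if "s \<in> R" for s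
        using c that unfolding split by (simp add: add_eq_0_iff add.commute)
      have "\<forall>s\<in>R. (\<Sum>k\<in>K'. c k * E' s k \<alpha>) = 0"
        unfolding E'sum using c' rh(1) by (simp add: algebra_simps)
      moreover have "q \<alpha> \<noteq> 0" using q\<alpha> by (simp add: q'_def)
      ultimately have IH: "\<forall>k\<in>K'. q \<alpha> * c k = (\<Sum>f\<in>F. c f * w f k \<alpha>)" using w(4) by blast
      have "q' \<alpha> * c k = (\<Sum>f\<in>F. c f * w' f k \<alpha>)" if "k \<in> K'" for k
      proof -
        have "k \<noteq> h" using that K'(3) by blast
        then have "(\<Sum>f\<in>F. c f * w' f k \<alpha>) = E r h \<alpha> * (\<Sum>f\<in>F. c f * w f k \<alpha>)"
          by (simp add: w'_def sum_distrib_left mult.left_commute)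
        with IH that show ?thesis by (simp add: q'_def mult.assoc)
      qed
      moreover have "q' \<alpha> * c h = (\<Sum>f\<in>F. c f * w' f h \<alpha>)"
      proof -
        have "q' \<alpha> * c h = - (q \<alpha> * (\<Sum>k\<in>K'. c k * E r k \<alpha>))"
          using c'[OF rh(1)] by (simp add: q'_def algebra_simps)
        also have "\<dots> = - (\<Sum>k\<in>K'. (q \<alpha> * c k) * E r k \<alpha>)"
          by (simp add: sum_distrib_left mult.assoc)
        also have "\<dots> = - (\<Sum>k\<in>K'. \<Sum>f\<in>F. c f * w f k \<alpha> * E r k \<alpha>)"
          using IH by (simp add: sum_distrib_right)
        also have "\<dots> = (\<Sum>f\<in>F. - (\<Sum>k\<in>K'. c f * w f k \<alpha> * E r k \<alpha>))"
          by (subst sum.swap) (simp add: sum_negf)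
        also have "\<dots> = (\<Sum>f\<in>F. c f * w' f h \<alpha>)"
          by (intro sum.cong refl) (simp add: w'_def sum_distrib_left mult_ac)
        finally show ?thesis .
      qed
      ultimately show ?thesis using K'(2) by auto
    qed
    moreover have "F \<subseteq> K" using F K'(2) by blast
    ultimately show ?thesis by blast
  qed
qed

definition solspace :: "('x \<Rightarrow> complex) set \<Rightarrow> 'r set \<Rightarrow> ('r \<Rightarrow> (nat \<Rightarrow> complex^3) \<Rightarrow> ('x \<Rightarrow> complex) \<Rightarrow> complex)
    \<Rightarrow> (nat \<Rightarrow> complex^3) \<Rightarrow> ('x \<Rightarrow> complex) set" where
  "solspace T R L \<alpha> = {\<xi> \<in> fs.span T. \<forall>r\<in>R. L r \<alpha> \<xi> = 0}"

text \<open>Wherever q \<noteq> 0 the solution space lies in the span of the \<open>card F\<close>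
  polynomial vectors \<open>W\<close>, which form a basis of it at \<open>\<alpha>0\<close>; this
  bounds the dimension. If the dimension at \<alpha> is no smaller than at \<open>\<alpha>0\<close>,
  the inclusion is an equality, the vectors \<open>W\<close> are solutions at \<alpha>, and a
  combination of them with constant coefficients deforms \<xi>. The factor
  \<open>q \<alpha>0\<close> comes from the pivots.\<close>

lemma solspace_deformation:
  fixes T :: "('x \<Rightarrow> complex) set"
  assumes T: "finite T" "fs.independent T"
    and Ladd: "\<And>r \<alpha> f g. L r \<alpha> (\<lambda>x. f x + g x) = L r \<alpha> f + L r \<alpha> g"
    and Lscale: "\<And>r \<alpha> c f. L r \<alpha> (\<lambda>x. c * f x) = c * L r \<alpha> f"
    and Lpoly: "\<forall>r\<in>R. \<forall>m\<in>T. polyfun n (\<lambda>\<alpha>. L r \<alpha> m)"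
  obtains q where "polyfun n q" "q \<alpha>0 \<noteq> 0"
    "\<And>\<alpha>. q \<alpha> \<noteq> 0 \<Longrightarrow> fs.dim (solspace T R L \<alpha>) \<le> fs.dim (solspace T R L \<alpha>0)"
    "\<And>\<xi>. \<xi> \<in> solspace T R L \<alpha>0 \<Longrightarrow> \<exists>\<Xi>. (\<forall>x. polyfun n (\<lambda>\<alpha>. \<Xi> \<alpha> x)) \<and> \<Xi> \<alpha>0 = (\<lambda>x. q \<alpha>0 * \<xi> x) \<and>
       (\<forall>\<alpha>. q \<alpha> \<noteq> 0 \<longrightarrow> fs.dim (solspace T R L \<alpha>0) \<le> fs.dim (solspace T R L \<alpha>) \<longrightarrow>
          \<Xi> \<alpha> \<in> solspace T R L \<alpha>)"
proof -
  let ?V = "solspace T R L"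
  obtain F q w where F: "F \<subseteq> T" and q: "polyfun n q" "q \<alpha>0 \<noteq> 0"
    and w': "\<forall>f\<in>F. \<forall>k\<in>T. polyfun n (w f k)"
      "\<forall>f\<in>F. \<forall>k\<in>F. w f k \<alpha>0 = (if k = f then q \<alpha>0 else 0)"
      "\<forall>f\<in>F. \<forall>r\<in>R. (\<Sum>k\<in>T. w f k \<alpha>0 * L r \<alpha>0 k) = 0"
      "\<forall>\<alpha> c. q \<alpha> \<noteq> 0 \<longrightarrow> (\<forall>r\<in>R. (\<Sum>k\<in>T. c k * L r \<alpha> k) = 0) \<longrightarrow>
        (\<forall>k\<in>T. q \<alpha> * c k = (\<Sum>f\<in>F. c f * w f k \<alpha>))"
    using polynomial_elimination[of T R n "\<lambda>r k \<alpha>. L r \<alpha> k" \<alpha>0, OF T(1) Lpoly]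
    by (elim exE conjE) (rule that)
  note w = w'(1-3)[THEN bspec, THEN bspec]
  have finF: "finite F" using F T(1) finite_subset by blast
  define W where "W \<alpha> f = (\<lambda>x. \<Sum>k\<in>T. w f k \<alpha> * k x)" for \<alpha> f
  have L0: "L r \<alpha> (\<lambda>x. 0) = 0" for r \<alpha> using Lscale[of r \<alpha> 0 "\<lambda>x. 0"] by simp
  have Lsum: "L r \<alpha> (\<lambda>x. \<Sum>i\<in>I. c i * g i x) = (\<Sum>i\<in>I. c i * L r \<alpha> (g i))"
    if "finite I" for r \<alpha> I c and g :: "('x \<Rightarrow> complex) \<Rightarrow> 'x \<Rightarrow> complex"
    using that by (induction I rule: finite_induct) (auto simp: L0 Ladd Lscale)
  have span: "\<xi> \<in> fs.span T \<longleftrightarrow> (\<exists>c. \<xi> = (\<lambda>x. \<Sum>k\<in>T. c k * k x))" for \<xi>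
    unfolding fs.span_finite[OF T(1)] by (auto simp: fun_eq_iff sum_fun_apply image_iff)
  have sub: "fs.subspace (?V \<alpha>)" for \<alpha>
    using fs.subspace_span[of T] unfolding fsubspace_iff solspace_def by (auto simp: L0 Ladd Lscale)
  have coord: "(\<lambda>x. q \<alpha> * \<xi> x) = (\<lambda>x. \<Sum>f\<in>F. c f * W \<alpha> f x)"
    if "q \<alpha> \<noteq> 0" "\<xi> \<in> ?V \<alpha>" "\<xi> = (\<lambda>x. \<Sum>k\<in>T. c k * k x)" for \<alpha> \<xi> c
  proof
    fix x
    have "\<forall>r\<in>R. (\<Sum>k\<in>T. c k * L r \<alpha> k) = 0"
      using that(2) Lsum[OF T(1), of _ \<alpha> c "\<lambda>k. k"] unfolding solspace_def that(3) by simp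
    then have "q \<alpha> * c k = (\<Sum>f\<in>F. c f * w f k \<alpha>)" if "k \<in> T" for k using w'(4) \<open>q \<alpha> \<noteq> 0\<close> that by blast
    then have "q \<alpha> * \<xi> x = (\<Sum>k\<in>T. (\<Sum>f\<in>F. c f * w f k \<alpha>) * k x)"
      unfolding that(3) sum_distrib_left by (intro sum.cong refl) (simp add: mult.assoc[symmetric])
    also have "\<dots> = (\<Sum>f\<in>F. \<Sum>k\<in>T. c f * w f k \<alpha> * k x)"
      unfolding sum_distrib_right by (rule sum.swap)
    also have "\<dots> = (\<Sum>f\<in>F. c f * W \<alpha> f x)" by (simp add: W_def sum_distrib_left mult.assoc)
    finally show "q \<alpha> * \<xi> x = (\<Sum>f\<in>F. c f * W \<alpha> f x)" .
  qed
  have comb: "(\<Sum>f\<in>F. fscale (u f) (W \<alpha> f)) \<in> fs.span (W \<alpha> ` F)" for \<alpha> u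
    by (rule fs.span_sum, rule fs.span_scale, rule fs.span_base, rule imageI)
  have VW: "?V \<alpha> \<subseteq> fs.span (W \<alpha> ` F)" if "q \<alpha> \<noteq> 0" for \<alpha>
  proof
    fix \<xi> assume th: "\<xi> \<in> ?V \<alpha>"
    then obtain c where c: "\<xi> = (\<lambda>x. \<Sum>k\<in>T. c k * k x)" using span by (auto simp: solspace_def)
    have "\<xi> = (\<Sum>f\<in>F. fscale (c f / q \<alpha>) (W \<alpha> f))"
    proof
      fix x
      have "q \<alpha> * \<xi> x = (\<Sum>f\<in>F. c f * W \<alpha> f x)" using coord[OF that th c] by metis
      then have "\<xi> x = (\<Sum>f\<in>F. c f * W \<alpha> f x) / q \<alpha>" using that by (simp add: field_simps)
      then show "\<xi> x = (\<Sum>f\<in>F. fscale (c f / q \<alpha>) (W \<alpha> f)) x"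
        by (simp add: sum_fun_apply sum_divide_distrib)
    qed
    then show "\<xi> \<in> fs.span (W \<alpha> ` F)" by (simp only: comb)
  qed
  have dimle: "fs.dim (?V \<alpha>) \<le> card F" if "q \<alpha> \<noteq> 0" for \<alpha>
    using fs.dim_le_card[OF VW[OF that]] finF card_image_le[OF finF] le_trans by blast
  have W0: "W \<alpha>0 f \<in> ?V \<alpha>0" if "f \<in> F" for f
    using w(3)[OF that] Lsum[OF T(1), of _ \<alpha>0 _ "\<lambda>k. k"] span unfolding solspace_def W_def by auto
  have zero: "\<forall>g\<in>F. u g = 0" if "(\<lambda>x. \<Sum>f\<in>F. u f * W \<alpha>0 f x) = (\<lambda>x. 0)" for u
  proof
    fix g assume g: "g \<in> F"
    define v where "v k = (\<Sum>f\<in>F. u f * w f k \<alpha>0)" for k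
    have "(\<Sum>k\<in>T. fscale (v k) k) = 0"
    proof
      fix x
      have "(\<Sum>k\<in>T. v k * k x) = (\<Sum>f\<in>F. u f * W \<alpha>0 f x)"
        unfolding v_def W_def sum_distrib_left sum_distrib_right
        by (subst sum.swap) (simp add: mult.assoc)
      with that show "(\<Sum>k\<in>T. fscale (v k) k) x = 0 x" by (simp add: sum_fun_apply fun_eq_iff)
    qed
    then have "v g = 0" using fs.independentD[OF T(2) T(1) order_refl] F g by blast
    moreover have "v g = (\<Sum>f\<in>F. if f = g then u g * q \<alpha>0 else 0)"
      unfolding v_def using w(2)[OF _ g] by (intro sum.cong) (auto split: if_splits)
    then have "v g = u g * q \<alpha>0" using g finF by simp
    ultimately show "u g = 0" using q by simp
  qed
  have inj: "inj_on (W \<alpha>0) F"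
  proof (rule inj_onI, rule ccontr)
    fix f g assume fg: "f \<in> F" "g \<in> F" "W \<alpha>0 f = W \<alpha>0 g" "f \<noteq> g"
    define u where "u k = (if k = f then 1 else if k = g then -1 else (0::complex))" for k
    have "(\<Sum>k\<in>F. u k * W \<alpha>0 k x) = (\<Sum>k\<in>{f, g}. u k * W \<alpha>0 k x)" for x
      using fg finF by (intro sum.mono_neutral_right) (auto simp: u_def)
    then have "(\<lambda>x. \<Sum>k\<in>F. u k * W \<alpha>0 k x) = (\<lambda>x. 0)" using fg by (auto simp: u_def)
    from zero[OF this] fg show False by (auto simp: u_def)
  qed
  have "fs.independent (W \<alpha>0 ` F)"
  proof
    assume "fs.dependent (W \<alpha>0 ` F)"
    then obtain u where u: "\<exists>v\<in>W \<alpha>0 ` F. u v \<noteq> 0" "(\<Sum>v\<in>W \<alpha>0 ` F. fscale (u v) v) = 0"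
      using fs.dependent_finite finF by blast
    have "(\<lambda>x. \<Sum>f\<in>F. u (W \<alpha>0 f) * W \<alpha>0 f x) = (\<lambda>x. 0)"
      using u(2) unfolding sum.reindex[OF inj] by (auto simp: fun_eq_iff sum_fun_apply)
    from zero[OF this] u(1) show False by auto
  qed
  then have "card F \<le> fs.dim (?V \<alpha>0)"
    using fs.dim_mono_finite[of "W \<alpha>0 ` F" "?V \<alpha>0" T] W0 T(1) card_image[OF inj]
      fs.dim_eq_card_independent[of "W \<alpha>0 ` F"] by (auto simp: solspace_def)
  with dimle[OF q(2)] have dim0: "fs.dim (?V \<alpha>0) = card F" by simp
  show ?thesis
  proof (rule that[OF q])
    show "fs.dim (?V \<alpha>) \<le> fs.dim (?V \<alpha>0)" if "q \<alpha> \<noteq> 0" for \<alpha> using dimle[OF that] dim0 by simp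
    fix \<xi> assume th: "\<xi> \<in> ?V \<alpha>0"
    then obtain c where c: "\<xi> = (\<lambda>x. \<Sum>k\<in>T. c k * k x)" using span by (auto simp: solspace_def)
    define \<Xi> where "\<Xi> \<alpha> = (\<lambda>x. \<Sum>f\<in>F. c f * W \<alpha> f x)" for \<alpha>
    have "polyfun n (\<lambda>\<alpha>. \<Xi> \<alpha> x)" for x
      unfolding \<Xi>_def W_def by (intro polyfun_sum polyfun_mult polyfun_const w(1))
    moreover have "\<Xi> \<alpha>0 = (\<lambda>x. q \<alpha>0 * \<xi> x)" using coord[OF q(2) th c] by (simp add: \<Xi>_def)
    moreover have "\<Xi> \<alpha> \<in> ?V \<alpha>" if "q \<alpha> \<noteq> 0" "fs.dim (?V \<alpha>0) \<le> fs.dim (?V \<alpha>)" for \<alpha>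
    proof -
      have "fs.dim (fs.span (W \<alpha> ` F)) \<le> card F"
        using fs.dim_le_card[OF order_refl] finF card_image_le[OF finF] le_trans
        by (metis finite_imageI)
      then have "?V \<alpha> = fs.span (W \<alpha> ` F)"
        using fs.subspace_eq_of_dim_le[OF sub VW[OF that(1)] order_refl] finF that(2) dim0 by auto
      moreover have "\<Xi> \<alpha> = (\<Sum>f\<in>F. fscale (c f) (W \<alpha> f))"
        by (auto simp: \<Xi>_def sum_fun_apply)
      ultimately show ?thesis by (simp only: comb)
    qed
    ultimately show "\<exists>\<Xi>. (\<forall>x. polyfun n (\<lambda>\<alpha>. \<Xi> \<alpha> x)) \<and> \<Xi> \<alpha>0 = (\<lambda>x. q \<alpha>0 * \<xi> x) \<and>
       (\<forall>\<alpha>. q \<alpha> \<noteq> 0 \<longrightarrow> fs.dim (?V \<alpha>0) \<le> fs.dim (?V \<alpha>) \<longrightarrow> \<Xi> \<alpha> \<in> ?V \<alpha>)"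
      by blast
  qed
qed

section \<open>Logarithmic derivations of large degree\<close>

declare fscale_apply [simp del] \<comment> \<open>it would rewrite inside eta-expanded occurrences of spans and dimensions\<close>

primrec monomials :: "nat \<Rightarrow> (complex^3 \<Rightarrow> complex) set" where
  "monomials 0 = {\<lambda>x. 1}"
| "monomials (Suc d) = (\<lambda>(k, m) x. x $ k * m x) ` (UNIV \<times> monomials d)"

lemma finite_monomials: "finite (monomials d)"
  by (induction d) auto

lemma form_monomials: "m \<in> monomials d \<Longrightarrow> form d m"
  by (induction d arbitrary: m) (auto intro: form_const form_coord)

lemma fspan_add: "f \<in> fs.span T \<Longrightarrow> g \<in> fs.span T \<Longrightarrow> (\<lambda>x. f x + g x) \<in> fs.span T"
  using fs.span_add[of f T g] by (simp add: plus_fun_def)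

lemma fspan_scale: "f \<in> fs.span T \<Longrightarrow> (\<lambda>x. c * f x) \<in> fs.span T"
  using fs.span_scale[of f T c] by (simp add: fscale_def)

lemma fspan_zero: "(\<lambda>x. 0) \<in> fs.span T"
  using fs.span_zero[of T] by (simp add: zero_fun_def)

lemma fspan_sum: "(\<And>i. i \<in> I \<Longrightarrow> f i \<in> fs.span T) \<Longrightarrow> (\<lambda>x. \<Sum>i\<in>I. f i x) \<in> fs.span T"
  by (induction I rule: infinite_finite_induct) (auto intro: fspan_zero fspan_add)

lemma fspan_induct [consumes 1, case_names base zero add scale]:
  assumes "f \<in> fs.span T" "\<And>g. g \<in> T \<Longrightarrow> P g" "P (\<lambda>x. 0)"
    "\<And>g h. P g \<Longrightarrow> P h \<Longrightarrow> P (\<lambda>x. g x + h x)" "\<And>c g. P g \<Longrightarrow> P (\<lambda>x. c * g x)"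
  shows "P f"
  using fs.span_induct[OF assms(1), of P] assms(2-5) fsubspace_iff[of "{f. P f}"] by simp

lemma form_imp_span_monomials: "form d F \<Longrightarrow> F \<in> fs.span (monomials d)"
proof (induction rule: form.induct)
  case (form_const c)
  have "(\<lambda>x. c * 1) \<in> fs.span (monomials 0)" by (rule fspan_scale, rule fs.span_base) simp
  then show ?case by (simp only: mult_1_right)
next
  case (form_coord j F k)
  from form_coord.IH show ?case
  proof (induction rule: fspan_induct)
    case (base g)
    then show ?case by (intro fs.span_base) auto
  next
    case (scale c g)
    have "(\<lambda>x. x $ k * (c * g x)) = (\<lambda>x. c * (x $ k * g x))" by auto
    then show ?case by (simp only: fspan_scale[OF scale])
  qed (auto simp: distrib_left intro: fspan_zero fspan_add)
qed (rule fspan_add)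

definition vmonomials :: "nat \<Rightarrow> (3 \<times> (complex^3) \<Rightarrow> complex) set" where
  "vmonomials d = (\<lambda>(k, m) (l, x). if l = k then m x else 0) ` (UNIV \<times> monomials d)"

lemma finite_vmonomials: "finite (vmonomials d)"
  by (simp add: vmonomials_def finite_monomials)

lemma vfield_lincomb:
  "vfield d (\<lambda>x. 0)" "vfield d f \<Longrightarrow> vfield d g \<Longrightarrow> vfield d (\<lambda>x. f x + g x)"
  "vfield d f \<Longrightarrow> vfield d (\<lambda>x. c * f x)"
  by (auto simp: vfield_def intro: form_zero form_add form_cmult)

lemma span_vmonomials: "fs.span (vmonomials d) = {\<xi>. vfield d \<xi>}"
proof (intro equalityI subsetI CollectI)
  fix \<xi> assume "\<xi> \<in> fs.span (vmonomials d)"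
  then show "vfield d \<xi>"
  proof (induction rule: fspan_induct)
    case (base g)
    then obtain k m where km: "m \<in> monomials d" "g = (\<lambda>(l, x). if l = k then m x else 0)"
      by (auto simp: vmonomials_def)
    have "form d (\<lambda>x. if l = k then m x else 0)" for l
      using km(1) by (cases "l = k") (auto intro: form_monomials form_zero)
    then show ?case by (simp add: vfield_def km(2))
  qed (auto intro: vfield_lincomb)
next
  fix \<xi> assume "\<xi> \<in> {\<xi>. vfield d \<xi>}"
  then have f: "(\<lambda>x. \<xi> (k, x)) \<in> fs.span (monomials d)" for k
    by (auto simp: vfield_def intro: form_imp_span_monomials)
  have "(\<lambda>(l, x). if l = k then F x else 0) \<in> fs.span (vmonomials d)" if "F \<in> fs.span (monomials d)" for k F
    using that
  proof (induction rule: fspan_induct)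
    case (base g)
    then show ?case by (intro fs.span_base) (auto simp: vmonomials_def)
  next
    case zero
    have "(\<lambda>(l, x). if l = k then 0 else 0) = (\<lambda>z :: 3 \<times> (complex^3). 0::complex)" by auto
    then show ?case by (simp only: fspan_zero)
  next
    case (add g h)
    have "(\<lambda>(l, x). if l = k then g x + h x else 0)
        = (\<lambda>z. (\<lambda>(l, x). if l = k then g x else 0) z + (\<lambda>(l, x). if l = k then h x else 0) z)" by auto
    then show ?case using fspan_add[OF add] by simp
  next
    case (scale c g)
    have "(\<lambda>(l, x). if l = k then c * g x else 0) = (\<lambda>z. c * (\<lambda>(l, x). if l = k then g x else 0) z)" by auto
    then show ?case using fspan_scale[OF scale, of c] by simp
  qed
  then have "(\<lambda>z. \<Sum>k\<in>UNIV. (\<lambda>(l, x). if l = k then \<xi> (k, x) else 0) z) \<in> fs.span (vmonomials d)"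
    using f by (intro fspan_sum) blast
  moreover have "(\<Sum>k\<in>UNIV. (\<lambda>(l, x). if l = k then \<xi> (k, x) else 0) z) = \<xi> z" for z
    by (cases z) simp
  ultimately show "\<xi> \<in> fs.span (vmonomials d)" by simp
qed

lemma vval_lincomb: "vval (\<lambda>z. 0) x = 0" "vval (\<lambda>z. f z + g z) x = vval f x + vval g x"
  "vval (\<lambda>z. c * f z) x = c *s vval f x"
  by (simp_all add: vec_eq_iff)

lemma subspace_logder: "fs.subspace (logder n \<alpha> d)"
  unfolding fsubspace_iff logder_def by (auto simp: vfield_lincomb vval_lincomb pairing_simps)

lemma logder_span: "logder n \<alpha> d \<subseteq> fs.span (vmonomials d)"
  by (auto simp: span_vmonomials logder_def)

lemma form_pairing_vval: "vfield d \<xi> \<Longrightarrow> form d (\<lambda>x. pairing a (vval \<xi> x))"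
  unfolding pairing_def vval_nth vfield_def by (intro form_sum form_cmult) auto

section \<open>Coordinates on a plane, adapted to the other planes\<close>

lemma exists_avoiding:
  assumes "finite I" "\<And>i. i \<in> I \<Longrightarrow> \<exists>x\<in>U. pairing (b i) x \<noteq> 0"
    and U: "0 \<in> U" "\<And>x y t. x \<in> U \<Longrightarrow> y \<in> U \<Longrightarrow> x + t *s y \<in> U"
  shows "\<exists>v\<in>U. \<forall>i\<in>I. pairing (b i) v \<noteq> 0"
  using assms(1,2)
proof (induction I rule: finite_induct)
  case (insert m I)
  then obtain v where v: "v \<in> U" "\<forall>i\<in>I. pairing (b i) v \<noteq> 0" by blast
  obtain x where x: "x \<in> U" "pairing (b m) x \<noteq> 0" using insert.prems by blast
  show ?case
  proof (cases "pairing (b m) v = 0")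
    case True
    obtain t where t: "t \<notin> (\<lambda>i. - pairing (b i) x / pairing (b i) v) ` I"
      using ex_new_if_finite[OF infinite_UNIV_char_0] insert.hyps(1) by blast
    have "pairing (b i) (x + t *s v) \<noteq> 0" if "i \<in> I" for i
    proof
      assume "pairing (b i) (x + t *s v) = 0"
      then have "t = - pairing (b i) x / pairing (b i) v"
        using v(2) that by (simp add: pairing_simps field_simps add_eq_0_iff)
      with t that show False by blast
    qed
    moreover have "pairing (b m) (x + t *s v) \<noteq> 0" using True x by (simp add: pairing_simps)
    ultimately show ?thesis using U(2)[OF x(1) v(1)] by blast
  next
    case False
    with v show ?thesis by blast
  qed
qed (use U in auto)

lemma annihilator_crossC:
  assumes "crossC a b \<noteq> 0" "pairing a y = 0" "pairing b y = 0"
  shows "\<exists>c. y = c *s crossC a b"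
proof (cases "y = 0")
  case True
  then show ?thesis by (intro exI[of _ 0]) simp
next
  case False
  have "crossC (crossC a b) y = pairing a y *s b - pairing b y *s a"
    by (simp add: vec_eq_iff forall_3 pairing_eq algebra_simps)
  with assms have "crossC (crossC a b) y = 0" by simp
  then show ?thesis using crossC_eq_0_imp_proportional[OF assms(1) False] by (auto simp: proportional_def)
qed

text \<open>Both x and \<open>crossC a b\<close> span the line in which the planes of a and b meet,
  so d annihilates \<open>crossC a b\<close> and is a cross product with it; expanding the double
  cross product gives the combination.\<close>

lemma pencil_relation:
  assumes "a \<noteq> 0" "b \<noteq> 0" "\<not> proportional a b" "x \<noteq> 0" "pairing a x = 0" "pairing b x = 0" "pairing d x = 0"
  shows "\<exists>c e. d = c *s b + e *s a"
proof -
  have ne: "crossC a b \<noteq> 0" using assms crossC_eq_0_imp_proportional by blast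
  then obtain c where c: "x = c *s crossC a b" using annihilator_crossC assms by blast
  with assms(4) have "c \<noteq> 0" by auto
  with c assms(7) have "pairing (crossC a b) d = 0" by (simp add: pairing_simps pairing_commute)
  then obtain y where "d = crossC (crossC a b) y" using hyp_crossC[OF ne, of d] by (auto simp: mem_hyp)
  also have "\<dots> = pairing a y *s b + (- pairing b y) *s a"
    by (simp add: vec_eq_iff forall_3 pairing_eq algebra_simps)
  finally show ?thesis by blast
qed

text \<open>The vectors u and v form a basis of the plane with dual coordinates e and f. As v lies
  off every other plane, each of these meets the affine line u + t v in exactly one point, and
  nothing is lost at infinity.\<close>

lemma plane_parametrization:
  assumes a: "a \<noteq> 0" and I: "finite I" "\<And>i. i \<in> I \<Longrightarrow> b i \<noteq> 0 \<and> \<not> proportional a (b i)"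
  obtains u v e f where "pairing a u = 0" "pairing a v = 0" "pairing e u = 1" "pairing e v = 0"
    "pairing f u = 0" "pairing f v = 1" "\<And>x. x \<in> hyp a \<Longrightarrow> x = pairing e x *s u + pairing f x *s v"
    "\<And>i. i \<in> I \<Longrightarrow> pairing (b i) v \<noteq> 0"
proof -
  obtain g where g: "g \<noteq> 0" "\<not> proportional a g" using exists_nonproportional a by blast
  have "\<exists>v\<in>hyp a. \<forall>h\<in>insert g (b ` I). pairing h v \<noteq> 0"
  proof (rule exists_avoiding[where b = "\<lambda>h. h"])
    fix h assume "h \<in> insert g (b ` I)"
    then have "h \<noteq> 0" "\<not> proportional a h" using g I(2) by auto
    then obtain w where "pairing a w = 0" "pairing h w = 1" using exists_separating a by blast
    then show "\<exists>x\<in>hyp a. pairing h x \<noteq> 0" by (intro bexI[of _ w]) (simp_all add: mem_hyp)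
  qed (use I(1) in \<open>auto simp: mem_hyp pairing_simps\<close>)
  then obtain v where v: "pairing a v = 0" "pairing g v \<noteq> 0" "\<And>i. i \<in> I \<Longrightarrow> pairing (b i) v \<noteq> 0"
    by (auto simp: mem_hyp)
  define f where "f = inverse (pairing g v) *s g"
  have f: "pairing f v = 1" using v(2) by (simp add: f_def pairing_simps)
  define u where "u = crossC a g"
  have u0: "u \<noteq> 0" unfolding u_def using a g crossC_eq_0_imp_proportional by blast
  have u: "pairing a u = 0" "pairing f u = 0" by (simp_all add: u_def f_def pairing_simps)
  obtain e' where "pairing u e' = 1" using exists_pairing_one u0 by blast
  then have e': "pairing e' u = 1" by (simp add: pairing_commute)
  define e where "e = e' - pairing e' v *s f"
  have e: "pairing e u = 1" "pairing e v = 0" using e' u f by (simp_all add: e_def pairing_simps)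
  have "x = pairing e x *s u + pairing f x *s v" if x: "x \<in> hyp a" for x
  proof -
    let ?y = "x - pairing e x *s u - pairing f x *s v"
    have "pairing a ?y = 0" "pairing f ?y = 0" "pairing e ?y = 0"
      using x u v f e by (simp_all add: mem_hyp pairing_simps)
    moreover have "pairing f z = inverse (pairing g v) * pairing g z" for z
      by (simp add: f_def pairing_simps)
    with \<open>pairing f ?y = 0\<close> v(2) have "pairing g ?y = 0" by simp
    ultimately obtain c where c: "?y = c *s u" using annihilator_crossC[of a g ?y] u0 u_def by blast
    with \<open>pairing e ?y = 0\<close> e have "c = 0" by (simp add: pairing_simps)
    with c show ?thesis by (simp add: algebra_simps)
  qed
  then show ?thesis using that u v e f by blast
qed

text \<open>Homogeneity reduces s \<noteq> 0 to the affine line; for s = 0 the restriction to a line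
  parallel to u is a polynomial that is zero off one parameter.\<close>

lemma form_zero_on_plane:
  assumes "form d F" "\<And>t. F (u + t *s v) = 0" shows "F (s *s u + t *s v) = 0"
proof -
  have nz: "F (s *s u + t *s v) = 0" if "s \<noteq> 0" for s t
  proof -
    have "s *s u + t *s v = s *s (u + (t / s) *s v)" using that by (simp add: vec_eq_iff field_simps)
    then have "F (s *s u + t *s v) = s ^ d * F (u + (t / s) *s v)"
      by (simp only: form_homogeneous[OF assms(1)])
    then show ?thesis by (simp only: assms(2) mult_zero_right)
  qed
  obtain p where p: "\<And>r. poly p r = F (t *s v + r *s u)" using form_on_line[OF assms(1)] by blast
  have "p = 0" using nz p by (intro poly_eq_0_cofinite[of "{0}"]) (auto simp: add.commute)
  then show ?thesis using p[of s] by (simp add: add.commute)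
qed

section \<open>Univariate polynomials with prescribed roots\<close>

lemma dim_poly_multiples:
  assumes "B \<noteq> (0::complex poly)"
  shows "fs.dim {\<lambda>t. poly (B * q) t | q. degree q \<le> m} = Suc m"
proof (rule fs.dim_unique)
  let ?b = "\<lambda>k. (\<lambda>t. poly (B * monom 1 k) t)"
  let ?V = "{\<lambda>t. poly (B * q) t | q. degree q \<le> m}"
  have zero: "c k = 0" if "\<And>t. (\<Sum>k\<le>m. c k * ?b k t) = 0" "k \<le> m" for c k
  proof -
    have "poly (B * (\<Sum>k\<le>m. monom (c k) k)) t = 0" for t
      using that(1)[of t] by (simp add: poly_sum poly_monom sum_distrib_left mult_ac)
    then have "B * (\<Sum>k\<le>m. monom (c k) k) = 0" by (metis poly_all_0_iff_0)
    then have "(\<Sum>k\<le>m. monom (c k) k) = 0" using assms by simp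
    from arg_cong[OF this, of "\<lambda>p. coeff p k"] that(2) show ?thesis by (simp add: coeff_sum)
  qed
  have inj: "inj_on ?b {..m}"
  proof (rule inj_onI)
    fix k l assume kl: "?b k = ?b l"
    then have "B * monom 1 k = B * monom 1 l" by (simp only: poly_eq_poly_eq_iff)
    then show "k = l" using assms by (simp add: monom_eq_iff')
  qed
  show "?b ` {..m} \<subseteq> ?V" by (auto intro!: exI[of _ "monom 1 _"] simp: degree_monom_eq)
  show "card (?b ` {..m}) = Suc m" using card_image[OF inj] by simp
  show "fs.independent (?b ` {..m})"
  proof
    assume "fs.dependent (?b ` {..m})"
    then obtain c where c: "\<exists>v\<in>?b ` {..m}. c v \<noteq> 0" "(\<Sum>v\<in>?b ` {..m}. fscale (c v) v) = 0"
      using fs.dependent_finite[of "?b ` {..m}"] by auto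
    have "(\<Sum>k\<le>m. c (?b k) * ?b k t) = 0" for t
      using fun_cong[OF c(2), of t] unfolding sum.reindex[OF inj]
      by (simp only: sum_fun_apply fscale_apply o_def zero_fun_def)
    from zero[OF this] c(1) show False by auto
  qed
  show "?V \<subseteq> fs.span (?b ` {..m})"
  proof safe
    fix q :: "complex poly" assume q: "degree q \<le> m"
    have "poly (B * q) = (\<lambda>t. \<Sum>k\<le>m. coeff q k * ?b k t)"
      by (rule ext) (simp add: poly_as_sum[OF q] poly_monom sum_distrib_left mult_ac)
    also have "\<dots> \<in> fs.span (?b ` {..m})"
      by (intro fspan_sum fspan_scale fs.span_base) auto
    finally show "poly (B * q) \<in> fs.span (?b ` {..m})" .
  qed
qed

text \<open>This supplies the surjectivity in the count for one added plane, where the partial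
  products come from fields that leave out one linear factor. Subtracting a multiple of the product
  over \<open>R\<close> makes q vanish at the new node, whose linear factor is then divided
  out.\<close>

lemma lagrange_combination:
  fixes q :: "complex poly"
  assumes "finite R" "R \<noteq> {}" "inj_on t R" "degree q \<le> k + card R - 1"
  shows "\<exists>g. (\<forall>r\<in>R. degree (g r) \<le> k) \<and> q = (\<Sum>r\<in>R. g r * (\<Prod>s\<in>R-{r}. [:- t s, 1:]))"
  using assms
proof (induction R arbitrary: q rule: finite_ne_induct)
  case (singleton x)
  then show ?case by (intro exI[of _ "\<lambda>_. q"]) simp
next
  case (insert \<sigma> R)
  let ?P = "\<Prod>s\<in>R. [:- t s, 1:]"
  have nz: "poly ?P (t \<sigma>) \<noteq> 0"
    using insert.prems(1) insert.hyps by (auto simp: poly_prod inj_on_def)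
  define c where "c = poly q (t \<sigma>) / poly ?P (t \<sigma>)"
  have "poly (q - smult c ?P) (t \<sigma>) = 0" using nz by (simp add: c_def)
  then obtain p where p: "q - smult c ?P = [:- t \<sigma>, 1:] * p" unfolding poly_eq_0_iff_dvd by (rule dvdE)
  have dP: "degree ?P = card R" by (subst degree_prod_eq_sum_degree) auto
  have card: "card R \<ge> 1" using insert.hyps by (simp add: Suc_le_eq card_gt_0_iff)
  have "degree (q - smult c ?P) \<le> k + card R"
    using insert.prems(2) insert.hyps dP
    by (intro degree_diff_le) (auto intro: order_trans[OF degree_smult_le])
  then have "degree p \<le> k + card R - 1"
    unfolding p by (cases "p = 0") (auto simp: degree_mult_eq simp del: mult_pCons_left)
  moreover have "inj_on t R" using insert.prems(1) by simp
  ultimately obtain g where g: "\<forall>r\<in>R. degree (g r) \<le> k"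
    "p = (\<Sum>r\<in>R. g r * (\<Prod>s\<in>R-{r}. [:- t s, 1:]))" using insert.IH by blast
  define g' where "g' r = (if r = \<sigma> then [:c:] else g r)" for r
  have eq: "g' r * (\<Prod>s\<in>insert \<sigma> R - {r}. [:- t s, 1:]) = [:- t \<sigma>, 1:] * (g r * (\<Prod>s\<in>R-{r}. [:- t s, 1:]))"
    if "r \<in> R" for r
  proof -
    have "insert \<sigma> R - {r} = insert \<sigma> (R - {r})" "r \<noteq> \<sigma>" using that insert.hyps by auto
    then show ?thesis using insert.hyps by (simp add: g'_def mult.left_commute del: mult_pCons_left)
  qed
  have "q = smult c ?P + [:- t \<sigma>, 1:] * p" using p by (simp add: algebra_simps)
  also have "smult c ?P = g' \<sigma> * (\<Prod>s\<in>insert \<sigma> R - {\<sigma>}. [:- t s, 1:])"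
    using insert.hyps by (simp add: g'_def)
  also have "[:- t \<sigma>, 1:] * p = (\<Sum>r\<in>R. g' r * (\<Prod>s\<in>insert \<sigma> R - {r}. [:- t s, 1:]))"
    unfolding g(2) sum_distrib_left by (intro sum.cong refl) (simp only: eq)
  finally have "q = (\<Sum>r\<in>insert \<sigma> R. g' r * (\<Prod>s\<in>insert \<sigma> R - {r}. [:- t s, 1:]))"
    using insert.hyps by simp
  moreover have "\<forall>r\<in>insert \<sigma> R. degree (g' r) \<le> k" using g(1) by (simp add: g'_def)
  ultimately show ?case by blast
qed

lemma prod_power_linear_dvd:
  fixes f :: "complex poly"
  assumes "finite T" "\<And>\<tau>. \<tau> \<in> T \<Longrightarrow> [:- \<tau>, 1:] ^ m \<tau> dvd f"
  shows "(\<Prod>\<tau>\<in>T. [:- \<tau>, 1:] ^ m \<tau>) dvd f"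
  using assms
proof (induction T rule: finite_induct)
  case (insert \<sigma> T)
  show ?case
  proof (cases "f = 0")
    case False
    let ?P = "\<Prod>\<tau>\<in>T. [:- \<tau>, 1:] ^ m \<tau>"
    obtain g where g: "f = ?P * g" using insert by (auto elim: dvdE)
    have "poly ?P \<sigma> \<noteq> 0" using insert.hyps by (auto simp: poly_prod poly_power)
    then have "order \<sigma> ?P = 0" by (rule order_0I)
    then have "order \<sigma> f = order \<sigma> g" using False g order_mult[of ?P g \<sigma>] by simp
    moreover have "[:- \<sigma>, 1:] ^ m \<sigma> dvd f" using insert.prems by simp
    ultimately have "[:- \<sigma>, 1:] ^ m \<sigma> dvd g" using False by (simp add: order_divides)
    then have "[:- \<sigma>, 1:] ^ m \<sigma> * ?P dvd g * ?P" by (rule mult_dvd_mono) simp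
    then show ?thesis using insert.hyps g by (simp add: mult.commute)
  qed simp
qed simp

lemma prod_linear_dvd:
  fixes f :: "complex poly"
  assumes "finite N" "\<And>\<tau>. \<tau> \<in> t ` N \<Longrightarrow> [:- \<tau>, 1:] ^ card {j\<in>N. t j = \<tau>} dvd f"
  shows "(\<Prod>j\<in>N. [:- t j, 1:]) dvd f"
proof -
  have "(\<Prod>j\<in>N. [:- t j, 1:]) = (\<Prod>\<tau>\<in>t ` N. \<Prod>j\<in>{j\<in>N. t j = \<tau>}. [:- t j, 1:])"
    using assms(1) by (subst prod.group) auto
  also have "\<dots> = (\<Prod>\<tau>\<in>t ` N. [:- \<tau>, 1:] ^ card {j\<in>N. t j = \<tau>})"
    by (intro prod.cong refl) simp
  finally show ?thesis using prod_power_linear_dvd[of "t ` N"] assms by simp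
qed

text \<open>If k + 1 old planes pass through a point of H_i, then \<alpha>_i(\<xi>) restricted to
  H_i vanishes there to order at least k: \<open>m\<close> is one of these planes and
  \<open>C\<close> collects the others. Write \<alpha>_m(\<xi>) = \<alpha>_m g and subtract g times
  the Euler field from \<xi>; the component along \<alpha>_m becomes 0 and the one along \<alpha>_i
  becomes \<open>?H\<close>. Since all these planes share a line, each \<alpha>_j with j in
  \<open>C\<close> is a combination of \<alpha>_m and \<alpha>_i, so tangency to H_j makes
  \<open>?H\<close> vanish on H_j. On H_i it agrees with \<alpha>_i(\<xi>).\<close>

lemma logder_restriction_dvd:
  assumes A: "arrangement (Suc i) \<alpha>" and \<xi>: "\<xi> \<in> logder i \<alpha> d" and d: "d \<ge> 1"
    and uv: "pairing (\<alpha> i) u = 0" "pairing (\<alpha> i) v = 0" "u + \<tau> *s v \<noteq> 0"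
    and C: "C \<subseteq> {..<i}" and m: "m < i" "m \<notin> C" "pairing (\<alpha> m) (u + \<tau> *s v) = 0"
    and \<tau>: "\<And>j. j \<in> C \<Longrightarrow> pairing (\<alpha> j) (u + \<tau> *s v) = 0"
    and f: "\<And>t. poly f t = pairing (\<alpha> i) (vval \<xi> (u + t *s v))"
  shows "[:- \<tau>, 1:] ^ card C dvd f"
proof -
  let ?F = "\<lambda>x. pairing (\<alpha> i) (vval \<xi> x)"
  have fin: "finite C" using C finite_subset by blast
  have vf: "vfield d \<xi>" using \<xi> by (simp add: logder_def)
  have tang: "pairing (\<alpha> j) (vval \<xi> x) = 0" if "j < i" "pairing (\<alpha> j) x = 0" for j x
    using \<xi> that by (simp add: logder_def mem_hyp)
  note nz = arrangementD(1)[OF A] and np = arrangementD(2)[OF A]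
  obtain g where g: "form (d - 1) g" "\<And>x. pairing (\<alpha> m) (vval \<xi> x) = pairing (\<alpha> m) x * g x"
    using form_vanishing[OF form_pairing_vval[OF vf], of "\<alpha> m" "\<alpha> m"] nz[of m] m tang
    by (auto simp: mem_hyp)
  let ?H = "\<lambda>x. ?F x - pairing (\<alpha> i) x * g x"
  have "form d (\<lambda>x. pairing (\<alpha> i) x * g x)" using form_pairing_mult[OF g(1)] d by simp
  with form_pairing_vval[OF vf] have H: "form d ?H" by (rule form_diff)
  have "?H x = 0" if "j \<in> C" "x \<in> hyp (\<alpha> j)" for j x
  proof -
    have j: "j < i" "j \<noteq> m" using that C m by auto
    obtain c e where ce: "\<alpha> j = c *s \<alpha> m + e *s \<alpha> i"
      using pencil_relation[of "\<alpha> i" "\<alpha> m" "u + \<tau> *s v" "\<alpha> j"] nz[of i] nz[of m] np[of i m] m uv \<tau>[OF \<open>j \<in> C\<close>]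
      by (auto simp: pairing_simps)
    have "e \<noteq> 0"
    proof
      assume "e = 0"
      with ce have "\<alpha> j = c *s \<alpha> m" by simp
      moreover from this have "c \<noteq> 0" using nz[of j] j by auto
      ultimately have "proportional (\<alpha> m) (\<alpha> j)" by (auto simp: proportional_def)
      then show False using np[of m j] j m by auto
    qed
    have x: "c * pairing (\<alpha> m) x + e * pairing (\<alpha> i) x = 0"
      using that(2) by (simp add: mem_hyp ce pairing_simps)
    have "c * pairing (\<alpha> m) (vval \<xi> x) + e * ?F x = 0"
      using tang[OF j(1), of x] that(2) by (simp add: mem_hyp ce pairing_simps)
    then have "e * ?H x + (c * pairing (\<alpha> m) x + e * pairing (\<alpha> i) x) * g x = 0"
      by (simp add: g(2) algebra_simps)
    with x \<open>e \<noteq> 0\<close> show ?thesis by simp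
  qed
  moreover have "\<alpha> j \<noteq> 0" if "j \<in> C" for j using that C nz[of j] by auto
  moreover have "\<not> proportional (\<alpha> j) (\<alpha> k)" if "j \<in> C" "k \<in> C" "j \<noteq> k" for j k
  proof (rule np)
    show "j < Suc i" "k < Suc i" using that C less_SucI by blast+
  qed fact
  ultimately obtain G where G: "form (d - card C) G" "\<And>x. ?H x = (\<Prod>j\<in>C. pairing (\<alpha> j) x) * G x"
    using form_vanishing_prod[OF fin H, of \<alpha>] by blast
  obtain h where h: "\<And>t. poly h t = G (u + t *s v)" using form_on_line[OF G(1)] by blast
  have "pairing (\<alpha> j) (u + t *s v) = pairing (\<alpha> j) v * (t - \<tau>)" if "j \<in> C" for j t
    using \<tau>[OF that] by (simp add: pairing_simps algebra_simps add_eq_0_iff)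
  then have "(\<Prod>j\<in>C. pairing (\<alpha> j) (u + t *s v)) = (\<Prod>j\<in>C. pairing (\<alpha> j) v) * (t - \<tau>) ^ card C" for t
    by (simp add: prod.distrib)
  then have "?F (u + t *s v) = (\<Prod>j\<in>C. pairing (\<alpha> j) v) * (t - \<tau>) ^ card C * G (u + t *s v)" for t
    using G(2)[of "u + t *s v"] uv by (simp add: pairing_simps)
  then have "poly f t = poly ([:- \<tau>, 1:] ^ card C * smult (\<Prod>j\<in>C. pairing (\<alpha> j) v) h) t" for t
    by (simp add: f h poly_power algebra_simps)
  then have "f = [:- \<tau>, 1:] ^ card C * smult (\<Prod>j\<in>C. pairing (\<alpha> j) v) h"
    by (intro iffD1[OF poly_eq_poly_eq_iff] ext)
  then show ?thesis by (rule dvdI)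
qed

text \<open>The field is a constant vector w times a polynomial: the product of the \<alpha>_j with
  j \<noteq> r makes it tangent to these H_j, and w lies in H_r. The degree is (i - 1) + (d + 1 - i)
  = d, which is where i \<le> d + 1 enters. The constant \<kappa> removes the leading coefficients
  of the forms on the line u + s v.\<close>

lemma logder_extension_field:
  assumes A: "arrangement (Suc i) \<alpha>" and d: "i \<le> Suc d"
    and uv: "pairing (\<alpha> i) u = 0" "pairing (\<alpha> i) v = 0"
    and ef: "pairing e u = 1" "pairing e v = 0" "pairing f u = 0" "pairing f v = 1"
    and v: "\<And>j. j < i \<Longrightarrow> pairing (\<alpha> j) v \<noteq> 0"
    and t: "\<And>j. j < i \<Longrightarrow> t j = - pairing (\<alpha> j) u / pairing (\<alpha> j) v"
    and r: "r < i" and q: "degree q \<le> Suc d - i"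
  shows "\<exists>\<xi>\<in>logder i \<alpha> d. \<forall>s. pairing (\<alpha> i) (vval \<xi> (u + s *s v))
    = poly (q * (\<Prod>j\<in>{..<i}-{r}. [:- t j, 1:])) s"
proof -
  note nz = arrangementD(1)[OF A] and np = arrangementD(2)[OF A]
  define \<kappa> where "\<kappa> = (\<Prod>j\<in>{..<i}-{r}. pairing (\<alpha> j) v)"
  have \<kappa>: "\<kappa> \<noteq> 0" using v by (simp add: \<kappa>_def)
  obtain w where w: "pairing (\<alpha> r) w = 0" "pairing (\<alpha> i) w = 1"
    using exists_separating[of "\<alpha> r" "\<alpha> i"] nz[of r] nz[of i] np[of r i] r by auto
  have "degree (smult (1 / \<kappa>) q) \<le> Suc d - i" using q degree_smult_le order_trans by blast
  then obtain G where G: "form (Suc d - i) G" "\<And>s. G (u + s *s v) = poly (smult (1 / \<kappa>) q) s"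
    using form_of_poly[OF ef] by blast
  let ?P = "\<lambda>x. \<Prod>j\<in>{..<i}-{r}. pairing (\<alpha> j) x"
  let ?\<xi> = "\<lambda>(k, x). w $ k * (?P x * G x)"
  have val: "vval ?\<xi> x = (?P x * G x) *s w" for x by (simp add: vec_eq_iff)
  have "form (card ({..<i}-{r}) + (Suc d - i)) (\<lambda>x. ?P x * G x)"
    by (intro form_mult form_prod_pairing G(1)) simp
  moreover have "card ({..<i}-{r}) + (Suc d - i) = d" using r d by simp
  ultimately have "vfield d ?\<xi>" by (auto simp: vfield_def intro!: form_cmult)
  moreover have "pairing (\<alpha> j) (vval ?\<xi> x) = 0" if "j < i" "x \<in> hyp (\<alpha> j)" for j x
  proof (cases "j = r")
    case True
    then show ?thesis using w by (simp add: val pairing_simps)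
  next
    case False
    then have "?P x = 0" using that by (auto simp: mem_hyp)
    then show ?thesis by (simp add: val pairing_simps)
  qed
  ultimately have "?\<xi> \<in> logder i \<alpha> d" by (simp add: logder_def)
  moreover have "pairing (\<alpha> i) (vval ?\<xi> (u + s *s v)) = poly (q * (\<Prod>j\<in>{..<i}-{r}. [:- t j, 1:])) s" for s
  proof -
    have "pairing (\<alpha> j) (u + s *s v) = pairing (\<alpha> j) v * (s - t j)" if "j < i" for j
      using t[OF that] v[OF that] by (simp add: pairing_simps field_simps)
    then have "?P (u + s *s v) = (\<Prod>j\<in>{..<i}-{r}. pairing (\<alpha> j) v * (s - t j))"
      by (intro prod.cong refl) auto
    also have "\<dots> = \<kappa> * (\<Prod>j\<in>{..<i}-{r}. s - t j)" by (simp add: prod.distrib \<kappa>_def)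
    finally show ?thesis using \<kappa> by (simp add: val pairing_simps w G(2) poly_prod)
  qed
  ultimately show ?thesis by blast
qed

text \<open>Restricting \<alpha>_i(\<xi>) to the line u + s v gives a map \<Phi> whose kernel is
  D(d) of the enlarged arrangement. Its image consists of the multiples of degree at most d of a
  polynomial \<open>B\<close>, in which a point of the line is a root once for every old plane
  through it beyond the first; so B has degree i - p.\<close>

lemma dim_logder_deletion:
  assumes A: "arrangement (Suc i) \<alpha>" and d: "d \<ge> 1" "i \<le> Suc d"
  shows "fs.dim (logder i \<alpha> d)
    = Suc (d + card ((\<lambda>j. hyp (\<alpha> i) \<inter> hyp (\<alpha> j)) ` {..<i}) - i) + fs.dim (logder (Suc i) \<alpha> d)"
proof -
  note nz = arrangementD(1)[OF A] and np = arrangementD(2)[OF A]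
  obtain u v e f where uv: "pairing (\<alpha> i) u = 0" "pairing (\<alpha> i) v = 0"
    and ef: "pairing e u = 1" "pairing e v = 0" "pairing f u = 0" "pairing f v = 1"
    and plane: "\<And>x. x \<in> hyp (\<alpha> i) \<Longrightarrow> x = pairing e x *s u + pairing f x *s v"
    and v: "\<And>j. j < i \<Longrightarrow> pairing (\<alpha> j) v \<noteq> 0"
  proof (rule plane_parametrization[of "\<alpha> i" "{..<i}" \<alpha>])
    show "\<alpha> i \<noteq> 0" using nz by simp
    show "\<alpha> j \<noteq> 0 \<and> \<not> proportional (\<alpha> i) (\<alpha> j)" if "j \<in> {..<i}" for j
      using that nz[of j] np[of i j] by simp
  qed (use that in auto)
  define t where "t j = - pairing (\<alpha> j) u / pairing (\<alpha> j) v" for j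
  have lin: "pairing (\<alpha> j) (r *s u + s *s v) = pairing (\<alpha> j) v * (s - r * t j)" if "j < i" for j r s
    using v[OF that] by (simp add: t_def pairing_simps field_simps)
  have uv0: "u + s *s v \<noteq> 0" for s
  proof
    assume "u + s *s v = 0"
    from arg_cong[OF this, of "pairing e"] ef show False by (simp add: pairing_simps)
  qed
  define p where "p = card (t ` {..<i})"
  have p: "card ((\<lambda>j. hyp (\<alpha> i) \<inter> hyp (\<alpha> j)) ` {..<i}) = p"
  proof -
    \<comment> \<open>The slope \<tau> determines the line spanned by u + \<tau> v, so counting
      lines of intersection amounts to counting values of \<open>t\<close>.\<close>
    define ray where "ray \<tau> = {r *s u + (r * \<tau>) *s v | r. True}" for \<tau>
    have "hyp (\<alpha> i) \<inter> hyp (\<alpha> j) = ray (t j)" if j: "j < i" for j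
    proof (intro equalityI subsetI)
      fix x assume x: "x \<in> hyp (\<alpha> i) \<inter> hyp (\<alpha> j)"
      then have eq: "x = pairing e x *s u + pairing f x *s v" using plane by blast
      have "pairing (\<alpha> j) (pairing e x *s u + pairing f x *s v) = 0"
        using x eq by (simp add: mem_hyp)
      then have "pairing f x = pairing e x * t j" using lin[OF j] v[OF j] by simp
      with eq show "x \<in> ray (t j)" unfolding ray_def by auto
    next
      fix x assume "x \<in> ray (t j)"
      then obtain r where r: "x = r *s u + (r * t j) *s v" by (auto simp: ray_def)
      have "pairing (\<alpha> i) x = 0" unfolding r using uv by (simp add: pairing_simps)
      moreover have "pairing (\<alpha> j) x = 0" unfolding r lin[OF j] by simp
      ultimately show "x \<in> hyp (\<alpha> i) \<inter> hyp (\<alpha> j)" by (simp add: mem_hyp)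
    qed
    then have "(\<lambda>j. hyp (\<alpha> i) \<inter> hyp (\<alpha> j)) ` {..<i} = ray ` (t ` {..<i})"
      unfolding image_image by (intro image_cong) auto
    moreover have "inj ray"
    proof (rule injI)
      fix \<tau> \<tau>' assume "ray \<tau> = ray \<tau>'"
      moreover have "1 *s u + (1 * \<tau>) *s v \<in> ray \<tau>" unfolding ray_def by blast
      ultimately obtain r where r: "1 *s u + (1 * \<tau>) *s v = r *s u + (r * \<tau>') *s v" by (auto simp: ray_def)
      from arg_cong[OF r, of "pairing e"] ef have "r = 1" by (simp add: pairing_simps)
      with arg_cong[OF r, of "pairing f"] ef show "\<tau> = \<tau>'" by (simp add: pairing_simps)
    qed
    ultimately show ?thesis unfolding p_def by (metis card_image inj_on_subset subset_UNIV)
  qed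
  \<comment> \<open>\<open>R\<close> picks one old plane through each of the p points, and
    \<open>N\<close> gathers the remaining ones, which contribute the roots of
    \<open>B\<close>.\<close>
  obtain R where R: "R \<subseteq> {..<i}" "inj_on t R" "t ` {..<i} = t ` R"
    using subset_image_inj[of "t ` {..<i}" t "{..<i}"] by auto
  have finR: "finite R" using R(1) finite_subset by blast
  have cardR: "card R = p" unfolding p_def R(3) using card_image[OF R(2)] by simp
  have pi: "p \<le> i" unfolding p_def using card_image_le[of "{..<i}" t] by simp
  define N where "N = {..<i} - R"
  have cardN: "card N = i - p" unfolding N_def using R(1) finR cardR by (simp add: card_Diff_subset)
  define B where "B = (\<Prod>j\<in>N. [:- t j, 1:])"
  have B0: "B \<noteq> 0" and degB: "degree B = i - p"
    unfolding B_def using cardN by (auto simp: degree_prod_eq_sum_degree N_def)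
  define \<Phi> where "\<Phi> \<xi> = (\<lambda>s. pairing (\<alpha> i) (vval \<xi> (u + s *s v)))" for \<xi>
  have \<Phi>lin: "Vector_Spaces.linear fscale fscale \<Phi>"
    by (rule flinearI) (auto simp: \<Phi>_def vval_lincomb pairing_simps)
  have ker: "{\<xi> \<in> logder i \<alpha> d. \<Phi> \<xi> = 0} = logder (Suc i) \<alpha> d"
  proof (intro equalityI subsetI)
    fix \<xi> assume \<xi>: "\<xi> \<in> {\<xi> \<in> logder i \<alpha> d. \<Phi> \<xi> = 0}"
    then have F: "form d (\<lambda>x. pairing (\<alpha> i) (vval \<xi> x))" by (auto simp: logder_def form_pairing_vval)
    have "pairing (\<alpha> i) (vval \<xi> (u + s *s v)) = 0" for s
      using \<xi> by (auto simp: \<Phi>_def fun_eq_iff)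
    then have "pairing (\<alpha> i) (vval \<xi> (r *s u + s *s v)) = 0" for r s
      using form_zero_on_plane[OF F] by blast
    then have "pairing (\<alpha> i) (vval \<xi> x) = 0" if "x \<in> hyp (\<alpha> i)" for x using plane[OF that] by metis
    with \<xi> show "\<xi> \<in> logder (Suc i) \<alpha> d" by (auto simp: logder_def less_Suc_eq)
  next
    fix \<xi> assume \<xi>: "\<xi> \<in> logder (Suc i) \<alpha> d"
    have "u + s *s v \<in> hyp (\<alpha> i)" for s using uv by (simp add: mem_hyp pairing_simps)
    with \<xi> show "\<xi> \<in> {\<xi> \<in> logder i \<alpha> d. \<Phi> \<xi> = 0}"
      by (auto simp: logder_def \<Phi>_def zero_fun_def)
  qed
  have image: "\<Phi> ` logder i \<alpha> d = {\<lambda>s. poly (B * q) s | q. degree q \<le> d + p - i}"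
  proof (intro equalityI subsetI)
    fix g assume "g \<in> \<Phi> ` logder i \<alpha> d"
    then obtain \<xi> where \<xi>: "\<xi> \<in> logder i \<alpha> d" "g = \<Phi> \<xi>" by blast
    then have "form d (\<lambda>x. pairing (\<alpha> i) (vval \<xi> x))" by (auto simp: logder_def form_pairing_vval)
    then obtain h where h: "degree h \<le> d" "\<And>s. poly h s = pairing (\<alpha> i) (vval \<xi> (u + s *s v))"
      using form_on_line by blast
    have "B dvd h"
      unfolding B_def
    proof (rule prod_linear_dvd)
      show "finite N" by (simp add: N_def)
      fix \<tau> assume "\<tau> \<in> t ` N"
      then obtain m where m: "m \<in> R" "t m = \<tau>" using R(3) by (auto simp: N_def image_iff) (metis image_iff lessThan_iff)
      show "[:- \<tau>, 1:] ^ card {j \<in> N. t j = \<tau>} dvd h"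
      proof (rule logder_restriction_dvd[OF A \<xi>(1) d(1) uv uv0, where m = m])
        show "m < i" using m R(1) by auto
        then show "pairing (\<alpha> m) (u + \<tau> *s v) = 0" using lin[of m 1 \<tau>] m(2) by simp
        show "pairing (\<alpha> j) (u + \<tau> *s v) = 0" if "j \<in> {j \<in> N. t j = \<tau>}" for j
          using lin[of j 1 \<tau>] that by (auto simp: N_def)
      qed (use m h in \<open>auto simp: N_def\<close>)
    qed
    then obtain q where q: "h = B * q" by (rule dvdE)
    have "degree q \<le> d + p - i"
    proof (cases "q = 0")
      case False
      then have "degree h = i - p + degree q" using B0 degB q by (simp add: degree_mult_eq)
      with h(1) pi show ?thesis by simp
    qed simp
    moreover have "g = (\<lambda>s. poly (B * q) s)" unfolding q[symmetric] using \<xi>(2) h(2) by (auto simp: \<Phi>_def)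
    ultimately show "g \<in> {\<lambda>s. poly (B * q) s | q. degree q \<le> d + p - i}" by blast
  next
    fix g assume "g \<in> {\<lambda>s. poly (B * q) s | q. degree q \<le> d + p - i}"
    then obtain q where q: "degree q \<le> d + p - i" "g = (\<lambda>s. poly (B * q) s)" by blast
    show "g \<in> \<Phi> ` logder i \<alpha> d"
    proof (cases "i = 0")
      \<comment> \<open>Without old planes there is no constraint and no node for the interpolation;
        \<open>B\<close> is 1, and any polynomial of degree at most d is realised by a field in a
        constant direction w.\<close>
      case True
      then have B1: "B = 1" "p = 0" using pi by (simp_all add: B_def N_def)
      obtain F where F: "form d F" "\<And>s. F (u + s *s v) = poly q s"
        using form_of_poly[OF ef, of q d] q(1) B1 True by auto
      obtain w where w: "pairing (\<alpha> i) w = 1" using exists_pairing_one nz by blast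
      let ?\<xi> = "\<lambda>(k, x). w $ k * F x"
      have "vval ?\<xi> x = F x *s w" for x by (simp add: vec_eq_iff)
      then have "\<Phi> ?\<xi> = g" by (simp add: \<Phi>_def pairing_simps w F(2) q(2) B1)
      moreover have "?\<xi> \<in> logder i \<alpha> d" using F(1) True by (auto simp: logder_def vfield_def intro: form_cmult)
      ultimately show ?thesis by blast
    next
      case False
      then have "t ` R \<noteq> {}" unfolding R(3)[symmetric] by (simp add: lessThan_empty_iff)
      then have Rne: "R \<noteq> {}" by blast
      have "p \<ge> 1" using Rne finR cardR by (metis One_nat_def Suc_leI card_gt_0_iff)
      then have "degree q \<le> (Suc d - i) + card R - 1" using q(1) d(2) cardR by simp
      then obtain h where h: "\<forall>r\<in>R. degree (h r) \<le> Suc d - i"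
        "q = (\<Sum>r\<in>R. h r * (\<Prod>s\<in>R-{r}. [:- t s, 1:]))"
        using lagrange_combination[OF finR Rne R(2)] by blast
      have "\<exists>\<xi>. \<xi> \<in> logder i \<alpha> d \<and> (\<forall>s. \<Phi> \<xi> s = poly (h r * (\<Prod>j\<in>{..<i}-{r}. [:- t j, 1:])) s)"
        if "r \<in> R" for r
        using logder_extension_field[OF A d(2) uv ef v, of t r "h r"] that R(1) h(1)
        unfolding t_def \<Phi>_def by blast
      then obtain \<xi> where \<xi>: "\<And>r. r \<in> R \<Longrightarrow> \<xi> r \<in> logder i \<alpha> d"
        "\<And>r s. r \<in> R \<Longrightarrow> \<Phi> (\<xi> r) s = poly (h r * (\<Prod>j\<in>{..<i}-{r}. [:- t j, 1:])) s" by metis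
      have prod: "(\<Prod>j\<in>{..<i}-{r}. [:- t j, 1:]) = B * (\<Prod>s\<in>R-{r}. [:- t s, 1:])" if "r \<in> R" for r
      proof -
        have "{..<i}-{r} = N \<union> (R - {r})" "N \<inter> (R - {r}) = {}" using that R(1) by (auto simp: N_def)
        then show ?thesis unfolding B_def using finR by (simp add: prod.union_disjoint N_def)
      qed
      have "\<Phi> (\<Sum>r\<in>R. \<xi> r) = (\<Sum>r\<in>R. \<Phi> (\<xi> r))" using fsp.linear_sum[OF \<Phi>lin] by blast
      also have "\<dots> = g"
      proof
        fix s
        have "(\<Sum>r\<in>R. \<Phi> (\<xi> r)) s = (\<Sum>r\<in>R. poly (B * (h r * (\<Prod>s\<in>R-{r}. [:- t s, 1:]))) s)"
          unfolding sum_fun_apply by (intro sum.cong refl) (simp add: \<xi>(2) prod mult_ac)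
        also have "\<dots> = poly (B * q) s" unfolding h(2) by (simp add: poly_sum sum_distrib_left)
        finally show "(\<Sum>r\<in>R. \<Phi> (\<xi> r)) s = g s" using q(2) by simp
      qed
      finally have "\<Phi> (\<Sum>r\<in>R. \<xi> r) = g" .
      moreover have "(\<Sum>r\<in>R. \<xi> r) \<in> logder i \<alpha> d" using fs.subspace_sum[OF subspace_logder] \<xi>(1) by blast
      ultimately show ?thesis by blast
    qed
  qed
  have "fs.dim (logder i \<alpha> d) = fs.dim (\<Phi> ` logder i \<alpha> d) + fs.dim {\<xi> \<in> logder i \<alpha> d. \<Phi> \<xi> = 0}"
    by (rule fsp.rank_nullity[OF subspace_logder logder_span finite_vmonomials \<Phi>lin])
  then show ?thesis unfolding ker image p dim_poly_multiples[OF B0] .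
qed

theorem dim_logder_large_degree:
  assumes A: "arrangement n \<alpha>" and d: "d \<ge> 1" "n \<le> Suc d"
  shows "fs.dim {\<xi>. vfield d \<xi>} = fs.dim (logder n \<alpha> d)
    + (\<Sum>i<n. Suc d - i) + (\<Sum>i<n. card ((\<lambda>j. hyp (\<alpha> i) \<inter> hyp (\<alpha> j)) ` {..<i}))"
  using A d(2)
proof (induction n)
  case 0
  show ?case by (simp add: logder_def)
next
  case (Suc i)
  then have "arrangement i \<alpha>" by (auto simp: arrangement_def)
  moreover have "Suc (d + c - i) = Suc d - i + c" for c using Suc.prems by simp
  ultimately show ?case
    using Suc.IH dim_logder_deletion[OF Suc.prems(1) d(1)] Suc.prems(2) by simp
qed

section \<open>The linear coefficient of the characteristic polynomial\<close>

lemma subspace_hyp: "vec.subspace (hyp a)"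
  unfolding vec.subspace_def by (simp add: mem_hyp pairing_simps)

lemma dim_hyp_Int_hyp:
  assumes "a \<noteq> 0" "b \<noteq> 0" "\<not> proportional a b"
  shows "vec.dim (hyp a \<inter> hyp b) = 1"
proof -
  have ne: "crossC a b \<noteq> 0" using assms crossC_eq_0_imp_proportional by blast
  have "hyp a \<inter> hyp b = vec.span {crossC a b}"
  proof (intro equalityI subsetI)
    fix x assume "x \<in> hyp a \<inter> hyp b"
    then obtain c where "x = c *s crossC a b" using annihilator_crossC[OF ne] by (auto simp: mem_hyp)
    then show "x \<in> vec.span {crossC a b}" by (auto simp: vec.span_singleton)
  next
    fix x assume "x \<in> vec.span {crossC a b}"
    then show "x \<in> hyp a \<inter> hyp b" by (auto simp: vec.span_singleton mem_hyp pairing_simps)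
  qed
  then show ?thesis using ne by (simp add: vec.dim_insert)
qed

lemma hyp_subset_hyp_iff:
  assumes "a \<noteq> 0" "b \<noteq> 0"
  shows "hyp a \<subseteq> hyp b \<longleftrightarrow> proportional a b"
proof
  assume sub: "hyp a \<subseteq> hyp b"
  show "proportional a b"
  proof (rule ccontr)
    assume "\<not> proportional a b"
    then obtain w where "pairing a w = 0" "pairing b w = 1" using exists_separating assms by blast
    with sub show False by (auto simp: mem_hyp subset_iff)
  qed
qed (auto simp: proportional_def mem_hyp pairing_simps)

lemma dim_hyp_neq_1:
  assumes "a \<noteq> 0" shows "vec.dim (hyp a) \<noteq> 1"
proof
  assume 1: "vec.dim (hyp a) = 1"
  obtain b where b: "b \<noteq> 0" "\<not> proportional a b" using exists_nonproportional assms by blast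
  have "hyp a \<inter> hyp b = hyp a"
    by (rule vec.subspace_dim_equal)
       (use 1 dim_hyp_Int_hyp[OF assms b] in \<open>auto intro: vec.subspace_inter subspace_hyp\<close>)
  then show False using hyp_subset_hyp_iff[OF assms b(1)] b(2) by blast
qed

lemma hyp_neq_UNIV: "a \<noteq> 0 \<Longrightarrow> hyp a \<noteq> UNIV"
  using exists_pairing_one[of a] mem_hyp[of _ a] by (metis UNIV_I zero_neq_one)

context
  fixes n \<alpha> assumes A: "arrangement n \<alpha>"
begin

text \<open>The flats of rank two: lines in C^3, or the points where at least two lines of the
  arrangement meet in the projective plane.\<close>

private definition "pts = {hyp (\<alpha> i) \<inter> hyp (\<alpha> j) | i j. i < n \<and> j < n \<and> i \<noteq> j}"

private lemma nz: "i < n \<Longrightarrow> \<alpha> i \<noteq> 0"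
  and np: "i < n \<Longrightarrow> j < n \<Longrightarrow> i \<noteq> j \<Longrightarrow> \<not> proportional (\<alpha> i) (\<alpha> j)"
  using arrangementD[OF A] by auto

private lemma dim_pts: "X \<in> pts \<Longrightarrow> vec.dim X = 1"
  and subspace_pts: "X \<in> pts \<Longrightarrow> vec.subspace X"
  using dim_hyp_Int_hyp nz np by (auto simp: pts_def intro: vec.subspace_inter subspace_hyp)

private lemma pts_maximal:
  assumes "X \<in> pts" "X \<subseteq> hyp (\<alpha> i) \<inter> hyp (\<alpha> j)" "i < n" "j < n" "i \<noteq> j"
  shows "X = hyp (\<alpha> i) \<inter> hyp (\<alpha> j)"
  by (rule vec.subspace_dim_equal[OF subspace_pts[OF assms(1)] _ assms(2)])
     (use assms dim_pts dim_hyp_Int_hyp nz np in \<open>auto intro: vec.subspace_inter subspace_hyp\<close>)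

text \<open>The last case comprises every intersection of at least two planes, of rank two or three
  alike; hence an inclusion in place of an equality.\<close>

private lemma intlat_cases:
  assumes "Y \<in> intlat n \<alpha>"
  obtains "Y = UNIV" | i where "i < n" "Y = hyp (\<alpha> i)"
  | i j where "i < n" "j < n" "i \<noteq> j" "Y \<subseteq> hyp (\<alpha> i) \<inter> hyp (\<alpha> j)" "vec.subspace Y"
proof -
  obtain I where I: "I \<subseteq> {..<n}" "Y = \<Inter> (hyp ` \<alpha> ` I)" using assms by (auto simp: intlat_def)
  have sub: "vec.subspace Y" unfolding I(2) by (intro vec.subspace_Inter) (auto intro: subspace_hyp)
  consider "I = {}" | i where "I = {i}" | i j where "i \<in> I" "j \<in> I" "i \<noteq> j" by blast
  then show ?thesis
  proof cases
    case 1
    then show ?thesis using that(1) I by simp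
  next
    case (2 i)
    then show ?thesis using that(2)[of i] I by auto
  next
    case (3 i j)
    then show ?thesis using that(3)[of i j] I sub by auto
  qed
qed

private lemma intlat_mem: "UNIV \<in> intlat n \<alpha>" "i < n \<Longrightarrow> hyp (\<alpha> i) \<in> intlat n \<alpha>" "X \<in> pts \<Longrightarrow> X \<in> intlat n \<alpha>"
proof -
  show "UNIV \<in> intlat n \<alpha>" unfolding intlat_def by (intro CollectI exI[of _ "{}"]) simp
  show "hyp (\<alpha> i) \<in> intlat n \<alpha>" if "i < n" unfolding intlat_def using that by (intro CollectI exI[of _ "{i}"]) simp
  show "X \<in> intlat n \<alpha>" if X: "X \<in> pts"
  proof -
    obtain i j where "i < n" "j < n" "X = hyp (\<alpha> i) \<inter> hyp (\<alpha> j)" using X by (auto simp: pts_def)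
    then show ?thesis unfolding intlat_def by (intro CollectI exI[of _ "{i, j}"]) simp
  qed
qed

private lemma finite_intlat: "finite (intlat n \<alpha>)"
proof -
  have "intlat n \<alpha> = (\<lambda>I. \<Inter> (hyp ` \<alpha> ` I)) ` Pow {..<n}" by (auto simp: intlat_def)
  then show ?thesis by simp
qed

private lemma pts_neq: "X \<in> pts \<Longrightarrow> X \<noteq> UNIV" "X \<in> pts \<Longrightarrow> i < n \<Longrightarrow> X \<noteq> hyp (\<alpha> i)"
  using dim_pts dim_hyp_neq_1 nz vec_dim_card[where 'a = complex and 'n = 3] by fastforce+

private lemma pts_eq: "pts = {X \<in> intlat n \<alpha>. vec.dim X = 1}"
proof (intro equalityI subsetI)
  fix X assume "X \<in> pts"
  then show "X \<in> {X \<in> intlat n \<alpha>. vec.dim X = 1}" using dim_pts intlat_mem(3) by blast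
next
  fix X assume X: "X \<in> {X \<in> intlat n \<alpha>. vec.dim X = 1}"
  then have "X \<in> intlat n \<alpha>" by blast
  then show "X \<in> pts"
  proof (cases rule: intlat_cases)
    case 1
    then show ?thesis using X vec_dim_card[where 'a = complex and 'n = 3] by simp
  next
    case (2 i)
    then show ?thesis using X dim_hyp_neq_1 nz by auto
  next
    case (3 i j)
    have "X = hyp (\<alpha> i) \<inter> hyp (\<alpha> j)"
      by (rule vec.subspace_dim_equal[OF 3(5) _ 3(4)])
         (use X 3 dim_hyp_Int_hyp nz np in \<open>auto intro: vec.subspace_inter subspace_hyp\<close>)
    then show ?thesis using 3 by (auto simp: pts_def)
  qed
qed

private lemma mob_fuel_UNIV: "mob_fuel k L UNIV = 1"
  by (cases k) auto

private lemma mob_fuel_hyp: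
  assumes i: "i < n" shows "mob_fuel (Suc k) (intlat n \<alpha>) (hyp (\<alpha> i)) = - 1"
proof -
  have "{Y \<in> intlat n \<alpha>. hyp (\<alpha> i) \<subset> Y} = {UNIV}"
  proof (intro equalityI subsetI)
    fix Y assume Y: "Y \<in> {Y \<in> intlat n \<alpha>. hyp (\<alpha> i) \<subset> Y}"
    have no: "\<not> hyp (\<alpha> i) \<subset> hyp (\<alpha> j)" if "j < n" for j
      using hyp_subset_hyp_iff[OF nz[OF i] nz[OF that]] np[OF i that] by (cases "i = j") auto
    from Y have "Y \<in> intlat n \<alpha>" by blast
    then show "Y \<in> {UNIV}"
    proof (cases rule: intlat_cases)
      case (2 j)
      then show ?thesis using Y no by auto
    next
      case (3 j k)
      then have "hyp (\<alpha> i) \<subseteq> hyp (\<alpha> j)" "hyp (\<alpha> i) \<subseteq> hyp (\<alpha> k)" using Y by auto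
      then show ?thesis using 3 hyp_subset_hyp_iff nz np i by metis
    qed simp
  next
    fix Y assume "Y \<in> {UNIV :: (complex^3) set}"
    then show "Y \<in> {Y \<in> intlat n \<alpha>. hyp (\<alpha> i) \<subset> Y}" using intlat_mem(1) hyp_neq_UNIV nz i by auto
  qed
  then show ?thesis using hyp_neq_UNIV nz i by (simp add: mob_fuel_UNIV)
qed

private lemma inj_hyp: "inj_on (\<lambda>i. hyp (\<alpha> i)) {..<n}"
  by (rule inj_onI) (metis hyp_subset_hyp_iff lessThan_iff nz np order_refl)

text \<open>Strictly above X lie C^3, with value 1, and the planes through X, with value -1 each;
  the negative of the sum is the number of these planes minus 1.\<close>

private lemma mobius_pts:
  assumes X: "X \<in> pts"
  shows "mobius (intlat n \<alpha>) X = int (card {i\<in>{..<n}. X \<subseteq> hyp (\<alpha> i)}) - 1"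
proof -
  let ?M = "{i\<in>{..<n}. X \<subseteq> hyp (\<alpha> i)}"
  have up: "{Y \<in> intlat n \<alpha>. X \<subset> Y} = insert UNIV ((\<lambda>i. hyp (\<alpha> i)) ` ?M)"
  proof (intro equalityI subsetI)
    fix Y assume Y: "Y \<in> {Y \<in> intlat n \<alpha>. X \<subset> Y}"
    then have "Y \<in> intlat n \<alpha>" by blast
    then show "Y \<in> insert UNIV ((\<lambda>i. hyp (\<alpha> i)) ` ?M)"
    proof (cases rule: intlat_cases)
      case (2 i)
      then show ?thesis using Y by auto
    next
      case (3 i j)
      have "X \<subseteq> hyp (\<alpha> i) \<inter> hyp (\<alpha> j)" using 3 Y by blast
      then have "X = hyp (\<alpha> i) \<inter> hyp (\<alpha> j)" using pts_maximal[OF X] 3 by blast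
      then show ?thesis using 3 Y by blast
    qed simp
  next
    fix Y assume "Y \<in> insert UNIV ((\<lambda>i. hyp (\<alpha> i)) ` ?M)"
    then show "Y \<in> {Y \<in> intlat n \<alpha>. X \<subset> Y}" using intlat_mem pts_neq[OF X] by auto
  qed
  \<comment> \<open>The recursion descends from X to a plane and from there to C^3, so the fuel must
    be at least 2; it is, as the lattice contains C^3 and X.\<close>
  have "{UNIV, X} \<subseteq> intlat n \<alpha>" using intlat_mem X by auto
  then have "card {UNIV, X} \<le> card (intlat n \<alpha>)" using finite_intlat card_mono by blast
  then have "2 \<le> card (intlat n \<alpha>)" using pts_neq(1)[OF X] by simp
  then obtain k where k: "card (intlat n \<alpha>) = Suc (Suc k)" by (metis Suc_le_D numeral_2_eq_2 Suc_le_mono)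
  have "UNIV \<notin> (\<lambda>i. hyp (\<alpha> i)) ` ?M" using hyp_neq_UNIV nz by force
  moreover have "(\<Sum>Y\<in>(\<lambda>i. hyp (\<alpha> i)) ` ?M. mob_fuel (Suc k) (intlat n \<alpha>) Y) = (\<Sum>i\<in>?M. - 1)"
    using inj_on_subset[OF inj_hyp, of ?M] mob_fuel_hyp
    by (subst sum.reindex) (auto intro!: sum.cong simp del: mob_fuel.simps)
  ultimately have "(\<Sum>Y\<in>insert UNIV ((\<lambda>i. hyp (\<alpha> i)) ` ?M). mob_fuel (Suc k) (intlat n \<alpha>) Y) = 1 - int (card ?M)"
    by (simp add: mob_fuel_UNIV del: mob_fuel.simps)
  then show ?thesis unfolding mobius_def k mob_fuel.simps(2)[of "Suc k"] up using pts_neq(1)[OF X] by simp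
qed

text \<open>A double count of pairs of a rank two flat X and a plane H_i through it. When the planes
  are added in order, X is among the intersections of H_i with its predecessors for every H_i
  through X but the first. This accounts for the number of planes through X minus 1, which is the
  Moebius value of X.\<close>

lemma coeff_charpoly_1:
  "coeff (charpoly n \<alpha>) 1 = int (\<Sum>i<n. card ((\<lambda>j. hyp (\<alpha> i) \<inter> hyp (\<alpha> j)) ` {..<i}))"
proof -
  let ?M = "\<lambda>X. {i\<in>{..<n}. X \<subseteq> hyp (\<alpha> i)}"
  let ?P = "\<lambda>i. (\<lambda>j. hyp (\<alpha> i) \<inter> hyp (\<alpha> j)) ` {..<i}"
  have finp: "finite pts" unfolding pts_eq using finite_intlat by simp
  have "coeff (charpoly n \<alpha>) 1 = (\<Sum>X\<in>intlat n \<alpha>. if vec.dim X = 1 then mobius (intlat n \<alpha>) X else 0)"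
    by (simp add: charpoly_def coeff_sum)
  also have "\<dots> = (\<Sum>X\<in>pts. mobius (intlat n \<alpha>) X)"
    unfolding pts_eq using finite_intlat by (simp add: sum.inter_filter)
  also have "\<dots> = (\<Sum>X\<in>pts. int (card {i\<in>{..<n}. X \<in> ?P i}))"
  proof (rule sum.cong[OF refl])
    fix X assume X: "X \<in> pts"
    then obtain i j where "i < n" "j < n" "X = hyp (\<alpha> i) \<inter> hyp (\<alpha> j)" by (auto simp: pts_def)
    then have ne: "?M X \<noteq> {}" by auto
    have "{i\<in>{..<n}. X \<in> ?P i} = ?M X - {Min (?M X)}"
    proof (intro equalityI subsetI)
      fix i assume "i \<in> {i\<in>{..<n}. X \<in> ?P i}"
      then obtain j where j: "i < n" "j < i" "X = hyp (\<alpha> i) \<inter> hyp (\<alpha> j)" by blast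
      then have "j \<in> ?M X" by auto
      then have "Min (?M X) \<le> j" by (intro Min_le) auto
      then have "i \<noteq> Min (?M X)" using j(2) by linarith
      moreover have "i \<in> ?M X" using j by auto
      ultimately show "i \<in> ?M X - {Min (?M X)}" by blast
    next
      fix i assume i: "i \<in> ?M X - {Min (?M X)}"
      let ?j = "Min (?M X)"
      have j: "?j \<in> ?M X" using ne by (intro Min_in) auto
      have "?j \<le> i" using i by (intro Min_le) auto
      moreover have "?j \<noteq> i" using i by blast
      ultimately have "?j < i" by linarith
      moreover have "X = hyp (\<alpha> i) \<inter> hyp (\<alpha> ?j)" using pts_maximal[OF X, of i ?j] i j \<open>?j \<noteq> i\<close> by blast
      ultimately show "i \<in> {i\<in>{..<n}. X \<in> ?P i}" using i by blast
    qed
    moreover have "Min (?M X) \<in> ?M X" using ne by (intro Min_in) auto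
    moreover have "card (?M X) \<ge> 1" using ne by (simp add: Suc_le_eq card_gt_0_iff)
    ultimately show "mobius (intlat n \<alpha>) X = int (card {i\<in>{..<n}. X \<in> ?P i})"
      unfolding mobius_pts[OF X] by (simp add: of_nat_diff)
  qed
  also have "\<dots> = int (\<Sum>X\<in>pts. \<Sum>i<n. if X \<in> ?P i then 1 else 0)"
    by (simp add: sum.If_cases Int_def)
  also have "\<dots> = int (\<Sum>i<n. \<Sum>X\<in>pts. if X \<in> ?P i then 1 else 0)"
    by (subst sum.swap) simp
  also have "\<dots> = int (\<Sum>i<n. card (?P i))"
  proof -
    have "(\<Sum>X\<in>pts. if X \<in> ?P i then 1 else 0) = card (?P i)" if "i < n" for i
    proof -
      have "?P i \<subseteq> pts"
      proof
        fix X assume "X \<in> ?P i"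
        then obtain j where "j < i" "X = hyp (\<alpha> i) \<inter> hyp (\<alpha> j)" by blast
        then show "X \<in> pts" unfolding pts_def using that less_trans by blast
      qed
      then have "pts \<inter> ?P i = ?P i" by blast
      then show ?thesis using finp by (simp add: sum.If_cases Int_def[symmetric])
    qed
    then show ?thesis by simp
  qed
  finally show ?thesis .
qed

end

section \<open>Restriction to a generic plane\<close>

definition plane_proj :: "complex^3 \<Rightarrow> complex^3 \<Rightarrow> complex^3 \<Rightarrow> complex^3" where
  "plane_proj l w x = x - pairing l x *s w"

definition restr :: "complex^3 \<Rightarrow> complex^3 \<Rightarrow> (3 \<times> (complex^3) \<Rightarrow> complex) \<Rightarrow> 3 \<times> (complex^3) \<Rightarrow> complex" where
  "restr l w \<xi> = (\<lambda>(k, x). \<xi> (k, plane_proj l w x))"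

text \<open>Fields along the plane l = 0 with values in C^3, encoded, for
  \<open>pairing l w = 1\<close>, by their extensions that are constant in the direction w. They
  thus stay in the same function space as the fields on C^3, and restriction becomes the linear
  projection \<open>restr\<close>.\<close>

definition planefields :: "complex^3 \<Rightarrow> complex^3 \<Rightarrow> nat \<Rightarrow> (3 \<times> (complex^3) \<Rightarrow> complex) set" where
  "planefields l w d = {\<xi>. vfield d \<xi> \<and> restr l w \<xi> = \<xi>}"

text \<open>As y varies, \<alpha>_i \<times> y runs through H_i if \<alpha>_i \<noteq> 0, and its
  coordinates are linear in \<alpha>_i. Tangency to H_i thus becomes a system of equations with
  coefficients polynomial in \<alpha>, although H_i itself moves.\<close>

definition tangency :: "nat \<times> (complex^3) \<Rightarrow> (nat \<Rightarrow> complex^3) \<Rightarrow> (3 \<times> (complex^3) \<Rightarrow> complex) \<Rightarrow> complex" where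
  "tangency r \<alpha> \<xi> = pairing (\<alpha> (fst r)) (vval \<xi> (crossC (\<alpha> (fst r)) (snd r)))"

text \<open>If l is not proportional to \<alpha>_i, the vector \<alpha>_i \<times> l spans the line
  in which H_i meets the plane l = 0, so by homogeneity one equation expresses tangency along that
  line.\<close>

definition planeder :: "complex^3 \<Rightarrow> complex^3 \<Rightarrow> nat \<Rightarrow> (nat \<Rightarrow> complex^3) \<Rightarrow> nat \<Rightarrow> (3 \<times> (complex^3) \<Rightarrow> complex) set" where
  "planeder l w n \<alpha> d = {\<xi> \<in> planefields l w d. \<forall>i<n. tangency (i, l) \<alpha> \<xi> = 0}"

lemma vval_restr: "vval (restr l w \<xi>) x = vval \<xi> (plane_proj l w x)"
  by (simp add: restr_def vec_eq_iff)

lemma vfield_restr: "vfield d \<xi> \<Longrightarrow> vfield d (restr l w \<xi>)"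
  unfolding vfield_def restr_def plane_proj_def using form_projection by fastforce

lemma linear_restr: "Vector_Spaces.linear fscale fscale (restr l w)"
  by (rule flinearI) (auto simp: restr_def)

lemma plane_proj_fix: "pairing l x = 0 \<Longrightarrow> plane_proj l w x = x"
  by (simp add: plane_proj_def)

lemma pairing_plane_proj: "pairing l w = 1 \<Longrightarrow> pairing l (plane_proj l w x) = 0"
  by (simp add: plane_proj_def pairing_simps)

lemma restr_restr: "pairing l w = 1 \<Longrightarrow> restr l w (restr l w \<xi>) = restr l w \<xi>"
  by (auto simp: restr_def plane_proj_fix pairing_plane_proj)

lemma subspace_planefields: "fs.subspace (planefields l w d)"
proof -
  have "restr l w (\<lambda>z. 0) = (\<lambda>z. 0)" "restr l w (\<lambda>z. f z + g z) = (\<lambda>z. restr l w f z + restr l w g z)"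
    "restr l w (\<lambda>z. c * f z) = (\<lambda>z. c * restr l w f z)" for f g c
    by (auto simp: restr_def)
  then show ?thesis unfolding fsubspace_iff planefields_def by (auto simp: vfield_lincomb)
qed

lemma planeder_span: "planeder l w n \<alpha> d \<subseteq> fs.span (vmonomials d)"
  by (auto simp: span_vmonomials planeder_def planefields_def)

lemma restr_logder_subset:
  assumes "pairing l w = 1" shows "restr l w ` logder n \<alpha> d \<subseteq> planeder l w n \<alpha> d"
proof safe
  fix \<xi> assume \<xi>: "\<xi> \<in> logder n \<alpha> d"
  have "tangency (i, l) \<alpha> (restr l w \<xi>) = 0" if "i < n" for i
    using \<xi> that by (simp add: tangency_def vval_restr plane_proj_fix logder_def mem_hyp)
  then show "restr l w \<xi> \<in> planeder l w n \<alpha> d"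
    using \<xi> assms by (auto simp: planeder_def planefields_def vfield_restr restr_restr logder_def)
qed

lemma form_mult_eq_0:
  assumes "form d F" "b \<noteq> 0" "\<And>x. pairing b x * F x = 0" shows "F x = 0"
proof -
  obtain y where y: "pairing b y = 1" using exists_pairing_one assms(2) by blast
  obtain p where p: "\<And>t. poly p t = F (x + t *s y)" using form_on_line[OF assms(1)] by blast
  have "poly p t = 0" if "t \<notin> {- pairing b x}" for t
  proof -
    have "pairing b (x + t *s y) \<noteq> 0" using that y by (auto simp: pairing_simps add_eq_0_iff)
    then show ?thesis using assms(3)[of "x + t *s y"] p by simp
  qed
  then have "p = 0" by (intro poly_eq_0_cofinite[of "{- pairing b x}"]) auto
  with p[of 0] show ?thesis by simp
qed

lemma form_mult_prod_eq_0:
  assumes "finite I" "form d F" "\<And>i. i \<in> I \<Longrightarrow> b i \<noteq> 0" "\<And>x. (\<Prod>i\<in>I. pairing (b i) x) * F x = 0"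
  shows "F x = 0"
  using assms
proof (induction I arbitrary: x rule: finite_induct)
  case (insert m I)
  have "form (card I + d) (\<lambda>x. (\<Prod>i\<in>I. pairing (b i) x) * F x)"
    by (intro form_mult form_prod_pairing insert.hyps insert.prems(1))
  then have "(\<Prod>i\<in>I. pairing (b i) x) * F x = 0" for x
    by (rule form_mult_eq_0[where b = "b m"]) (use insert in \<open>auto simp: mult.assoc\<close>)
  then show ?case using insert by blast
qed simp

text \<open>A field that restricts to 0 is divisible by l, and since l is not proportional to
  \<alpha>_i, the factor l can be cancelled from the tangency condition on H_i.\<close>

lemma kernel_restr_logder:
  assumes lw: "pairing l w = 1" and A: "arrangement n \<alpha>" and l: "\<And>i. i < n \<Longrightarrow> \<not> proportional l (\<alpha> i)"
  shows "{\<xi> \<in> logder n \<alpha> (Suc d). restr l w \<xi> = 0} = (\<lambda>\<xi> (k, x). pairing l x * \<xi> (k, x)) ` logder n \<alpha> d"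
proof (intro equalityI subsetI)
  have l0: "l \<noteq> 0" using lw by (auto simp: pairing_simps)
  fix \<xi> assume "\<xi> \<in> {\<xi> \<in> logder n \<alpha> (Suc d). restr l w \<xi> = 0}"
  then have \<xi>: "vfield (Suc d) \<xi>" "\<And>i x. i < n \<Longrightarrow> x \<in> hyp (\<alpha> i) \<Longrightarrow> pairing (\<alpha> i) (vval \<xi> x) = 0"
    and r: "restr l w \<xi> = 0" by (auto simp: logder_def)
  have "\<xi> (k, x - pairing l x *s w) = 0" for k x
    using fun_cong[OF r, of "(k, x)"] by (simp add: restr_def plane_proj_def)
  then have "\<forall>k. \<exists>G. form d G \<and> (\<forall>x. \<xi> (k, x) = pairing l x * G x)"
    using form_diff_projection[of "Suc d" _ l w] \<xi>(1) unfolding vfield_def by fastforce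
  then obtain G where G: "\<And>k. form d (G k)" "\<And>k x. \<xi> (k, x) = pairing l x * G k x" by metis
  define \<phi> where "\<phi> = (\<lambda>(k, x). G k x)"
  have \<phi>: "vfield d \<phi>" by (simp add: vfield_def \<phi>_def G(1))
  have val: "vval \<xi> x = pairing l x *s vval \<phi> x" for x by (simp add: vec_eq_iff \<phi>_def G(2))
  have "pairing (\<alpha> i) (vval \<phi> x) = 0" if "i < n" "x \<in> hyp (\<alpha> i)" for i x
  proof (rule vanishing_cancel[where G = "\<lambda>x. pairing (\<alpha> i) (vval \<phi> x)" and a = l and b = "\<alpha> i"])
    show "\<exists>p. \<forall>t. poly p t = pairing (\<alpha> i) (vval \<phi> (u + t *s v))" for u v
      using form_on_line[OF form_pairing_vval[OF \<phi>]] by blast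
    show "pairing l x * pairing (\<alpha> i) (vval \<phi> x) = 0" if "x \<in> hyp (\<alpha> i)" for x
      using \<xi>(2)[OF \<open>i < n\<close> that] by (simp add: val pairing_simps)
  qed (use that l l0 arrangementD(1)[OF A] in auto)
  then have "\<phi> \<in> logder n \<alpha> d" using \<phi> by (simp add: logder_def)
  moreover have "\<xi> = (\<lambda>(k, x). pairing l x * \<phi> (k, x))" by (auto simp: \<phi>_def G(2))
  ultimately show "\<xi> \<in> (\<lambda>\<xi> (k, x). pairing l x * \<xi> (k, x)) ` logder n \<alpha> d" by blast
next
  fix \<xi> assume "\<xi> \<in> (\<lambda>\<xi> (k, x). pairing l x * \<xi> (k, x)) ` logder n \<alpha> d"
  then obtain \<phi> where \<phi>: "\<phi> \<in> logder n \<alpha> d" "\<xi> = (\<lambda>(k, x). pairing l x * \<phi> (k, x))" by blast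
  have "vval \<xi> x = pairing l x *s vval \<phi> x" for x by (simp add: vec_eq_iff \<phi>(2))
  moreover have "vfield (Suc d) \<xi>" using \<phi> by (auto simp: logder_def vfield_def intro: form_pairing_mult)
  moreover have "restr l w \<xi> = 0"
    by (rule ext) (auto simp: \<phi>(2) restr_def pairing_plane_proj[OF lw])
  ultimately show "\<xi> \<in> {\<xi> \<in> logder n \<alpha> (Suc d). restr l w \<xi> = 0}"
    using \<phi>(1) by (auto simp: logder_def pairing_simps)
qed

lemma dim_logder_Suc:
  assumes lw: "pairing l w = 1" and A: "arrangement n \<alpha>" and l: "\<And>i. i < n \<Longrightarrow> \<not> proportional l (\<alpha> i)"
  shows "fs.dim (logder n \<alpha> (Suc d)) = fs.dim (restr l w ` logder n \<alpha> (Suc d)) + fs.dim (logder n \<alpha> d)"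
proof -
  define \<mu> where "\<mu> = (\<lambda>\<xi> (k :: 3, x). pairing l x * \<xi> (k, x))"
  have l0: "l \<noteq> 0" using lw by (auto simp: pairing_simps)
  have lin: "Vector_Spaces.linear fscale fscale \<mu>"
    by (rule flinearI) (auto simp: \<mu>_def fun_eq_iff algebra_simps)
  have "{\<xi> \<in> logder n \<alpha> d. \<mu> \<xi> = 0} = {0}"
  proof (intro equalityI subsetI)
    fix \<xi> assume \<xi>: "\<xi> \<in> {\<xi> \<in> logder n \<alpha> d. \<mu> \<xi> = 0}"
    have "\<xi> (k, x) = 0" for k x
    proof (rule form_mult_eq_0[OF _ l0])
      show "form d (\<lambda>x. \<xi> (k, x))" using \<xi> by (auto simp: logder_def vfield_def)
      show "pairing l x * \<xi> (k, x) = 0" for x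
      proof -
        have "\<mu> \<xi> = 0" using \<xi> by blast
        from fun_cong[OF this, of "(k, x)"] show ?thesis by (simp add: \<mu>_def)
      qed
    qed
    then show "\<xi> \<in> {0}" by (auto simp: fun_eq_iff)
  next
    fix \<xi> assume "\<xi> \<in> {0 :: 3 \<times> (complex^3) \<Rightarrow> complex}"
    moreover have "\<mu> 0 = 0" by (auto simp: \<mu>_def fun_eq_iff)
    ultimately show "\<xi> \<in> {\<xi> \<in> logder n \<alpha> d. \<mu> \<xi> = 0}"
      using fs.subspace_0[OF subspace_logder] by blast
  qed
  then have "fs.dim (logder n \<alpha> d) = fs.dim (\<mu> ` logder n \<alpha> d)"
    using fsp.rank_nullity[OF subspace_logder logder_span finite_vmonomials lin] fs.dim_singleton_zero by simp
  moreover have "{\<xi> \<in> logder n \<alpha> (Suc d). restr l w \<xi> = 0} = \<mu> ` logder n \<alpha> d"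
    unfolding \<mu>_def by (rule kernel_restr_logder[OF lw A l])
  ultimately show ?thesis
    using fsp.rank_nullity[OF subspace_logder logder_span finite_vmonomials linear_restr,
        of n \<alpha> "Suc d" l w] by simp
qed

text \<open>The quotient by the product has truncated degree 0, so F is homogeneous both of degree j
  and of degree \<open>card I\<close>. Comparing the two expressions for F(2 x) gives F(x) = 0, as
  the two powers of 2 differ.\<close>

lemma form_vanishing_prod_low_degree:
  assumes "finite I" "form j F" "\<And>i. i \<in> I \<Longrightarrow> a i \<noteq> 0"
    "\<And>i i'. i \<in> I \<Longrightarrow> i' \<in> I \<Longrightarrow> i \<noteq> i' \<Longrightarrow> \<not> proportional (a i) (a i')"
    "\<And>i x. i \<in> I \<Longrightarrow> x \<in> hyp (a i) \<Longrightarrow> F x = 0" "j < card I"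
  shows "F x = 0"
proof -
  obtain G where G: "form (j - card I) G" "\<And>x. F x = (\<Prod>i\<in>I. pairing (a i) x) * G x"
    using form_vanishing_prod[of I j F a] assms by blast
  have "form 0 G" using G(1) assms(6) by simp
  moreover have "F = (\<lambda>x. (\<Prod>i\<in>I. pairing (a i) x) * G x)" using G(2) by blast
  ultimately have "form (card I) F"
    using form_mult[OF form_prod_pairing[OF assms(1)], of 0 G a] by simp
  then have "2 ^ card I * F x = 2 ^ j * F x"
    using form_homogeneous[of _ F 2 x] assms(2) by metis
  moreover have "(2::complex) ^ card I \<noteq> 2 ^ j"
  proof
    assume "(2::complex) ^ card I = 2 ^ j"
    from arg_cong[OF this, of norm] have "(2::real) ^ card I = 2 ^ j" by (simp add: norm_power)
    with assms(6) show False by simp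
  qed
  ultimately show ?thesis by simp
qed

lemma tdet_eq_pairing_crossC: "tdet a b c = pairing (crossC a b) c"
  by (simp add: tdet_def pairing_eq algebra_simps)

lemma plane_form_nonzero:
  assumes "a \<noteq> 0" "\<not> proportional l a" shows "a - c *s l \<noteq> 0"
proof
  assume "a - c *s l = 0"
  then have "a = c *s l" by simp
  moreover from this have "c \<noteq> 0" using assms(1) by auto
  ultimately show False using assms(2) unfolding proportional_def by blast
qed

text \<open>The forms \<beta>_i are the \<alpha>_i composed with the projection to l = 0. Genericity
  of l makes them pairwise nonproportional, so F on the plane can be divided by their product. The
  clause for m < n is stated separately because the truncated degree would otherwise allow a nonzero
  constant.\<close>

lemma plane_quotient:
  assumes lw: "pairing l w = 1" and A: "arrangement n \<alpha>"
    and gen: "\<And>i j. i < n \<Longrightarrow> j < n \<Longrightarrow> i \<noteq> j \<Longrightarrow> tdet (\<alpha> i) (\<alpha> j) l \<noteq> 0"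
    and l: "\<And>i. i < n \<Longrightarrow> \<not> proportional l (\<alpha> i)"
    and F: "form m F" and F0: "\<And>i x. i < n \<Longrightarrow> pairing (\<alpha> i) x = 0 \<Longrightarrow> pairing l x = 0 \<Longrightarrow> F x = 0"
  shows "\<exists>G. form (m - n) G \<and> (m < n \<longrightarrow> G = (\<lambda>x. 0)) \<and>
    (\<forall>x. F (plane_proj l w x) = (\<Prod>i<n. pairing (\<alpha> i) (plane_proj l w x)) * G (plane_proj l w x))"
proof -
  define \<beta> where "\<beta> i = \<alpha> i - pairing (\<alpha> i) w *s l" for i
  have \<beta>: "pairing (\<beta> i) x = pairing (\<alpha> i) (plane_proj l w x)" for i x
    by (simp add: \<beta>_def plane_proj_def pairing_simps)
  have l0: "l \<noteq> 0" using lw by (auto simp: pairing_simps)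
  have \<beta>0: "\<beta> i \<noteq> 0" if "i < n" for i
    unfolding \<beta>_def by (rule plane_form_nonzero[OF arrangementD(1)[OF A that] l[OF that]])
  have \<beta>p: "\<not> proportional (\<beta> i) (\<beta> j)" if ij: "i < n" "j < n" "i \<noteq> j" for i j
  proof
    assume "proportional (\<beta> i) (\<beta> j)"
    then obtain c where "\<beta> j = c *s \<beta> i" by (auto simp: proportional_def)
    then have "\<alpha> j = c *s \<alpha> i + (pairing (\<alpha> j) w - c * pairing (\<alpha> i) w) *s l"
      by (simp add: \<beta>_def vec_eq_iff algebra_simps)
    then obtain e where e: "\<alpha> j = c *s \<alpha> i + e *s l" by blast
    have "tdet (\<alpha> i) (\<alpha> j) l = 0" unfolding e tdet_linear tdet_degenerate by simp
    then show False using gen ij by blast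
  qed
  let ?F = "\<lambda>x. F (plane_proj l w x)"
  have F': "form m ?F" using form_projection[OF F] by (simp add: plane_proj_def)
  have van: "?F x = 0" if "i \<in> {..<n}" "x \<in> hyp (\<beta> i)" for i x
    using F0[of i "plane_proj l w x"] that by (simp add: mem_hyp \<beta> pairing_plane_proj[OF lw])
  show ?thesis
  proof (cases "m < n")
    case True
    have "?F x = 0" for x
      by (rule form_vanishing_prod_low_degree[of "{..<n}" m ?F \<beta>]) (use F' van \<beta>0 \<beta>p True in auto)
    then show ?thesis using form_zero by (intro exI[of _ "\<lambda>x. 0"]) auto
  next
    case False
    obtain G where G: "form (m - card {..<n}) G" "\<And>x. ?F x = (\<Prod>i<n. pairing (\<beta> i) x) * G x"
      using form_vanishing_prod[of "{..<n}" m ?F \<beta>] F' van \<beta>0 \<beta>p by auto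
    have "?F x = (\<Prod>i<n. pairing (\<alpha> i) (plane_proj l w x)) * G (plane_proj l w x)" for x
      using G(2)[of "plane_proj l w x"] by (simp add: \<beta> plane_proj_fix pairing_plane_proj[OF lw])
    with G False show ?thesis by (intro exI[of _ G]) auto
  qed
qed

text \<open>Cramer's rule is applied on the plane l = 0. The determinants with q in one slot vanish
  on each line in which H_i meets the plane, so there they are Q times forms. Read on all of C^3 and
  divided by c, where c Q is the determinant of the basis, these forms are coefficients that combine
  \<xi>1, \<xi>2, \<xi>3 to a field of degree m in the module restricting to q.\<close>

lemma restr_logder_surj:
  assumes lw: "pairing l w = 1" and A: "arrangement n \<alpha>"
    and gen: "\<And>i j. i < n \<Longrightarrow> j < n \<Longrightarrow> i \<noteq> j \<Longrightarrow> tdet (\<alpha> i) (\<alpha> j) l \<noteq> 0"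
    and l: "\<And>i. i < n \<Longrightarrow> \<not> proportional l (\<alpha> i)"
    and \<xi>: "\<xi>1 \<in> logder n \<alpha> d1" "\<xi>2 \<in> logder n \<alpha> d2" "\<xi>3 \<in> logder n \<alpha> d3" and d: "d1 + d2 + d3 = n"
    and nz: "tdet (vval \<xi>1 x0) (vval \<xi>2 x0) (vval \<xi>3 x0) \<noteq> 0"
  shows "planeder l w n \<alpha> m \<subseteq> restr l w ` logder n \<alpha> m"
proof
  fix q assume "q \<in> planeder l w n \<alpha> m"
  then have q: "vfield m q" "restr l w q = q" "\<And>i. i < n \<Longrightarrow> tangency (i, l) \<alpha> q = 0"
    by (auto simp: planeder_def planefields_def)
  obtain c where c: "\<And>x. tdet (vval \<xi>1 x) (vval \<xi>2 x) (vval \<xi>3 x) = c * (\<Prod>i<n. pairing (\<alpha> i) x)"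
    using saito_det[OF A \<xi> d] by blast
  have c0: "c \<noteq> 0" using nz c by auto
  have l0: "l \<noteq> 0" using lw by (auto simp: pairing_simps)
  have tq: "pairing (\<alpha> i) (vval q x) = 0" if "i < n" "pairing (\<alpha> i) x = 0" "pairing l x = 0" for i x
  proof -
    have "crossC (\<alpha> i) l \<noteq> 0"
      using crossC_eq_0_imp_proportional[OF arrangementD(1)[OF A that(1)] l0] l[OF that(1)] proportional_sym
      by blast
    then have "\<exists>s. x = s *s crossC (\<alpha> i) l" using annihilator_crossC that by blast
    then obtain s where "x = s *s crossC (\<alpha> i) l" by blast
    then have "pairing (\<alpha> i) (vval q x) = s ^ m * tangency (i, l) \<alpha> q"
      using form_homogeneous[OF form_pairing_vval[OF q(1)], of "\<alpha> i" s "crossC (\<alpha> i) l"]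
      by (simp add: tangency_def)
    then show ?thesis using q(3)[OF that(1)] by simp
  qed
  let ?\<pi> = "plane_proj l w" and ?Q = "\<lambda>x. \<Prod>i<n. pairing (\<alpha> i) x"
  \<comment> \<open>A weak tangency, tested at points of H_i in the plane l = 0; it is what q shares
    with the three basis fields.\<close>
  define T where "T e \<phi> \<longleftrightarrow> vfield e \<phi> \<and> (\<forall>i<n. \<forall>x. pairing (\<alpha> i) x = 0 \<longrightarrow> pairing l x = 0 \<longrightarrow>
    pairing (\<alpha> i) (vval \<phi> x) = 0)" for e \<phi>
  have T: "T d1 \<xi>1" "T d2 \<xi>2" "T d3 \<xi>3" "T m q"
    using \<xi> q(1) tq by (auto simp: T_def logder_def mem_hyp)
  have quot: "\<exists>G. form (e1 + e2 + e3 - n) G \<and> (e1 + e2 + e3 < n \<longrightarrow> G = (\<lambda>x. 0)) \<and>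
      (\<forall>x. tdet (vval \<phi>1 (?\<pi> x)) (vval \<phi>2 (?\<pi> x)) (vval \<phi>3 (?\<pi> x)) = ?Q (?\<pi> x) * G (?\<pi> x))"
    if "T e1 \<phi>1" "T e2 \<phi>2" "T e3 \<phi>3" for e1 e2 e3 \<phi>1 \<phi>2 \<phi>3
    by (rule plane_quotient[OF lw A gen l form_tdet])
       (use that in \<open>auto simp: T_def intro!: tdet_plane[OF arrangementD(1)[OF A]]\<close>)
  obtain G1 where G1: "form (m - d1) G1" "m < d1 \<Longrightarrow> G1 = (\<lambda>x. 0)"
    "\<And>x. tdet (vval q (?\<pi> x)) (vval \<xi>2 (?\<pi> x)) (vval \<xi>3 (?\<pi> x)) = ?Q (?\<pi> x) * G1 (?\<pi> x)"
    using quot[OF T(4,2,3)] d by auto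
  obtain G2 where G2: "form (m - d2) G2" "m < d2 \<Longrightarrow> G2 = (\<lambda>x. 0)"
    "\<And>x. tdet (vval \<xi>1 (?\<pi> x)) (vval q (?\<pi> x)) (vval \<xi>3 (?\<pi> x)) = ?Q (?\<pi> x) * G2 (?\<pi> x)"
    using quot[OF T(1,4,3)] d by auto
  obtain G3 where G3: "form (m - d3) G3" "m < d3 \<Longrightarrow> G3 = (\<lambda>x. 0)"
    "\<And>x. tdet (vval \<xi>1 (?\<pi> x)) (vval \<xi>2 (?\<pi> x)) (vval q (?\<pi> x)) = ?Q (?\<pi> x) * G3 (?\<pi> x)"
    using quot[OF T(1,2,4)] d by auto
  have summand: "(\<lambda>(k, x). G x * \<xi> (k, x)) \<in> logder n \<alpha> m"
    if "\<xi> \<in> logder n \<alpha> e" "form (m - e) G" "m < e \<Longrightarrow> G = (\<lambda>x. 0)" for \<xi> e G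
  proof -
    have "form m (\<lambda>x. G x * \<xi> (k, x))" for k
    proof (cases "m < e")
      case True
      then show ?thesis using that(3) form_zero by simp
    next
      case False
      then show ?thesis using form_mult[OF that(2), of e "\<lambda>x. \<xi> (k, x)"] that(1) by (simp add: logder_def vfield_def)
    qed
    moreover have "vval (\<lambda>(k, x). G x * \<xi> (k, x)) x = G x *s vval \<xi> x" for x by (simp add: vec_eq_iff)
    ultimately show ?thesis using that(1) by (simp add: logder_def vfield_def pairing_simps)
  qed
  define \<Xi> where "\<Xi> = (\<lambda>z. (1 / c) * ((\<lambda>(k, x). G1 x * \<xi>1 (k, x)) z + (\<lambda>(k, x). G2 x * \<xi>2 (k, x)) z
      + (\<lambda>(k, x). G3 x * \<xi>3 (k, x)) z))"
  have lin: "\<And>f g. f \<in> logder n \<alpha> m \<Longrightarrow> g \<in> logder n \<alpha> m \<Longrightarrow> (\<lambda>z. f z + g z) \<in> logder n \<alpha> m"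
    "\<And>a f. f \<in> logder n \<alpha> m \<Longrightarrow> (\<lambda>z. a * f z) \<in> logder n \<alpha> m"
    using subspace_logder[of n \<alpha> m] unfolding fsubspace_iff by blast+
  have "\<Xi> \<in> logder n \<alpha> m"
    unfolding \<Xi>_def by (intro lin summand[OF \<xi>(1)] summand[OF \<xi>(2)] summand[OF \<xi>(3)] G1(1,2) G2(1,2) G3(1,2))
  moreover have "restr l w \<Xi> = q"
  proof
    fix z :: "3 \<times> (complex^3)"
    obtain k x where z: "z = (k, x)" by (cases z)
    define \<beta> where "\<beta> i = \<alpha> i - pairing (\<alpha> i) w *s l" for i
    have \<beta>: "pairing (\<beta> i) x = pairing (\<alpha> i) (?\<pi> x)" for i x
      by (simp add: \<beta>_def plane_proj_def pairing_simps)
    \<comment> \<open>Cramer's identity gives this only after multiplication by Q on the plane, that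
      is by the product of the \<beta>_i, which is then cancelled.\<close>
    have "restr l w \<Xi> (k, x) - q (k, x) = 0"
    proof (rule form_mult_prod_eq_0[where I = "{..<n}" and b = \<beta> and F = "\<lambda>x. restr l w \<Xi> (k, x) - q (k, x)"])
      have "vfield m (restr l w \<Xi>)" using \<open>\<Xi> \<in> logder n \<alpha> m\<close> by (auto simp: logder_def intro: vfield_restr)
      then show "form m (\<lambda>x. restr l w \<Xi> (k, x) - q (k, x))"
        using q(1) by (auto simp: vfield_def intro: form_diff)
      show "\<beta> i \<noteq> 0" if "i \<in> {..<n}" for i
        unfolding \<beta>_def using that by (intro plane_form_nonzero arrangementD(1)[OF A] l) auto
      show "(\<Prod>i<n. pairing (\<beta> i) x) * (restr l w \<Xi> (k, x) - q (k, x)) = 0" for x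
      proof -
        have "c * ?Q (?\<pi> x) * q (k, ?\<pi> x)
            = ?Q (?\<pi> x) * (G1 (?\<pi> x) * \<xi>1 (k, ?\<pi> x) + G2 (?\<pi> x) * \<xi>2 (k, ?\<pi> x) + G3 (?\<pi> x) * \<xi>3 (k, ?\<pi> x))"
          using arg_cong[OF tdet_cramer[of "vval \<xi>1 (?\<pi> x)" "vval \<xi>2 (?\<pi> x)" "vval \<xi>3 (?\<pi> x)" "vval q (?\<pi> x)"],
              of "\<lambda>v. v $ k"]
          by (simp add: G1(3) G2(3) G3(3) c algebra_simps)
        also have "\<dots> = c * ?Q (?\<pi> x) * restr l w \<Xi> (k, x)"
          using c0 by (simp add: restr_def \<Xi>_def)
        also have "q (k, ?\<pi> x) = q (k, x)" using fun_cong[OF q(2), of "(k, x)"] by (simp add: restr_def)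
        finally show ?thesis using c0 by (auto simp: \<beta>)
      qed
    qed simp
    then show "restr l w \<Xi> z = q z" by (simp add: z)
  qed
  ultimately show "q \<in> restr l w ` logder n \<alpha> m" by blast
qed

section \<open>Deformation of a basis\<close>

lemma subspace_basis:
  assumes "fs.subspace U" "U \<subseteq> fs.span M" "finite M"
  obtains T where "finite T" "fs.independent T" "fs.span T = U"
proof -
  obtain T where T: "T \<subseteq> U" "fs.independent T" "U \<subseteq> fs.span T" using fs.maximal_independent_subset by blast
  have "finite T" using fs.independent_span_bound[OF assms(3) T(2)] T(1) assms(2) by blast
  moreover have "fs.span T = U" using T fs.span_minimal[OF T(1) assms(1)] by blast
  ultimately show ?thesis using that T(2) by blast
qed

lemma polyfun_tangency:
  assumes "vfield d m" "i < n" shows "polyfun n (\<lambda>\<alpha>. tangency (i, y) \<alpha> m)"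
  unfolding tangency_def pairing_def vval_nth fst_conv snd_conv
  using assms by (intro polyfun_sum polyfun_mult polyfun_coord polyfun_form_crossC[of d]) (auto simp: vfield_def)

lemma tangency_deformation:
  assumes U: "fs.subspace U" "\<And>\<xi>. \<xi> \<in> U \<Longrightarrow> vfield d \<xi>" and R: "R \<subseteq> {..<n} \<times> UNIV"
    and V: "\<And>\<alpha>. V \<alpha> = {\<xi> \<in> U. \<forall>r\<in>R. tangency r \<alpha> \<xi> = 0}"
  obtains q where "polyfun n q" "q \<alpha>0 \<noteq> 0" "\<And>\<alpha>. q \<alpha> \<noteq> 0 \<Longrightarrow> fs.dim (V \<alpha>) \<le> fs.dim (V \<alpha>0)"
    "\<And>\<xi>. \<xi> \<in> V \<alpha>0 \<Longrightarrow> \<exists>\<Xi>. (\<forall>x. polyfun n (\<lambda>\<alpha>. \<Xi> \<alpha> x)) \<and> \<Xi> \<alpha>0 = (\<lambda>x. q \<alpha>0 * \<xi> x) \<and>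
       (\<forall>\<alpha>. q \<alpha> \<noteq> 0 \<longrightarrow> fs.dim (V \<alpha>0) \<le> fs.dim (V \<alpha>) \<longrightarrow> \<Xi> \<alpha> \<in> V \<alpha>)"
proof -
  have "U \<subseteq> fs.span (vmonomials d)" using U(2) by (auto simp: span_vmonomials)
  then obtain T where T: "finite T" "fs.independent T" "fs.span T = U"
    using subspace_basis[OF U(1) _ finite_vmonomials] by blast
  have V': "solspace T R tangency \<alpha> = V \<alpha>" for \<alpha> by (simp add: solspace_def T(3) V)
  have lin: "tangency r \<alpha> (\<lambda>x. f x + g x) = tangency r \<alpha> f + tangency r \<alpha> g"
    "tangency r \<alpha> (\<lambda>x. c * f x) = c * tangency r \<alpha> f" for r \<alpha> f g c
    by (simp_all add: tangency_def vval_lincomb pairing_simps)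
  have "\<forall>r\<in>R. \<forall>m\<in>T. polyfun n (\<lambda>\<alpha>. tangency r \<alpha> m)"
  proof (intro ballI)
    fix r m assume rm: "r \<in> R" "m \<in> T"
    have "vfield d m" using U(2) T(3) fs.span_base[OF rm(2)] by blast
    moreover obtain i y where "r = (i, y)" "i < n" using rm(1) R by auto
    ultimately show "polyfun n (\<lambda>\<alpha>. tangency r \<alpha> m)" using polyfun_tangency by simp
  qed
  from solspace_deformation[of T tangency R n \<alpha>0, OF T(1,2) lin this, unfolded V'] that
  show ?thesis by blast
qed

lemma planeder_deformation:
  obtains q where "polyfun n q" "q \<alpha>0 \<noteq> 0"
    "\<And>\<alpha>. q \<alpha> \<noteq> 0 \<Longrightarrow> fs.dim (planeder l w n \<alpha> d) \<le> fs.dim (planeder l w n \<alpha>0 d)"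
proof (rule tangency_deformation[of "planefields l w d" d "{..<n} \<times> {l}" n "\<lambda>\<alpha>. planeder l w n \<alpha> d" \<alpha>0])
  show "planeder l w n \<alpha> d = {\<xi> \<in> planefields l w d. \<forall>r\<in>{..<n} \<times> {l}. tangency r \<alpha> \<xi> = 0}" for \<alpha>
    by (auto simp: planeder_def)
qed (use subspace_planefields that in \<open>auto simp: planefields_def\<close>)

text \<open>Tangency is imposed at \<alpha>_i \<times> y for all y. This infinite system is
  admissible, as the elimination runs over the finitely many unknowns; for an arrangement, where
  every \<alpha>_i is nonzero, its solutions are the logarithmic derivations.\<close>

lemma logder_deformation:
  assumes A0: "arrangement n \<alpha>0" and \<xi>: "\<xi> \<in> logder n \<alpha>0 d"
  obtains q \<Xi> where "polyfun n q" "q \<alpha>0 \<noteq> 0" "\<And>x. polyfun n (\<lambda>\<alpha>. \<Xi> \<alpha> x)" "\<Xi> \<alpha>0 = (\<lambda>x. q \<alpha>0 * \<xi> x)"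
    "\<And>\<alpha>. arrangement n \<alpha> \<Longrightarrow> q \<alpha> \<noteq> 0 \<Longrightarrow> fs.dim (logder n \<alpha>0 d) \<le> fs.dim (logder n \<alpha> d) \<Longrightarrow> \<Xi> \<alpha> \<in> logder n \<alpha> d"
proof -
  let ?V = "\<lambda>\<alpha>. {\<xi> \<in> {\<xi>. vfield d \<xi>}. \<forall>r\<in>{..<n} \<times> UNIV. tangency r \<alpha> \<xi> = 0}"
  have V: "?V \<alpha> = logder n \<alpha> d" if A: "arrangement n \<alpha>" for \<alpha>
  proof -
    have "(\<forall>y. pairing (\<alpha> i) (vval \<xi> (crossC (\<alpha> i) y)) = 0) \<longleftrightarrow> (\<forall>x\<in>hyp (\<alpha> i). pairing (\<alpha> i) (vval \<xi> x) = 0)"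
      if "i < n" for i \<xi>
      using hyp_crossC[OF arrangementD(1)[OF A that]] by (auto simp: mem_hyp) (metis pairing_crossC(1))
    then show ?thesis by (auto simp: logder_def tangency_def)
  qed
  have U: "fs.subspace {\<xi>. vfield d \<xi>}" unfolding fsubspace_iff by (simp add: vfield_lincomb)
  obtain q where q: "polyfun n q" "q \<alpha>0 \<noteq> 0"
    "\<And>\<xi>. \<xi> \<in> ?V \<alpha>0 \<Longrightarrow> \<exists>\<Xi>. (\<forall>x. polyfun n (\<lambda>\<alpha>. \<Xi> \<alpha> x)) \<and> \<Xi> \<alpha>0 = (\<lambda>x. q \<alpha>0 * \<xi> x) \<and>
       (\<forall>\<alpha>. q \<alpha> \<noteq> 0 \<longrightarrow> fs.dim (?V \<alpha>0) \<le> fs.dim (?V \<alpha>) \<longrightarrow> \<Xi> \<alpha> \<in> ?V \<alpha>)"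
    by (rule tangency_deformation[OF U, of d "{..<n} \<times> UNIV" n ?V \<alpha>0]) auto
  obtain \<Xi> where \<Xi>: "\<And>x. polyfun n (\<lambda>\<alpha>. \<Xi> \<alpha> x)" "\<Xi> \<alpha>0 = (\<lambda>x. q \<alpha>0 * \<xi> x)"
     "\<And>\<alpha>. q \<alpha> \<noteq> 0 \<Longrightarrow> fs.dim (?V \<alpha>0) \<le> fs.dim (?V \<alpha>) \<Longrightarrow> \<Xi> \<alpha> \<in> ?V \<alpha>"
    using q(3)[of \<xi>] \<xi> V[OF A0] by blast
  show ?thesis
  proof (rule that[OF q(1,2) \<Xi>(1,2)])
    fix \<alpha> assume A: "arrangement n \<alpha>" and q\<alpha>: "q \<alpha> \<noteq> 0"
      and dim: "fs.dim (logder n \<alpha>0 d) \<le> fs.dim (logder n \<alpha> d)"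
    show "\<Xi> \<alpha> \<in> logder n \<alpha> d" by (rule \<Xi>(3)[of \<alpha>, unfolded V[OF A0] V[OF A], OF q\<alpha> dim])
  qed
qed

text \<open>Here \<beta> is the free reference arrangement and \<alpha> a nearby one. Passing from
  degree m + 1 to m subtracts the dimension of the restriction image, which for \<alpha> is at most
  that of \<open>planeder\<close> and for \<beta> equal to it.\<close>

lemma dim_logder_semicontinuous:
  assumes lw: "pairing l w = 1" and A: "arrangement n \<alpha>" "arrangement n \<beta>"
    and l: "\<And>i. i < n \<Longrightarrow> \<not> proportional l (\<alpha> i)" "\<And>i. i < n \<Longrightarrow> \<not> proportional l (\<beta> i)"
    and surj: "\<And>m. planeder l w n \<beta> m \<subseteq> restr l w ` logder n \<beta> m"
    and semi: "\<And>m. m \<le> J \<Longrightarrow> fs.dim (planeder l w n \<alpha> m) \<le> fs.dim (planeder l w n \<beta> m)"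
    and top: "fs.dim (logder n \<alpha> J) = fs.dim (logder n \<beta> J)" and j: "j \<le> J"
  shows "fs.dim (logder n \<beta> j) \<le> fs.dim (logder n \<alpha> j)"
  using j
proof (induction rule: inc_induct)
  case (step m)
  have "fs.dim (restr l w ` logder n \<alpha> (Suc m)) \<le> fs.dim (planeder l w n \<alpha> (Suc m))"
    by (rule fs.dim_mono_finite[OF restr_logder_subset[OF lw] planeder_span finite_vmonomials])
  also have "\<dots> \<le> fs.dim (planeder l w n \<beta> (Suc m))" using semi step.hyps by simp
  also have "planeder l w n \<beta> (Suc m) = restr l w ` logder n \<beta> (Suc m)"
    using surj restr_logder_subset[OF lw] by blast
  finally show ?case
    using step.IH dim_logder_Suc[OF lw A(1) l(1), of m] dim_logder_Suc[OF lw A(2) l(2), of m] by simp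
qed (use top in simp)

lemma polyfun_tdet:
  assumes "\<And>k. polyfun n (\<lambda>\<alpha>. a \<alpha> $ k)" "\<And>k. polyfun n (\<lambda>\<alpha>. b \<alpha> $ k)" "\<And>k. polyfun n (\<lambda>\<alpha>. c \<alpha> $ k)"
  shows "polyfun n (\<lambda>\<alpha>. tdet (a \<alpha>) (b \<alpha>) (c \<alpha>))"
  unfolding tdet_def by (intro polyfun_add polyfun_mult polyfun_diff assms)

lemma in_C_iff: "in_C n f \<alpha> \<longleftrightarrow> arrangement n \<alpha> \<and> charpoly n \<alpha> = f"
  by (auto simp: in_C_def arrangement_def)

text \<open>The auxiliary vectors b_i turn nonproportionality of l and \<alpha>_i into the
  nonvanishing of \<open>tdet (\<alpha> i) (b i) l\<close>, a polynomial condition with b_i fixed as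
  \<alpha> moves. The vector \<open>axis 1 1\<close> is put into \<open>M\<close> to force l
  \<noteq> 0 for every n.\<close>

lemma exists_generic_plane:
  assumes A: "arrangement n \<alpha>"
  obtains l w b where "pairing l w = 1" "\<And>i. i < n \<Longrightarrow> tdet (\<alpha> i) (b i) l \<noteq> 0"
    "\<And>i j. i < n \<Longrightarrow> j < n \<Longrightarrow> i \<noteq> j \<Longrightarrow> tdet (\<alpha> i) (\<alpha> j) l \<noteq> 0"
proof -
  have "\<forall>i. \<exists>b. i < n \<longrightarrow> b \<noteq> 0 \<and> \<not> proportional (\<alpha> i) b"
    using exists_nonproportional arrangementD(1)[OF A] by blast
  then obtain b where b: "\<And>i. i < n \<Longrightarrow> b i \<noteq> 0 \<and> \<not> proportional (\<alpha> i) (b i)" by metis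
  define M where "M = (\<lambda>i. crossC (\<alpha> i) (b i)) ` {..<n} \<union>
    (\<lambda>(i, j). crossC (\<alpha> i) (\<alpha> j)) ` {(i, j). i < n \<and> j < n \<and> i \<noteq> j} \<union> {axis 1 1}"
  have fin: "finite M"
  proof -
    have "{(i, j). i < n \<and> j < n \<and> i \<noteq> j} \<subseteq> {..<n} \<times> {..<n}" by auto
    then have "finite {(i, j). i < n \<and> j < n \<and> i \<noteq> j}" using finite_subset by blast
    then show ?thesis by (simp add: M_def)
  qed
  have "crossC (\<alpha> i) (b i) \<noteq> 0" if "i < n" for i
    using that b arrangementD(1)[OF A] crossC_eq_0_imp_proportional by blast
  moreover have "crossC (\<alpha> i) (\<alpha> j) \<noteq> 0" if "i < n" "j < n" "i \<noteq> j" for i j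
    using that arrangementD[OF A] crossC_eq_0_imp_proportional by blast
  ultimately have "h \<noteq> 0" if "h \<in> M" for h
    using that by (auto simp: M_def axis_eq_0_iff)
  then have "\<exists>x\<in>UNIV. pairing h x \<noteq> 0" if "h \<in> M" for h
    using exists_pairing_one[of h] that by (metis UNIV_I zero_neq_one)
  then obtain l where l: "\<And>h. h \<in> M \<Longrightarrow> pairing h l \<noteq> 0"
    using exists_avoiding[OF fin, of UNIV "\<lambda>h. h"] by auto
  have "l \<noteq> 0" using l[of "axis 1 1"] by (auto simp: M_def pairing_simps)
  then obtain w where "pairing l w = 1" using exists_pairing_one by blast
  then show ?thesis using l by (intro that[of l w b]) (auto simp: M_def tdet_eq_pairing_crossC)
qed

lemma not_proportional_if_tdet:
  assumes "tdet a b l \<noteq> 0" shows "\<not> proportional l a"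
proof
  assume "proportional l a"
  then obtain c where "a = c *s l" by (auto simp: proportional_def)
  with assms show False by (simp add: tdet_linear tdet_degenerate)
qed

theorem free_locus_locally_open:
  assumes n: "n \<ge> 1" and C0: "in_C n f \<alpha>0" and free: "is_free n \<alpha>0"
  obtains p where "polyfun n p" "p \<alpha>0 \<noteq> 0" "\<And>\<alpha>. in_C n f \<alpha> \<Longrightarrow> p \<alpha> \<noteq> 0 \<Longrightarrow> is_free n \<alpha>"
proof -
  have A0: "arrangement n \<alpha>0" using C0 by (simp add: in_C_iff)
  obtain d1 d2 d3 \<xi>1 \<xi>2 \<xi>3 x0 where \<xi>: "\<xi>1 \<in> logder n \<alpha>0 d1" "\<xi>2 \<in> logder n \<alpha>0 d2" "\<xi>3 \<in> logder n \<alpha>0 d3"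
    and d: "d1 + d2 + d3 = n" and nz: "tdet (vval \<xi>1 x0) (vval \<xi>2 x0) (vval \<xi>3 x0) \<noteq> 0"
    by (rule saito_converse[OF A0 n free])
  obtain l w b where lw: "pairing l w = 1" and lb: "\<And>i. i < n \<Longrightarrow> tdet (\<alpha>0 i) (b i) l \<noteq> 0"
    and gen: "\<And>i j. i < n \<Longrightarrow> j < n \<Longrightarrow> i \<noteq> j \<Longrightarrow> tdet (\<alpha>0 i) (\<alpha>0 j) l \<noteq> 0"
    using exists_generic_plane[OF A0] by metis
  have l0: "\<And>i. i < n \<Longrightarrow> \<not> proportional l (\<alpha>0 i)" using lb not_proportional_if_tdet by blast
  have surj: "planeder l w n \<alpha>0 m \<subseteq> restr l w ` logder n \<alpha>0 m" for m
    by (rule restr_logder_surj[OF lw A0 gen l0 \<xi> d nz])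
  have "\<forall>m. \<exists>q. polyfun n q \<and> q \<alpha>0 \<noteq> 0 \<and>
      (\<forall>\<alpha>. q \<alpha> \<noteq> 0 \<longrightarrow> fs.dim (planeder l w n \<alpha> m) \<le> fs.dim (planeder l w n \<alpha>0 m))"
    using planeder_deformation by metis
  then obtain q where q: "\<And>m. polyfun n (q m)" "\<And>m. q m \<alpha>0 \<noteq> 0"
    "\<And>m \<alpha>. q m \<alpha> \<noteq> 0 \<Longrightarrow> fs.dim (planeder l w n \<alpha> m) \<le> fs.dim (planeder l w n \<alpha>0 m)" by metis
  define F where "F d \<xi> r \<Xi> \<longleftrightarrow> polyfun n r \<and> r \<alpha>0 \<noteq> 0 \<and> (\<forall>x. polyfun n (\<lambda>\<alpha>. \<Xi> \<alpha> x)) \<and>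
    \<Xi> \<alpha>0 = (\<lambda>x. r \<alpha>0 * \<xi> x) \<and> (\<forall>\<alpha>. arrangement n \<alpha> \<longrightarrow> r \<alpha> \<noteq> 0 \<longrightarrow>
      fs.dim (logder n \<alpha>0 d) \<le> fs.dim (logder n \<alpha> d) \<longrightarrow> \<Xi> \<alpha> \<in> logder n \<alpha> d)" for d \<xi> r \<Xi>
  have ex: "\<exists>r \<Xi>. F d \<xi> r \<Xi>" if "\<xi> \<in> logder n \<alpha>0 d" for d \<xi>
    by (rule logder_deformation[OF A0 that]) (unfold F_def, blast)
  obtain q1 q2 q3 \<Xi>1 \<Xi>2 \<Xi>3 where F: "F d1 \<xi>1 q1 \<Xi>1" "F d2 \<xi>2 q2 \<Xi>2" "F d3 \<xi>3 q3 \<Xi>3"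
    using ex[OF \<xi>(1)] ex[OF \<xi>(2)] ex[OF \<xi>(3)] by blast
  note t1 = F(1)[unfolded F_def] and t2 = F(2)[unfolded F_def] and t3 = F(3)[unfolded F_def]
  define D where "D \<alpha> = tdet (vval (\<Xi>1 \<alpha>) x0) (vval (\<Xi>2 \<alpha>) x0) (vval (\<Xi>3 \<alpha>) x0)" for \<alpha>
  \<comment> \<open>One factor for each property to be preserved: l stays nonproportional to the
    forms, the spaces \<open>planeder\<close> in degrees up to n do not grow, the three basis fields
    extend, and their determinant at \<open>x0\<close> is nonzero.\<close>
  define p where "p \<alpha> = (\<Prod>i<n. tdet (\<alpha> i) (b i) l) * ((\<Prod>m\<le>n. q m \<alpha>) * (q1 \<alpha> * (q2 \<alpha> * (q3 \<alpha> * D \<alpha>))))" for \<alpha>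
  have "polyfun n D"
    unfolding D_def by (rule polyfun_tdet) (simp_all add: t1 t2 t3)
  moreover have "polyfun n (\<lambda>\<alpha>. tdet (\<alpha> i) (b i) l)" if "i < n" for i
    using that by (intro polyfun_tdet) (auto intro: polyfun_coord polyfun_const)
  ultimately have "polyfun n p"
    unfolding p_def using t1 t2 t3 by (intro polyfun_mult polyfun_prod q(1)) auto
  moreover have "D \<alpha>0 = q1 \<alpha>0 * (q2 \<alpha>0 * (q3 \<alpha>0 * tdet (vval \<xi>1 x0) (vval \<xi>2 x0) (vval \<xi>3 x0)))"
    by (simp add: D_def t1 t2 t3 vval_lincomb tdet_linear)
  then have "p \<alpha>0 \<noteq> 0" using nz t1 t2 t3 q(2) lb by (simp add: p_def)
  moreover have "is_free n \<alpha>" if C: "in_C n f \<alpha>" and p: "p \<alpha> \<noteq> 0" for \<alpha>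
  proof -
    have A: "arrangement n \<alpha>" using C by (simp add: in_C_iff)
    have l: "\<not> proportional l (\<alpha> i)" if "i < n" for i
      using p that not_proportional_if_tdet[of "\<alpha> i" "b i" l] by (auto simp: p_def)
    have semi: "fs.dim (planeder l w n \<alpha> m) \<le> fs.dim (planeder l w n \<alpha>0 m)" if "m \<le> n" for m
      using p that by (intro q(3)) (auto simp: p_def)
    have "int (\<Sum>i<n. card ((\<lambda>j. hyp (\<alpha> i) \<inter> hyp (\<alpha> j)) ` {..<i}))
        = int (\<Sum>i<n. card ((\<lambda>j. hyp (\<alpha>0 i) \<inter> hyp (\<alpha>0 j)) ` {..<i}))"
      using C C0 coeff_charpoly_1[OF A] coeff_charpoly_1[OF A0] by (simp only: in_C_iff)
    then have "(\<Sum>i<n. card ((\<lambda>j. hyp (\<alpha> i) \<inter> hyp (\<alpha> j)) ` {..<i}))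
        = (\<Sum>i<n. card ((\<lambda>j. hyp (\<alpha>0 i) \<inter> hyp (\<alpha>0 j)) ` {..<i}))"
      by (simp only: of_nat_eq_iff)
    then have top: "fs.dim (logder n \<alpha> n) = fs.dim (logder n \<alpha>0 n)"
      using dim_logder_large_degree[OF A n] dim_logder_large_degree[OF A0 n] by simp
    have "fs.dim (logder n \<alpha>0 j) \<le> fs.dim (logder n \<alpha> j)" if "j \<le> n" for j
      by (rule dim_logder_semicontinuous[OF lw A A0 l l0 surj semi top that])
    moreover have "d1 \<le> n" "d2 \<le> n" "d3 \<le> n" using d by auto
    ultimately have "\<Xi>1 \<alpha> \<in> logder n \<alpha> d1" "\<Xi>2 \<alpha> \<in> logder n \<alpha> d2" "\<Xi>3 \<alpha> \<in> logder n \<alpha> d3"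
      using t1 t2 t3 A p by (auto simp: p_def)
    moreover have "D \<alpha> \<noteq> 0" using p by (auto simp: p_def)
    ultimately show ?thesis using saito_free[OF A _ _ _ d] unfolding D_def by blast
  qed
  ultimately show ?thesis using that by blast
qed

section \<open>Multihomogeneous components\<close>

abbreviation (input) "mkeys \<equiv> Poly_Mapping.keys"
abbreviation (input) "coef \<equiv> Poly_Mapping.lookup"
abbreviation (input) "msingle \<equiv> Poly_Mapping.single"

section \<open>Evaluation of polynomials in the 3n coordinates\<close>

definition monom_eval :: "((nat \<times> 3) \<Rightarrow>\<^sub>0 nat) \<Rightarrow> (nat \<Rightarrow> complex^3) \<Rightarrow> complex" where
  "monom_eval m \<alpha> = (\<Prod>v\<in>mkeys m. (\<alpha> (fst v) $ snd v) ^ coef m v)"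

lemma mpeval_eq: "mpeval P \<alpha> = (\<Sum>m\<in>mkeys P. coef P m * monom_eval m \<alpha>)"
  by (simp add: mpeval_def monom_eval_def)

lemma monom_eval_superset:
  assumes "finite V" "mkeys m \<subseteq> V"
  shows "monom_eval m \<alpha> = (\<Prod>v\<in>V. (\<alpha> (fst v) $ snd v) ^ coef m v)"
  unfolding monom_eval_def using assms
  by (intro prod.mono_neutral_left) (auto simp: in_keys_iff)

lemma monom_eval_add: "monom_eval (m + m') \<alpha> = monom_eval m \<alpha> * monom_eval m' \<alpha>"
proof -
  let ?V = "mkeys m \<union> mkeys m'"
  have "mkeys (m + m') \<subseteq> ?V" by (rule Poly_Mapping.keys_add)
  then show ?thesis
    using monom_eval_superset[of ?V "m + m'"] monom_eval_superset[of ?V m] monom_eval_superset[of ?V m']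
    by (simp add: lookup_add power_add prod.distrib)
qed

lemma monom_eval_single: "monom_eval (msingle v 1) \<alpha> = \<alpha> (fst v) $ snd v"
  by (simp add: monom_eval_def)

lemma mpeval_superset:
  assumes "finite M" "mkeys P \<subseteq> M"
  shows "mpeval P \<alpha> = (\<Sum>m\<in>M. coef P m * monom_eval m \<alpha>)"
  unfolding mpeval_eq using assms by (intro sum.mono_neutral_left) (auto simp: in_keys_iff)

lemma mpeval_add: "mpeval (P + Q) \<alpha> = mpeval P \<alpha> + mpeval Q \<alpha>"
proof -
  let ?M = "mkeys P \<union> mkeys Q"
  have "mkeys (P + Q) \<subseteq> ?M" by (rule Poly_Mapping.keys_add)
  then show ?thesis
    using mpeval_superset[of ?M "P + Q"] mpeval_superset[of ?M P] mpeval_superset[of ?M Q]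
    by (simp add: lookup_add distrib_right sum.distrib)
qed

lemma mpeval_0: "mpeval 0 \<alpha> = 0"
  by (simp add: mpeval_eq)

lemma mpeval_sum: "mpeval (\<Sum>i\<in>I. P i) \<alpha> = (\<Sum>i\<in>I. mpeval (P i) \<alpha>)"
  by (induction I rule: infinite_finite_induct) (auto simp: mpeval_0 mpeval_add)

lemma mpeval_single: "mpeval (msingle m c) \<alpha> = c * monom_eval m \<alpha>"
  by (cases "c = 0") (simp_all add: mpeval_eq)

lemma keys_sum_single: "mkeys (\<Sum>m\<in>M. msingle (g m) (c m)) \<subseteq> g ` M"
proof (induction M rule: infinite_finite_induct)
  case (insert m M)
  have "mkeys (msingle (g m) (c m) + (\<Sum>m\<in>M. msingle (g m) (c m)))
      \<subseteq> mkeys (msingle (g m) (c m)) \<union> mkeys (\<Sum>m\<in>M. msingle (g m) (c m))"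
    by (rule Poly_Mapping.keys_add)
  also have "\<dots> \<subseteq> insert (g m) (g ` M)" using insert.IH by auto
  finally show ?case using insert.hyps by simp
qed auto

lemma polyfun_imp_mpeval:
  assumes "polyfun n p"
  shows "\<exists>P. (\<forall>m\<in>mkeys P. \<forall>v\<in>mkeys m. fst v < n) \<and> (\<forall>\<alpha>. mpeval P \<alpha> = p \<alpha>)"
  using assms
proof (induction rule: polyfun.induct)
  case (polyfun_const c)
  have "mpeval (msingle 0 c) \<alpha> = c" for \<alpha> by (simp add: mpeval_single monom_eval_def)
  moreover have "\<forall>m\<in>mkeys (msingle (0 :: (nat \<times> 3) \<Rightarrow>\<^sub>0 nat) c). \<forall>v\<in>mkeys m. fst v < n"
    by simp
  ultimately show ?case by blast
next
  case (polyfun_add p q)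
  then obtain P Q where "\<forall>m\<in>mkeys P. \<forall>v\<in>mkeys m. fst v < n" "\<forall>\<alpha>. mpeval P \<alpha> = p \<alpha>"
    "\<forall>m\<in>mkeys Q. \<forall>v\<in>mkeys m. fst v < n" "\<forall>\<alpha>. mpeval Q \<alpha> = q \<alpha>" by blast
  moreover from calculation have "\<forall>m\<in>mkeys (P + Q). \<forall>v\<in>mkeys m. fst v < n"
    using Poly_Mapping.keys_add[of P Q] by blast
  ultimately show ?case by (intro exI[of _ "P + Q"]) (simp add: mpeval_add)
next
  case (polyfun_coord_mult i p k)
  then obtain P where P: "\<forall>m\<in>mkeys P. \<forall>v\<in>mkeys m. fst v < n" "\<forall>\<alpha>. mpeval P \<alpha> = p \<alpha>" by blast
  let ?g = "\<lambda>m. msingle (i, k) 1 + m"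
  let ?P = "\<Sum>m\<in>mkeys P. msingle (?g m) (coef P m)"
  have "mpeval ?P \<alpha> = \<alpha> i $ k * p \<alpha>" for \<alpha>
  proof -
    have "mpeval ?P \<alpha> = (\<Sum>m\<in>mkeys P. \<alpha> i $ k * (coef P m * monom_eval m \<alpha>))"
      unfolding mpeval_sum mpeval_single monom_eval_add monom_eval_single by (simp add: mult_ac)
    also have "\<dots> = \<alpha> i $ k * mpeval P \<alpha>" by (simp add: mpeval_eq sum_distrib_left)
    finally show ?thesis using P(2) by simp
  qed
  moreover have "fst v < n" if "m \<in> mkeys ?P" "v \<in> mkeys m" for m v
  proof -
    have "m \<in> ?g ` mkeys P" by (rule subsetD[OF keys_sum_single that(1)])
    then obtain m' where m': "m' \<in> mkeys P" "m = ?g m'" by blast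
    then have "v = (i, k) \<or> v \<in> mkeys m'"
      using that(2) Poly_Mapping.keys_add[of "msingle (i, k) 1" m'] by auto
    then show ?thesis using P(1) m'(1) \<open>i < n\<close> by auto
  qed
  ultimately show ?case by blast
qed

text \<open>Set to 0 from n on, so that multidegrees with the same entries below n are equal as
  functions.\<close>

definition mdeg :: "nat \<Rightarrow> ((nat \<times> 3) \<Rightarrow>\<^sub>0 nat) \<Rightarrow> nat \<Rightarrow> nat" where
  "mdeg n m = (\<lambda>i. if i < n then \<Sum>k\<in>UNIV. coef m (i, k) else 0)"

definition mcomp :: "nat \<Rightarrow> mpoly \<Rightarrow> (nat \<Rightarrow> nat) \<Rightarrow> mpoly" where
  "mcomp n P d = (\<Sum>m\<in>{m\<in>mkeys P. mdeg n m = d}. msingle m (coef P m))"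

lemma keys_mcomp: "mkeys (mcomp n P d) \<subseteq> {m\<in>mkeys P. mdeg n m = d}"
  using keys_sum_single[of "\<lambda>m. m"] unfolding mcomp_def by fastforce

lemma multihomogeneous_mcomp:
  assumes "\<forall>m\<in>mkeys P. \<forall>v\<in>mkeys m. fst v < n"
  shows "multihomogeneous n (mcomp n P d)"
proof -
  have "(\<Sum>k\<in>UNIV. coef m (i, k)) = d i" if "m \<in> mkeys (mcomp n P d)" "i < n" for m i
    using that keys_mcomp[of n P d] by (auto simp: mdeg_def)
  then show ?thesis using assms keys_mcomp[of n P d] unfolding multihomogeneous_def by blast
qed

lemma mpeval_sum_mcomp: "mpeval P \<alpha> = (\<Sum>d\<in>mdeg n ` mkeys P. mpeval (mcomp n P d) \<alpha>)"
  unfolding mcomp_def mpeval_sum mpeval_single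
  by (subst sum.group) (auto simp: mpeval_eq)

lemma monom_eval_scale:
  assumes "j < n"
  shows "monom_eval m (\<alpha>(j := t *s \<alpha> j)) = t ^ mdeg n m j * monom_eval m \<alpha>"
proof -
  let ?V = "mkeys m \<union> {j} \<times> UNIV"
  let ?f = "\<lambda>v. (\<alpha> (fst v) $ snd v) ^ coef m v"
  have "monom_eval m (\<alpha>(j := t *s \<alpha> j)) = (\<Prod>v\<in>?V. (if fst v = j then t ^ coef m v else 1) * ?f v)"
    unfolding monom_eval_superset[of ?V m, OF _ Un_upper1, simplified]
    by (intro prod.cong refl) (auto simp: power_mult_distrib)
  also have "\<dots> = (\<Prod>v\<in>?V. if fst v = j then t ^ coef m v else 1) * monom_eval m \<alpha>"
    unfolding prod.distrib using monom_eval_superset[of ?V m \<alpha>] by simp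
  also have "(\<Prod>v\<in>?V. if fst v = j then t ^ coef m v else 1)
      = (\<Prod>v\<in>{j} \<times> UNIV. if fst v = j then t ^ coef m v else 1)"
    by (intro prod.mono_neutral_right) auto
  also have "\<dots> = (\<Prod>k\<in>UNIV. t ^ coef m (j, k))"
    by (rule prod.reindex_bij_witness[of _ "\<lambda>k. (j, k)" snd]) auto
  also have "\<dots> = t ^ mdeg n m j" using assms by (simp add: mdeg_def power_sum)
  finally show ?thesis .
qed

lemma mpeval_mcomp_scale:
  assumes "j < n"
  shows "mpeval (mcomp n P d) (\<alpha>(j := t *s \<alpha> j)) = t ^ d j * mpeval (mcomp n P d) \<alpha>"
  unfolding mcomp_def mpeval_sum mpeval_single sum_distrib_left
  using monom_eval_scale[OF assms] by (intro sum.cong refl) auto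

text \<open>Rescaling form j by t stays in \<open>Z\<close> and makes the sum of the components a
  polynomial in t that vanishes for all t \<noteq> 0, so its part of degree \<open>e j\<close> in
  form j vanishes on \<open>Z\<close> by itself. Treating the n forms in turn isolates the component
  of multidegree e.\<close>

lemma mcomp_vanishing:
  assumes Z: "\<And>\<alpha> j t. \<alpha> \<in> Z \<Longrightarrow> j < n \<Longrightarrow> t \<noteq> 0 \<Longrightarrow> \<alpha>(j := t *s \<alpha> j) \<in> Z"
    and zero: "\<And>\<alpha>. \<alpha> \<in> Z \<Longrightarrow> mpeval P \<alpha> = 0" and \<alpha>: "\<alpha> \<in> Z"
  shows "mpeval (mcomp n P e) \<alpha> = 0"
proof (cases "e \<in> mdeg n ` mkeys P")
  case False
  then have "{m\<in>mkeys P. mdeg n m = e} = {}" by auto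
  then show ?thesis by (simp only: mcomp_def sum.empty mpeval_0)
next
  case True
  let ?D = "\<lambda>j. {d \<in> mdeg n ` mkeys P. \<forall>i<j. d i = e i}"
  have "(\<Sum>d\<in>?D j. mpeval (mcomp n P d) \<alpha>) = 0" if "j \<le> n" "\<alpha> \<in> Z" for j \<alpha>
    using that
  proof (induction j arbitrary: \<alpha>)
    case 0
    then show ?case using zero[OF 0(2)] mpeval_sum_mcomp[of P \<alpha> n] by simp
  next
    case (Suc j)
    let ?p = "\<Sum>d\<in>?D j. monom (mpeval (mcomp n P d) \<alpha>) (d j)"
    have "poly ?p t = 0" if "t \<notin> {0}" for t
    proof -
      have "\<alpha>(j := t *s \<alpha> j) \<in> Z" using Z Suc.prems that by simp
      then have "(\<Sum>d\<in>?D j. mpeval (mcomp n P d) (\<alpha>(j := t *s \<alpha> j))) = 0" using Suc.IH Suc.prems by simp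
      then show ?thesis using Suc.prems
        by (simp add: mpeval_mcomp_scale poly_sum poly_monom mult.commute)
    qed
    then have "?p = 0" by (intro poly_eq_0_cofinite[of "{0}"]) auto
    from arg_cong[OF this, of "\<lambda>p. coeff p (e j)"]
    have "(\<Sum>d\<in>?D j. if d j = e j then mpeval (mcomp n P d) \<alpha> else 0) = 0" by (simp add: coeff_sum)
    moreover have "?D (Suc j) = {d \<in> ?D j. d j = e j}" by (auto simp: less_Suc_eq)
    moreover have "finite (?D j)" by simp
    then have "(\<Sum>d\<in>{d \<in> ?D j. d j = e j}. mpeval (mcomp n P d) \<alpha>)
        = (\<Sum>d\<in>?D j. if d j = e j then mpeval (mcomp n P d) \<alpha> else 0)"
      by (rule sum.inter_filter)
    ultimately show ?case by (simp only:)
  qed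
  from this[of n, OF order_refl \<alpha>] have "(\<Sum>d\<in>?D n. mpeval (mcomp n P d) \<alpha>) = 0" .
  moreover have "?D n = {e}"
  proof -
    have "d = e" if "d \<in> mdeg n ` mkeys P" "\<forall>i<n. d i = e i" for d
      using that True by (auto simp: mdeg_def fun_eq_iff)
    then show ?thesis using True by auto
  qed
  ultimately show ?thesis by simp
qed

text \<open>Scaling \<alpha>_j by t \<noteq> 0 leaves its plane unchanged, and the lattice,
  distinctness and tangency can all be expressed through the planes, up to nonzero factors.\<close>

lemma scaled_arrangement:
  assumes "t \<noteq> 0" "j < n"
  shows "in_C n f (\<alpha>(j := t *s \<alpha> j)) = in_C n f \<alpha>"
    and "arrangement n \<alpha> \<Longrightarrow> is_free n (\<alpha>(j := t *s \<alpha> j)) = is_free n \<alpha>"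
proof -
  let ?\<beta> = "\<alpha>(j := t *s \<alpha> j)"
  have pair: "pairing (?\<beta> i) x = (if i = j then t else 1) * pairing (\<alpha> i) x" for i x
    by (simp add: pairing_simps)
  then have hyp: "hyp (?\<beta> i) = hyp (\<alpha> i)" for i using assms
    by (auto simp: mem_hyp simp del: fun_upd_apply split: if_splits)
  have "hyp ` ?\<beta> ` I = hyp ` \<alpha> ` I" for I unfolding image_image hyp ..
  then have cp: "charpoly n ?\<beta> = charpoly n \<alpha>" by (simp only: charpoly_def intlat_def)
  have nz: "?\<beta> i = 0 \<longleftrightarrow> \<alpha> i = 0" for i using assms by simp
  have prp: "proportional a b \<longleftrightarrow> hyp a = hyp b" if "a \<noteq> 0" "b \<noteq> 0" for a b
    using hyp_subset_hyp_iff[OF that] hyp_subset_hyp_iff[OF that(2,1)] proportional_sym by blast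
  have arr_iff: "arrangement n \<gamma> \<longleftrightarrow> (\<forall>i<n. \<gamma> i \<noteq> 0) \<and> (\<forall>i<n. \<forall>j<n. i \<noteq> j \<longrightarrow> hyp (\<gamma> i) \<noteq> hyp (\<gamma> j))" for \<gamma>
    unfolding arrangement_def using prp by blast
  have arr: "arrangement n ?\<beta> = arrangement n \<alpha>"
    by (simp only: arr_iff hyp nz)
  then show "in_C n f ?\<beta> = in_C n f \<alpha>" by (simp only: in_C_iff cp)
  assume A: "arrangement n \<alpha>"
  have c: "((if i = j then t else 1) = 0) = False" for i using assms by simp
  have "derivation_module n ?\<beta> = derivation_module n \<alpha>"
    by (auto simp: c derivation_module_iff[OF A] derivation_module_iff[of n ?\<beta>, unfolded arr, OF A] hyp pair
      simp del: fun_upd_apply)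
  then show "is_free n ?\<beta> = is_free n \<alpha>" by (simp only: is_free_def)
qed

theorem theorem1p41:
  fixes n :: nat and f :: "int poly"
  assumes "n \<ge> 1"
  shows "\<exists>P :: mpoly set. (\<forall>p\<in>P. multihomogeneous n p) \<and>
           (\<forall>\<alpha>. in_C n f \<alpha> \<longrightarrow> (is_free n \<alpha> \<longleftrightarrow> \<not> (\<forall>p\<in>P. mpeval p \<alpha> = 0)))"
proof -
  define Z where "Z = {\<alpha>. in_C n f \<alpha> \<and> \<not> is_free n \<alpha>}"
  have Z: "\<alpha>(j := t *s \<alpha> j) \<in> Z" if "\<alpha> \<in> Z" "j < n" "t \<noteq> 0" for \<alpha> j t
    using that scaled_arrangement[OF that(3,2)] by (simp add: Z_def in_C_iff del: fun_upd_apply)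
  \<comment> \<open>With all multihomogeneous polynomials vanishing on \<open>Z\<close>, the
    arrangements that are not free satisfy the equations by definition; what remains is to find, at
    each free arrangement, one member of \<open>P\<close> that does not vanish.\<close>
  define P where "P = {p. multihomogeneous n p \<and> (\<forall>\<alpha>\<in>Z. mpeval p \<alpha> = 0)}"
  have "\<exists>p\<in>P. mpeval p \<alpha> \<noteq> 0" if \<alpha>: "in_C n f \<alpha>" "is_free n \<alpha>" for \<alpha>
  proof -
    obtain g where g: "polyfun n g" "g \<alpha> \<noteq> 0" "\<And>\<beta>. in_C n f \<beta> \<Longrightarrow> g \<beta> \<noteq> 0 \<Longrightarrow> is_free n \<beta>"
      using free_locus_locally_open[OF assms \<alpha>] by blast
    obtain G where G: "\<forall>m\<in>mkeys G. \<forall>v\<in>mkeys m. fst v < n" "\<And>\<beta>. mpeval G \<beta> = g \<beta>"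
      using polyfun_imp_mpeval[OF g(1)] by blast
    have "mpeval G \<beta> = 0" if "\<beta> \<in> Z" for \<beta> using that g(3) G(2) by (auto simp: Z_def)
    then have "mcomp n G d \<in> P" for d
      using mcomp_vanishing[of Z n G] Z multihomogeneous_mcomp[OF G(1)] by (simp add: P_def)
    moreover have "\<exists>d. mpeval (mcomp n G d) \<alpha> \<noteq> 0"
      using g(2) G(2)[of \<alpha>] mpeval_sum_mcomp[of G \<alpha> n] by (metis sum.neutral)
    ultimately show ?thesis by blast
  qed
  then show ?thesis by (intro exI[of _ P]) (auto simp: P_def Z_def)
qed

end
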